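(* Let $\kappa$ be an uncountable regular cardinal and let $S\subseteq[H_\kappa]^\omega$ be stationary. Then $S$ is spread out if and only if the forcing $\mathbb{P}_S$ is $\infty$-subcomplete.
   Context: $[H_\kappa]^\omega$ is the set of countable subsets of $H_\kappa$ (club/stationary in Jech's generalized sense). $\mathbb{P}_S$ consists of continuous $\in$-chains through $S$ of countable successor length (sequences $\langle X_i:i\le\ell\rangle$ of members of $S$, $\in$-increasing, with $X_j=\bigcup_{i<j}X_i$ at limits $j$), ordered by end-extension. For a set $A$, $L_\tau^A=\langle L_\tau[A],\in,A\cap L_\tau[A]\rangle$ (relativized constructibility). A transitive model $N$ of $\mathsf{ZFC}^-$ is full if there is an ordinal $\gamma>0$ with $L_\gamma(N)\models\mathsf{ZFC}^-$ and $N$ regular in $L_\gamma(N)$ (i.e. if $a\in N$, $f:a\to N$, $f\in L_\gamma(N)$, then $\mathrm{ran}(f)\in N$); a well-founded model is full if its transitive collapse is. For a model $N$ and $X\subseteq|N|$, $N|X$ is the restriction of $N$ to $X$. A stationary $S\subseteq[H_\kappa]^\omega$ is spread out if for every sufficiently large cardinal $\theta$: whenever $\tau,A,X,a$ are such that $H_\theta\subseteq L_\tau^A=N\models\mathsf{ZFC}^-$, $S,a,\theta\in X$, $N|X\prec N$ and $N|X$ is countable and full, then there are $Y$ with $N|Y\prec N$ and an isomorphism $\pi:N|X\to N|Y$ with $\pi(a)=a$ and $Y\cap H_\kappa\in S$. A forcing $\mathbb{P}$ is $\infty$-subcomplete if every sufficiently large cardinal $\theta$ satisfies: $\mathbb{P}\in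 H_\theta$, and for any $\mathsf{ZFC}^-$ model $N=L_\tau^A$ with $\theta<\tau$ and $H_\theta\subseteq N$, any $\sigma:\bar N\prec N$ with $\bar N$ countable, transitive and full and $\mathbb{P},\theta\in\mathrm{ran}(\sigma)$, writing $\sigma(\langle\bar\theta,\bar{\mathbb{P}}\rangle)=\langle\theta,\mathbb{P}\rangle$, any $\bar G\subseteq\bar{\mathbb{P}}$ generic over $\bar N$ and any $\bar s\in\bar N$, there is a condition $p\in\mathbb{P}$ such that whenever $G\ni p$ is $\mathbb{P}$-generic over $V$, there is in $V[G]$ a $\sigma':\bar N\prec N$ with $\sigma'(\langle\bar s,\bar\theta,\bar{\mathbb{P}}\rangle)=\sigma(\langle\bar s,\bar\theta,\bar{\mathbb{P}}\rangle)$ and $\sigma'``\bar G\subseteq G$. *)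

theory Defs
  imports "HOL-Library.Countable_Set" "HOL-Library.Equipollence"
begin

section \<open>The universe of sets\<close>

text \<open>
  The set-theoretic universe is a type of the following class, and its classes are the HOL
  predicates on that type. In Separation and Replacement arbitrary HOL sets and functions play the
  role of classes, and the axiom of choice comes from Hilbert choice. Consequently HOL
  functions, relations and cardinality comparisons restricted to (extensions of) sets mean the same
  as their internal counterparts.
\<close>

class zfc =
  fixes elts :: "'a \<Rightarrow> 'a set"
  assumes extensionality: "elts x = elts y \<Longrightarrow> x = y"
    and foundation: "wf {(x, y). x \<in> elts y}"
    and pairing: "\<exists>z. elts z = {x, y}"
    and union: "\<exists>z. elts z = (\<Union>y\<in>elts x. elts y)"
    and power_set: "\<exists>z. elts z = {y. elts y \<subseteq> elts x}"
    and separation: "Y \<subseteq> elts x \<Longrightarrow> \<exists>z. elts z = Y"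
    and replacement: "\<exists>z. elts z = f ` elts x"
    and infinity: "\<exists>x. (\<exists>e\<in>elts x. elts e = {}) \<and>
                       (\<forall>n\<in>elts x. \<exists>s\<in>elts x. elts s = insert n (elts n))"

definition mem_rel :: "('v::zfc \<times> 'v) set"
  where "mem_rel = {(x, y). x \<in> elts y}"

text \<open>Meaningful only if the argument is the extension of a set.\<close>
definition vset :: "'v::zfc set \<Rightarrow> 'v"
  where "vset X = (THE x. elts x = X)"

definition vpair :: "'v::zfc \<Rightarrow> 'v \<Rightarrow> 'v"
  where "vpair x y = vset {vset {x, x}, vset {x, y}}"

definition vfst :: "'v::zfc \<Rightarrow> 'v"
  where "vfst p = (THE x. \<exists>y. p = vpair x y)"

definition vsnd :: "'v::zfc \<Rightarrow> 'v"
  where "vsnd p = (THE y. \<exists>x. p = vpair x y)"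

lemma wf_mem_rel: "wf (mem_rel :: ('v::zfc \<times> 'v) set)"
  unfolding mem_rel_def by (rule foundation)

lemma wf_mem_rel_trancl: "wf ((mem_rel :: ('v::zfc \<times> 'v) set)\<^sup>+)"
  by (rule wf_trancl[OF wf_mem_rel])

lemma mem_rel_iff: "(x, y) \<in> mem_rel \<longleftrightarrow> x \<in> elts y"
  by (simp add: mem_rel_def)

lemma elts_vset: "elts x = X \<Longrightarrow> elts (vset X) = X"
  unfolding vset_def by (rule theI2[of _ x]) (auto intro: extensionality)

lemma elts_vset_upair [simp]: "elts (vset {x, y}) = {x, y :: 'v::zfc}"
  using pairing[of x y] elts_vset by blast

lemma elts_vpair: "elts (vpair x y) = {vset {x, x}, vset {x, y :: 'v::zfc}}"
  unfolding vpair_def by (rule elts_vset_upair)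

lemma vpair_inject [simp]: "vpair x y = vpair x' y' \<longleftrightarrow> x = x' \<and> y = (y' :: 'v::zfc)"
proof
  assume eq: "vpair x y = vpair x' y'"
  have up: "vset {a, b} = vset {c, d} \<longleftrightarrow> {a, b} = {c, d}" for a b c d :: 'v
    by (metis elts_vset_upair)
  have "{vset {x, x}, vset {x, y}} = {vset {x', x'}, vset {x', y'}}"
    using eq by (metis elts_vpair)
  then show "x = x' \<and> y = y'"
    unfolding doubleton_eq_iff up by auto
qed simp

lemma vfst_vpair [simp]: "vfst (vpair x y) = x"
  and vsnd_vpair [simp]: "vsnd (vpair x y) = y"
  by (simp_all add: vfst_def vsnd_def)

lemma vpair_fst_mem_trancl:
  assumes "vpair c r \<in> elts a"
  shows "(c, a) \<in> mem_rel\<^sup>+"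
proof -
  have "(c, vset {c, c}) \<in> mem_rel" "(vset {c, c}, vpair c r) \<in> mem_rel" "(vpair c r, a) \<in> mem_rel"
    using assms elts_vset_upair[of c c] by (auto simp: mem_rel_def elts_vpair simp del: elts_vset_upair)
  then show ?thesis by (meson r_into_trancl trancl_trans)
qed


section \<open>Ordinals, cardinals, and the sets hereditarily smaller than a cardinal\<close>

definition vtransitive :: "'v::zfc \<Rightarrow> bool"
  where "vtransitive x \<longleftrightarrow> (\<forall>y\<in>elts x. elts y \<subseteq> elts x)"

definition Ord :: "'v::zfc \<Rightarrow> bool"
  where "Ord \<alpha> \<longleftrightarrow> vtransitive \<alpha> \<and> (\<forall>\<beta>\<in>elts \<alpha>. vtransitive \<beta>)"

definition Limit :: "'v::zfc \<Rightarrow> bool"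
  where "Limit \<alpha> \<longleftrightarrow> Ord \<alpha> \<and> elts \<alpha> \<noteq> {} \<and> (\<forall>\<beta>\<in>elts \<alpha>. \<exists>\<gamma>\<in>elts \<alpha>. \<beta> \<in> elts \<gamma>)"

definition Card :: "'v::zfc \<Rightarrow> bool"
  where "Card \<kappa> \<longleftrightarrow> Ord \<kappa> \<and> (\<forall>\<alpha>\<in>elts \<kappa>. elts \<alpha> \<prec> elts \<kappa>)"

definition regular_cardinal :: "'v::zfc \<Rightarrow> bool"
  where "regular_cardinal \<kappa> \<longleftrightarrow> Card \<kappa> \<and> infinite (elts \<kappa>) \<and>
    (\<forall>X. X \<subseteq> elts \<kappa> \<and> X \<prec> elts \<kappa> \<longrightarrow> (\<exists>\<beta>\<in>elts \<kappa>. X \<subseteq> elts \<beta>))"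

definition TC :: "'v::zfc \<Rightarrow> 'v set"
  where "TC x = {y. (y, x) \<in> mem_rel\<^sup>+}"

definition H :: "'v::zfc \<Rightarrow> 'v set"
  where "H \<kappa> = {x. TC x \<prec> elts \<kappa>}"


section \<open>Generalized club and stationary sets\<close>

definition ctbl_subsets :: "'v::zfc set \<Rightarrow> 'v set"
  where "ctbl_subsets Z = {x. elts x \<subseteq> Z \<and> countable (elts x)}"

definition club :: "'v::zfc set \<Rightarrow> 'v set \<Rightarrow> bool"
  where "club Z C \<longleftrightarrow> C \<subseteq> ctbl_subsets Z \<and>
    (\<forall>x\<in>ctbl_subsets Z. \<exists>y\<in>C. elts x \<subseteq> elts y) \<and>
    (\<forall>f::nat \<Rightarrow> 'v. (\<forall>n. f n \<in> C \<and> elts (f n) \<subseteq> elts (f (Suc n))) \<longrightarrow>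
       (\<exists>y\<in>C. elts y = (\<Union>n. elts (f n))))"

definition stationary :: "'v::zfc set \<Rightarrow> 'v \<Rightarrow> bool"
  where "stationary Z S \<longleftrightarrow> elts S \<subseteq> ctbl_subsets Z \<and> (\<forall>C. club Z C \<longrightarrow> elts S \<inter> C \<noteq> {})"


section \<open>First-order structures $\langle M, \in, A\rangle$\<close>

text \<open>
  Formulas in the language with membership, equality and one unary predicate, over variables
  numbered by natural numbers. Pure \<open>\<in>\<close>-structures are those with empty predicate.
\<close>

datatype fm = Mem nat nat | Eq nat nat | Pr nat | Neg fm | Conj fm fm | All nat fm

primrec fv :: "fm \<Rightarrow> nat set" where
  "fv (Mem i j) = {i, j}"
| "fv (Eq i j) = {i, j}"
| "fv (Pr i) = {i}"
| "fv (Neg \<phi>) = fv \<phi>"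
| "fv (Conj \<phi> \<psi>) = fv \<phi> \<union> fv \<psi>"
| "fv (All n \<phi>) = fv \<phi> - {n}"

primrec sat :: "'v::zfc set \<Rightarrow> 'v set \<Rightarrow> fm \<Rightarrow> (nat \<Rightarrow> 'v) \<Rightarrow> bool" where
  "sat M A (Mem i j) e \<longleftrightarrow> e i \<in> elts (e j)"
| "sat M A (Eq i j) e \<longleftrightarrow> e i = e j"
| "sat M A (Pr i) e \<longleftrightarrow> e i \<in> A"
| "sat M A (Neg \<phi>) e \<longleftrightarrow> \<not> sat M A \<phi> e"
| "sat M A (Conj \<phi> \<psi>) e \<longleftrightarrow> sat M A \<phi> e \<and> sat M A \<psi> e"
| "sat M A (All n \<phi>) e \<longleftrightarrow> (\<forall>x\<in>M. sat M A \<phi> (e(n := x)))"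

text \<open>$\sigma : \langle M,\in,A\rangle \prec \langle N,\in,B\rangle$\<close>
definition elem_emb :: "('v::zfc \<Rightarrow> 'v) \<Rightarrow> 'v set \<Rightarrow> 'v set \<Rightarrow> 'v set \<Rightarrow> 'v set \<Rightarrow> bool"
  where "elem_emb \<sigma> M A N B \<longleftrightarrow> \<sigma> ` M \<subseteq> N \<and>
    (\<forall>\<phi> e. e ` fv \<phi> \<subseteq> M \<longrightarrow> (sat M A \<phi> e \<longleftrightarrow> sat N B \<phi> (\<sigma> \<circ> e)))"

text \<open>$N|X \prec N$ for $N = \langle N,\in,A\rangle$\<close>
definition elem_sub :: "'v::zfc set \<Rightarrow> 'v set \<Rightarrow> 'v set \<Rightarrow> bool"
  where "elem_sub X N A \<longleftrightarrow> elem_emb id X (A \<inter> X) N A"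

definition struct_iso :: "('v::zfc \<Rightarrow> 'v) \<Rightarrow> 'v set \<Rightarrow> 'v set \<Rightarrow> 'v set \<Rightarrow> 'v set \<Rightarrow> bool"
  where "struct_iso \<pi> M A N B \<longleftrightarrow> bij_betw \<pi> M N \<and>
    (\<forall>x\<in>M. \<forall>y\<in>M. x \<in> elts y \<longleftrightarrow> \<pi> x \<in> elts (\<pi> y)) \<and> (\<forall>x\<in>M. x \<in> A \<longleftrightarrow> \<pi> x \<in> B)"

text \<open>Subsets of \<open>M\<close> definable over $\langle M,\in,A\rangle$ with parameters; 0 is the subject variable.\<close>
definition Defset :: "'v::zfc set \<Rightarrow> 'v set \<Rightarrow> 'v set"
  where "Defset M A =
    {x. \<exists>\<phi> e. e ` (fv \<phi> - {0}) \<subseteq> M \<and> elts x = {y\<in>M. sat M A \<phi> (e(0 := y))}}"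

text \<open>
  $L_\tau[A] = \bigcup_{\alpha<\tau} \mathrm{Def}(L_\alpha[A], A \cap L_\alpha[A])$, which covers the zero, successor
  and limit clauses at once because the hierarchy is increasing. The structure $L_\tau^A$ has
  universe \<open>Lset A \<tau>\<close> and predicate \<open>elts A \<inter> Lset A \<tau>\<close>.
\<close>
function Lset :: "'v::zfc \<Rightarrow> 'v \<Rightarrow> 'v set" where
  "Lset A \<tau> = (\<Union>\<alpha>\<in>elts \<tau>. Defset (Lset A \<alpha>) (elts A \<inter> Lset A \<alpha>))"
  by pat_completeness auto
termination
  by (relation "inv_image mem_rel snd") (simp_all add: wf_inv_image[OF wf_mem_rel] in_inv_image mem_rel_iff)

declare Lset.simps [simp del]

abbreviation Lpred :: "'v::zfc \<Rightarrow> 'v \<Rightarrow> 'v set"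
  where "Lpred A \<tau> \<equiv> elts A \<inter> Lset A \<tau>"

text \<open>$L_\gamma(x)$, starting from the transitive closure of $\{x\}$\<close>
function Lover :: "'v::zfc \<Rightarrow> 'v \<Rightarrow> 'v set" where
  "Lover x \<gamma> = insert x (TC x) \<union> (\<Union>\<alpha>\<in>elts \<gamma>. Defset (Lover x \<alpha>) {})"
  by pat_completeness auto
termination
  by (relation "inv_image mem_rel snd") (simp_all add: wf_inv_image[OF wf_mem_rel] in_inv_image mem_rel_iff)

declare Lover.simps [simp del]


section \<open>Models of ZFC without power set\<close>

text \<open>
  The axioms are written out as their interpretations in $\langle M,\in,A\rangle$; the schemes
  range over all formulas, including the predicate. As usual for this theory, replacement is taken
  in the form of collection and choice in the form of the well-ordering principle.
\<close>

definition upair_in :: "'v::zfc set \<Rightarrow> 'v \<Rightarrow> 'v \<Rightarrow> 'v \<Rightarrow> bool"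
  where "upair_in M z x y \<longleftrightarrow> (\<forall>w\<in>M. w \<in> elts z \<longleftrightarrow> w = x \<or> w = y)"

definition pair_in :: "'v::zfc set \<Rightarrow> 'v \<Rightarrow> 'v \<Rightarrow> 'v \<Rightarrow> bool"
  where "pair_in M z x y \<longleftrightarrow> (\<forall>w\<in>M. w \<in> elts z \<longleftrightarrow> upair_in M w x x \<or> upair_in M w x y)"

definition rel_in :: "'v::zfc set \<Rightarrow> 'v \<Rightarrow> 'v \<Rightarrow> 'v \<Rightarrow> bool"
  where "rel_in M r x y \<longleftrightarrow> (\<exists>z\<in>M. pair_in M z x y \<and> z \<in> elts r)"

definition wellorders_in :: "'v::zfc set \<Rightarrow> 'v \<Rightarrow> 'v \<Rightarrow> bool"
  where "wellorders_in M r x \<longleftrightarrow>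
    (\<forall>u\<in>M \<inter> elts x. \<not> rel_in M r u u) \<and>
    (\<forall>u\<in>M \<inter> elts x. \<forall>v\<in>M \<inter> elts x. \<forall>w\<in>M \<inter> elts x.
       rel_in M r u v \<and> rel_in M r v w \<longrightarrow> rel_in M r u w) \<and>
    (\<forall>s\<in>M. M \<inter> elts s \<noteq> {} \<and> M \<inter> elts s \<subseteq> elts x \<longrightarrow>
       (\<exists>m\<in>M \<inter> elts s. \<forall>u\<in>M \<inter> elts s. u \<noteq> m \<longrightarrow> rel_in M r m u))"

definition ZFC_minus :: "'v::zfc set \<Rightarrow> 'v set \<Rightarrow> bool"
  where "ZFC_minus M A \<longleftrightarrow>
    \<comment> \<open>extensionality\<close>
    (\<forall>x\<in>M. \<forall>y\<in>M. (\<forall>z\<in>M. z \<in> elts x \<longleftrightarrow> z \<in> elts y) \<longrightarrow> x = y) \<and>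
    \<comment> \<open>foundation\<close>
    (\<forall>x\<in>M. (\<exists>y\<in>M. y \<in> elts x) \<longrightarrow> (\<exists>y\<in>M. y \<in> elts x \<and> (\<forall>z\<in>M. \<not> (z \<in> elts x \<and> z \<in> elts y)))) \<and>
    \<comment> \<open>pairing\<close>
    (\<forall>x\<in>M. \<forall>y\<in>M. \<exists>z\<in>M. upair_in M z x y) \<and>
    \<comment> \<open>union\<close>
    (\<forall>x\<in>M. \<exists>u\<in>M. \<forall>z\<in>M. z \<in> elts u \<longleftrightarrow> (\<exists>y\<in>M. y \<in> elts x \<and> z \<in> elts y)) \<and>
    \<comment> \<open>infinity\<close>
    (\<exists>x\<in>M. (\<exists>z\<in>M. z \<in> elts x \<and> (\<forall>w\<in>M. w \<notin> elts z)) \<and>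
       (\<forall>n\<in>M. n \<in> elts x \<longrightarrow>
          (\<exists>s\<in>M. s \<in> elts x \<and> (\<forall>w\<in>M. w \<in> elts s \<longleftrightarrow> w \<in> elts n \<or> w = n)))) \<and>
    \<comment> \<open>separation\<close>
    (\<forall>\<phi> e. e ` (fv \<phi> - {0}) \<subseteq> M \<longrightarrow>
       (\<forall>a\<in>M. \<exists>b\<in>M. \<forall>x\<in>M. x \<in> elts b \<longleftrightarrow> x \<in> elts a \<and> sat M A \<phi> (e(0 := x)))) \<and>
    \<comment> \<open>collection\<close>
    (\<forall>\<phi> e. e ` (fv \<phi> - {0, 1}) \<subseteq> M \<longrightarrow>
       (\<forall>a\<in>M. (\<forall>x\<in>M. x \<in> elts a \<longrightarrow> (\<exists>y\<in>M. sat M A \<phi> (e(0 := x, 1 := y)))) \<longrightarrow>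
          (\<exists>b\<in>M. \<forall>x\<in>M. x \<in> elts a \<longrightarrow>
             (\<exists>y\<in>M. y \<in> elts b \<and> sat M A \<phi> (e(0 := x, 1 := y)))))) \<and>
    \<comment> \<open>well-ordering principle\<close>
    (\<forall>x\<in>M. \<exists>r\<in>M. wellorders_in M r x)"


section \<open>Full models\<close>

text \<open>$N$ is regular in the class $W$: ranges of functions $f\in W$ from $a\in N$ to $N$ are in $N$.\<close>
definition regular_in :: "'v::zfc \<Rightarrow> 'v set \<Rightarrow> bool"
  where "regular_in N W \<longleftrightarrow>
    (\<forall>a\<in>elts N. \<forall>f\<in>W.
       (\<forall>z\<in>elts f. \<exists>x\<in>elts a. \<exists>y\<in>elts N. z = vpair x y) \<and>
       (\<forall>x\<in>elts a. \<exists>!y. vpair x y \<in> elts f) \<longrightarrow>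
       (\<exists>r\<in>elts N. elts r = {y. \<exists>x. vpair x y \<in> elts f}))"

text \<open>
  The structure $\langle N,\in,B\rangle$ is coded by the pair $\langle N,B\rangle$ when forming $L_\gamma$
  over it.
\<close>
definition full :: "'v::zfc \<Rightarrow> 'v \<Rightarrow> bool"
  where "full N B \<longleftrightarrow> vtransitive N \<and> elts B \<subseteq> elts N \<and> ZFC_minus (elts N) (elts B) \<and>
    (\<exists>\<gamma>. Ord \<gamma> \<and> elts \<gamma> \<noteq> {} \<and> ZFC_minus (Lover (vpair N B) \<gamma>) {} \<and>
         regular_in N (Lover (vpair N B) \<gamma>))"

text \<open>$\langle X,\in,A\cap X\rangle$ is isomorphic to a transitive (hence its collapse) full structure.\<close>
definition collapse_full :: "'v::zfc set \<Rightarrow> 'v set \<Rightarrow> bool"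
  where "collapse_full X A \<longleftrightarrow>
    (\<exists>N B \<pi>. full N B \<and> struct_iso \<pi> (elts N) (elts B) X (A \<inter> X))"


section \<open>Spread out sets\<close>

definition suff_large :: "('v::zfc \<Rightarrow> bool) \<Rightarrow> bool"
  where "suff_large P \<longleftrightarrow>
    (\<exists>\<theta>\<^sub>0. Card \<theta>\<^sub>0 \<and> (\<forall>\<theta>. Card \<theta> \<and> elts \<theta>\<^sub>0 \<subseteq> elts \<theta> \<longrightarrow> P \<theta>))"

definition spread_out :: "'v::zfc \<Rightarrow> 'v \<Rightarrow> bool"
  where "spread_out \<kappa> S \<longleftrightarrow> stationary (H \<kappa>) S \<and>
    suff_large (\<lambda>\<theta>. \<forall>\<tau> A X a.
      Ord \<tau> \<and> H \<theta> \<subseteq> Lset A \<tau> \<and> ZFC_minus (Lset A \<tau>) (Lpred A \<tau>) \<and>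
      X \<subseteq> Lset A \<tau> \<and> S \<in> X \<and> a \<in> X \<and> \<theta> \<in> X \<and>
      elem_sub X (Lset A \<tau>) (Lpred A \<tau>) \<and> countable X \<and> collapse_full X (Lpred A \<tau>) \<longrightarrow>
      (\<exists>Y \<pi>. Y \<subseteq> Lset A \<tau> \<and> elem_sub Y (Lset A \<tau>) (Lpred A \<tau>) \<and>
         struct_iso \<pi> X (Lpred A \<tau> \<inter> X) Y (Lpred A \<tau> \<inter> Y) \<and> \<pi> a = a \<and>
         (\<exists>s\<in>elts S. elts s = Y \<inter> H \<kappa>)))"


section \<open>Forcing\<close>

text \<open>
  A forcing is a nonempty preorder, coded as a pair of a carrier and an order relation. It need not have
  a largest element.
\<close>

definition conds :: "'v::zfc \<Rightarrow> 'v set"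
  where "conds P = elts (vfst P)"

definition le :: "'v::zfc \<Rightarrow> 'v \<Rightarrow> 'v \<Rightarrow> bool"
  where "le P q p \<longleftrightarrow> q \<in> conds P \<and> p \<in> conds P \<and> vpair q p \<in> elts (vsnd P)"

definition forcing :: "'v::zfc \<Rightarrow> bool"
  where "forcing P \<longleftrightarrow> (\<exists>C R. P = vpair C R) \<and> conds P \<noteq> {} \<and>
    (\<forall>z\<in>elts (vsnd P). \<exists>q\<in>conds P. \<exists>p\<in>conds P. z = vpair q p) \<and>
    (\<forall>p\<in>conds P. le P p p) \<and> (\<forall>p q r. le P r q \<and> le P q p \<longrightarrow> le P r p)"

definition dense :: "'v::zfc \<Rightarrow> 'v set \<Rightarrow> bool"
  where "dense P D \<longleftrightarrow> D \<subseteq> conds P \<and> (\<forall>p\<in>conds P. \<exists>q\<in>D. le P q p)"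

definition generic_over :: "'v::zfc set \<Rightarrow> 'v \<Rightarrow> 'v set \<Rightarrow> bool"
  where "generic_over M P G \<longleftrightarrow> G \<subseteq> conds P \<and> G \<noteq> {} \<and>
    (\<forall>p\<in>G. \<forall>q. le P p q \<longrightarrow> q \<in> G) \<and>
    (\<forall>p\<in>G. \<forall>q\<in>G. \<exists>r\<in>G. le P r p \<and> le P r q) \<and>
    (\<forall>D\<in>M. dense P (elts D) \<longrightarrow> G \<inter> elts D \<noteq> {})"

subsection \<open>The forcing relation\<close>

text \<open>
  Truth in the generic extension is expressed by the forcing relation: ``every $V[G]$ with $p \in G$
  satisfies $\Phi$'' means $p \Vdash \Phi$. Every set serves as a name, only its elements of the form
  $\langle c,r\rangle$ with $r$ a condition being relevant (for generic $G$ its value is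
  $\{c^G \mid \langle c,r\rangle \in a, r \in G\}$). Statements of the forcing language are represented
  by the predicate ``forced by'' on conditions; all those built from the operators below
  satisfy: $p \Vdash \Phi$ iff the conditions forcing $\Phi$ are dense below $p$. The quantifiers
  \<open>f_all\<close> and \<open>f_ex\<close> range over names, \<open>f_INF\<close> is an infinitary conjunction indexed in the
  ground model.
\<close>

declare conj_cong [fundef_cong]

function f_eq :: "'v::zfc \<Rightarrow> 'v \<Rightarrow> 'v \<Rightarrow> 'v \<Rightarrow> bool" where
  "f_eq P a b p \<longleftrightarrow>
     (\<forall>c r. vpair c r \<in> elts a \<longrightarrow>
        (\<forall>q. le P q p \<and> le P q r \<longrightarrow>
           (\<exists>s. le P s q \<and> (\<exists>d t. vpair d t \<in> elts b \<and> le P s t \<and> f_eq P c d s)))) \<and>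
     (\<forall>d t. vpair d t \<in> elts b \<longrightarrow>
        (\<forall>q. le P q p \<and> le P q t \<longrightarrow>
           (\<exists>s. le P s q \<and> (\<exists>c r. vpair c r \<in> elts a \<and> le P s r \<and> f_eq P c d s))))"
  by pat_completeness auto
termination
  by (relation "inv_image (mem_rel\<^sup>+) (\<lambda>(P, a, b, p). a)")
     (auto simp: wf_mem_rel_trancl vpair_fst_mem_trancl)

declare conj_cong [fundef_cong del]
declare f_eq.simps [simp del]

definition f_mem :: "'v::zfc \<Rightarrow> 'v \<Rightarrow> 'v \<Rightarrow> 'v \<Rightarrow> bool"
  where "f_mem P a b p \<longleftrightarrow>
    (\<forall>q. le P q p \<longrightarrow> (\<exists>s. le P s q \<and> (\<exists>d t. vpair d t \<in> elts b \<and> le P s t \<and> f_eq P a d s)))"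

definition f_not :: "'v::zfc \<Rightarrow> ('v \<Rightarrow> bool) \<Rightarrow> 'v \<Rightarrow> bool"
  where "f_not P \<Phi> p \<longleftrightarrow> (\<forall>q. le P q p \<longrightarrow> \<not> \<Phi> q)"

definition f_and :: "('v::zfc \<Rightarrow> bool) \<Rightarrow> ('v \<Rightarrow> bool) \<Rightarrow> 'v \<Rightarrow> bool"
  where "f_and \<Phi> \<Psi> p \<longleftrightarrow> \<Phi> p \<and> \<Psi> p"

definition f_or :: "'v::zfc \<Rightarrow> ('v \<Rightarrow> bool) \<Rightarrow> ('v \<Rightarrow> bool) \<Rightarrow> 'v \<Rightarrow> bool"
  where "f_or P \<Phi> \<Psi> p \<longleftrightarrow> (\<forall>q. le P q p \<longrightarrow> (\<exists>s. le P s q \<and> (\<Phi> s \<or> \<Psi> s)))"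

definition f_imp :: "'v::zfc \<Rightarrow> ('v \<Rightarrow> bool) \<Rightarrow> ('v \<Rightarrow> bool) \<Rightarrow> 'v \<Rightarrow> bool"
  where "f_imp P \<Phi> \<Psi> p \<longleftrightarrow> (\<forall>q. le P q p \<longrightarrow> \<Phi> q \<longrightarrow> \<Psi> q)"

definition f_iff :: "'v::zfc \<Rightarrow> ('v \<Rightarrow> bool) \<Rightarrow> ('v \<Rightarrow> bool) \<Rightarrow> 'v \<Rightarrow> bool"
  where "f_iff P \<Phi> \<Psi> = f_and (f_imp P \<Phi> \<Psi>) (f_imp P \<Psi> \<Phi>)"

definition f_INF :: "'i set \<Rightarrow> ('i \<Rightarrow> 'v::zfc \<Rightarrow> bool) \<Rightarrow> 'v \<Rightarrow> bool"
  where "f_INF I \<Phi> p \<longleftrightarrow> (\<forall>i\<in>I. \<Phi> i p)"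

definition f_all :: "('v::zfc \<Rightarrow> 'v \<Rightarrow> bool) \<Rightarrow> 'v \<Rightarrow> bool"
  where "f_all \<Phi> p \<longleftrightarrow> (\<forall>x. \<Phi> x p)"

definition f_ex :: "'v::zfc \<Rightarrow> ('v \<Rightarrow> 'v \<Rightarrow> bool) \<Rightarrow> 'v \<Rightarrow> bool"
  where "f_ex P \<Phi> p \<longleftrightarrow> (\<forall>q. le P q p \<longrightarrow> (\<exists>s. le P s q \<and> (\<exists>x. \<Phi> x s)))"

text \<open>Canonical names for ground model sets, and for the generic filter.\<close>

function check :: "'v::zfc \<Rightarrow> 'v \<Rightarrow> 'v" where
  "check P x = vset {z. \<exists>y\<in>elts x. \<exists>r\<in>conds P. z = vpair (check P y) r}"
  by pat_completeness auto
termination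
  by (relation "inv_image mem_rel snd") (simp_all add: wf_inv_image[OF wf_mem_rel] in_inv_image mem_rel_iff)

declare check.simps [simp del]

definition gen_name :: "'v::zfc \<Rightarrow> 'v"
  where "gen_name P = vset {vpair (check P r) r | r. r \<in> conds P}"

subsection \<open>Elementary embeddings in the generic extension\<close>

definition f_upair :: "'v::zfc \<Rightarrow> 'v \<Rightarrow> 'v \<Rightarrow> 'v \<Rightarrow> 'v \<Rightarrow> bool"
  where "f_upair P z x y =
    f_all (\<lambda>w. f_iff P (f_mem P w z) (f_or P (f_eq P w x) (f_eq P w y)))"

definition f_pair :: "'v::zfc \<Rightarrow> 'v \<Rightarrow> 'v \<Rightarrow> 'v \<Rightarrow> 'v \<Rightarrow> bool"
  where "f_pair P z x y =
    f_all (\<lambda>w. f_iff P (f_mem P w z) (f_or P (f_upair P w x x) (f_upair P w x y)))"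

text \<open>``$f(x) = y$'', i.e.\ $\langle x,y\rangle\in f$\<close>
definition f_app :: "'v::zfc \<Rightarrow> 'v \<Rightarrow> 'v \<Rightarrow> 'v \<Rightarrow> 'v \<Rightarrow> bool"
  where "f_app P f x y = f_ex P (\<lambda>z. f_and (f_pair P z x y) (f_mem P z f))"

text \<open>``$f$ is a function from $M$ to $N$''\<close>
definition f_fun :: "'v::zfc \<Rightarrow> 'v \<Rightarrow> 'v \<Rightarrow> 'v \<Rightarrow> 'v \<Rightarrow> bool"
  where "f_fun P f M N =
    f_and (f_all (\<lambda>z. f_imp P (f_mem P z f)
             (f_ex P (\<lambda>x. f_ex P (\<lambda>y.
                f_and (f_pair P z x y) (f_and (f_mem P x M) (f_mem P y N)))))))
   (f_and (f_all (\<lambda>x. f_imp P (f_mem P x M) (f_ex P (\<lambda>y. f_app P f x y))))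
          (f_all (\<lambda>x. f_all (\<lambda>y. f_all (\<lambda>y'.
             f_imp P (f_and (f_app P f x y) (f_app P f x y')) (f_eq P y y'))))))"

text \<open>``$\langle M,\in,A\rangle \models \varphi[e]$'' in the generic extension, for names \<open>M\<close>, \<open>A\<close>, \<open>e i\<close>\<close>
primrec f_sat :: "'v::zfc \<Rightarrow> 'v \<Rightarrow> 'v \<Rightarrow> fm \<Rightarrow> (nat \<Rightarrow> 'v) \<Rightarrow> 'v \<Rightarrow> bool" where
  "f_sat P M A (Mem i j) e = f_mem P (e i) (e j)"
| "f_sat P M A (Eq i j) e = f_eq P (e i) (e j)"
| "f_sat P M A (Pr i) e = f_mem P (e i) A"
| "f_sat P M A (Neg \<phi>) e = f_not P (f_sat P M A \<phi> e)"
| "f_sat P M A (Conj \<phi> \<psi>) e = f_and (f_sat P M A \<phi> e) (f_sat P M A \<psi> e)"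
| "f_sat P M A (All n \<phi>) e = f_all (\<lambda>x. f_imp P (f_mem P x M) (f_sat P M A \<phi> (e(n := x))))"

text \<open>
  ``$f : \langle M,\in,A\rangle \prec \langle N,\in,B\rangle$'' in the generic extension, which has the same
  natural numbers, hence the same formulas: for all $\varphi$ and all assignments $e$ into $M$,
  $e'$ into $N$ with $e' = f\circ e$ on the free variables, satisfaction agrees. The assignments are
  finite sequences of names since only free variables matter.
\<close>
definition f_elem_emb :: "'v::zfc \<Rightarrow> 'v \<Rightarrow> 'v \<Rightarrow> 'v \<Rightarrow> 'v \<Rightarrow> 'v \<Rightarrow> 'v \<Rightarrow> bool"
  where "f_elem_emb P f M A N B =
    f_and (f_fun P f M N)
      (f_INF UNIV (\<lambda>\<phi>. f_INF UNIV (\<lambda>e. f_INF UNIV (\<lambda>e'.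
         f_imp P (f_INF (fv \<phi>) (\<lambda>i. f_and (f_mem P (e i) M) (f_app P f (e i) (e' i))))
                 (f_iff P (f_sat P M A \<phi> e) (f_sat P N B \<phi> e'))))))"


section \<open>Infinity-subcomplete forcing\<close>

definition inf_subcomplete :: "'v::zfc \<Rightarrow> bool"
  where "inf_subcomplete P \<longleftrightarrow> forcing P \<and>
    suff_large (\<lambda>\<theta>. P \<in> H \<theta> \<and>
      (\<forall>\<tau> A M B \<sigma> \<theta>' P' G' s.
         Ord \<tau> \<and> \<theta> \<in> elts \<tau> \<and> H \<theta> \<subseteq> Lset A \<tau> \<and> ZFC_minus (Lset A \<tau>) (Lpred A \<tau>) \<and>
         vtransitive M \<and> countable (elts M) \<and> elts B \<subseteq> elts M \<and> full M B \<and>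
         elem_emb \<sigma> (elts M) (elts B) (Lset A \<tau>) (Lpred A \<tau>) \<and>
         {P, \<theta>} \<subseteq> \<sigma> ` elts M \<and>
         \<theta>' \<in> elts M \<and> P' \<in> elts M \<and> \<sigma> (vpair \<theta>' P') = vpair \<theta> P \<and>
         generic_over (elts M) P' G' \<and> s \<in> elts M \<longrightarrow>
         (\<exists>p\<in>conds P.
            f_ex P (\<lambda>f.
              f_and (f_elem_emb P f (check P M) (check P B)
                       (check P (vset (Lset A \<tau>))) (check P (vset (Lpred A \<tau>))))
             (f_and (f_app P f (check P (vpair s (vpair \<theta>' P')))
                               (check P (\<sigma> (vpair s (vpair \<theta>' P')))))
                    (f_all (\<lambda>x. f_all (\<lambda>y.
                       f_imp P (f_and (f_mem P x (check P (vset G'))) (f_app P f x y))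
                               (f_mem P y (gen_name P))))))) p)))"


section \<open>The forcing $\mathbb{P}_S$\<close>

text \<open>
  A condition is the function $\langle X_i \mid i \le \ell\rangle$, as a set of pairs, with \<open>l\<close> a
  countable ordinal. One condition end-extends another iff it contains it as a set of pairs.
\<close>

definition chain_conds :: "'v::zfc \<Rightarrow> 'v set"
  where "chain_conds S = {p. \<exists>l X. Ord l \<and> countable (elts l) \<and>
    (\<forall>i\<in>insert l (elts l). X i \<in> elts S) \<and>
    (\<forall>j\<in>insert l (elts l). \<forall>i\<in>elts j. X i \<in> elts (X j)) \<and>
    (\<forall>j\<in>insert l (elts l). Limit j \<longrightarrow> elts (X j) = (\<Union>i\<in>elts j. elts (X i))) \<and>
    elts p = {vpair i (X i) | i. i \<in> insert l (elts l)}}"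

definition PS :: "'v::zfc \<Rightarrow> 'v"
  where "PS S = vpair (vset (chain_conds S))
    (vset {vpair p q | p q. p \<in> chain_conds S \<and> q \<in> chain_conds S \<and> elts q \<subseteq> elts p})"


section \<open>The arguments of \<open>vset\<close> above are extensions of sets\<close>

definition small :: "'v::zfc set \<Rightarrow> bool"
  where "small X \<longleftrightarrow> X \<in> range elts"

lemma elts_vset_small: "small X \<Longrightarrow> elts (vset X) = X"
  unfolding small_def using elts_vset by blast

lemma small_elts: "small (elts x)"
  by (simp add: small_def)

lemma small_subset: "small X \<Longrightarrow> Y \<subseteq> X \<Longrightarrow> small Y"
proof -
  assume "small X" "Y \<subseteq> X"
  then obtain x where "Y \<subseteq> elts x" unfolding small_def by blast
  then obtain z where "elts z = Y" using separation[of Y x] by blast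
  then show ?thesis by (metis small_elts)
qed

lemma small_image: "small X \<Longrightarrow> small (f ` X)" for f :: "'v::zfc \<Rightarrow> 'v"
proof -
  assume "small X"
  then obtain x where "X = elts x" unfolding small_def by blast
  moreover obtain z where "elts z = f ` elts x" using replacement[of f x] by blast
  ultimately show ?thesis by (metis small_elts)
qed

lemma small_Pow: "small X \<Longrightarrow> small {y. elts y \<subseteq> X}"
proof -
  assume "small X"
  then obtain x where "X = elts x" unfolding small_def by blast
  moreover obtain z where "elts z = {y. elts y \<subseteq> elts x}" using power_set[of x] by blast
  ultimately show ?thesis by (metis small_elts)
qed

lemma small_UN:
  fixes F :: "'v::zfc \<Rightarrow> 'v set"
  assumes "small X" and "\<And>x. x \<in> X \<Longrightarrow> small (F x)"
  shows "small (\<Union>x\<in>X. F x)"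
proof -
  have "small ((\<lambda>x. vset (F x)) ` X)" by (rule small_image[OF assms(1)])
  then obtain y where y: "elts y = (\<lambda>x. vset (F x)) ` X" unfolding small_def by auto
  obtain z where "elts z = (\<Union>y\<in>elts y. elts y)" using union[of y] by blast
  then have "elts z = (\<Union>x\<in>X. F x)" using assms(2) by (simp add: y elts_vset_small)
  then show ?thesis unfolding small_def by (metis rangeI)
qed

lemma small_pairs: "small X \<Longrightarrow> small Y \<Longrightarrow> small {z. \<exists>x\<in>X. \<exists>y\<in>Y. z = vpair x y}"
proof -
  assume "small X" "small Y"
  then have "small (\<Union>x\<in>X. (\<lambda>y. vpair x y) ` Y)" by (intro small_UN small_image)
  also have "(\<Union>x\<in>X. (\<lambda>y. vpair x y) ` Y) = {z. \<exists>x\<in>X. \<exists>y\<in>Y. z = vpair x y}" by auto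
  finally show ?thesis .
qed

lemma small_Lset: "small (Lset A \<tau>)"
proof (induction \<tau> rule: wf_induct_rule[OF wf_mem_rel])
  case (1 \<tau>)
  have "small (Defset M B)" if "small M" for M B :: "'a set"
    by (rule small_subset[OF small_Pow[OF that]]) (auto simp: Defset_def)
  then show ?case
    unfolding Lset.simps[of A \<tau>] using 1 by (intro small_UN small_elts) (simp add: mem_rel_iff)
qed

lemma elts_check: "elts (check P x) = {z. \<exists>y\<in>elts x. \<exists>r\<in>conds P. z = vpair (check P y) r}"
proof -
  have "small {z. \<exists>y\<in>check P ` elts x. \<exists>r\<in>conds P. z = vpair y r}"
    unfolding conds_def by (intro small_pairs small_image small_elts)
  then show ?thesis by (subst check.simps, subst elts_vset_small) simp_all
qed

lemma elts_gen_name: "elts (gen_name P) = {vpair (check P r) r | r. r \<in> conds P}"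
proof -
  have "small ((\<lambda>r. vpair (check P r) r) ` conds P)"
    unfolding conds_def by (intro small_image small_elts)
  then show ?thesis
    unfolding gen_name_def by (subst elts_vset_small) (simp_all add: image_def conj_commute Bex_def)
qed

lemma mem_irrefl: "x \<notin> elts (x :: 'v::zfc)"
  using wf_mem_rel by (metis mem_rel_iff wf_not_refl)

lemma small_range_nat: "\<exists>g :: nat \<Rightarrow> 'v::zfc. inj g \<and> small (range g)"
proof -
  obtain x :: 'v where inf: "(\<exists>e\<in>elts x. elts e = {}) \<and>
      (\<forall>n\<in>elts x. \<exists>s\<in>elts x. elts s = insert n (elts n))"
    using infinity by (rule exE)
  then obtain e where x: "e \<in> elts x" by blast
  from inf have "\<forall>n\<in>elts x. \<exists>s. s \<in> elts x \<and> elts s = insert n (elts n)" by blast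
  from bchoice[OF this] obtain suc
    where suc: "\<And>n. n \<in> elts x \<Longrightarrow> suc n \<in> elts x \<and> elts (suc n) = insert n (elts n)"
    by blast
  define g where "g n = (suc ^^ n) e" for n
  have g: "g n \<in> elts x" for n by (induction n) (auto simp: g_def x suc)
  have Suc: "elts (g (Suc n)) = insert (g n) (elts (g n))" for n
    using suc[OF g[of n]] by (simp add: g_def)
  have less: "g m \<in> elts (g n)" if "m < n" for m n
    using that by (induction n) (auto simp: Suc less_Suc_eq)
  have "inj g" by (rule linorder_injI) (metis less mem_irrefl)
  moreover have "small (range g)"
    by (rule small_subset[OF small_elts[of x]]) (use g in auto)
  ultimately show ?thesis by blast
qed

lemma transitive_iso_eq:
  fixes \<alpha> \<beta> :: "'v::zfc"
  assumes tr: "vtransitive \<alpha>" "vtransitive \<beta>" and bij: "bij_betw h (elts \<alpha>) (elts \<beta>)"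
    and iso: "\<And>x y. x \<in> elts \<alpha> \<Longrightarrow> y \<in> elts \<alpha> \<Longrightarrow> x \<in> elts y \<longleftrightarrow> h x \<in> elts (h y)"
  shows "\<alpha> = \<beta>"
proof -
  have "x \<in> elts \<alpha> \<longrightarrow> h x = x" for x
  proof (induction x rule: wf_induct_rule[OF wf_mem_rel])
    case (1 x)
    show ?case
    proof
      assume x: "x \<in> elts \<alpha>"
      have sub: "elts x \<subseteq> elts \<alpha>" "elts (h x) \<subseteq> elts \<beta>"
        using tr x bij_betwE[OF bij] unfolding vtransitive_def by blast+
      have "elts (h x) = elts x"
      proof (intro set_eqI iffI)
        fix z assume z: "z \<in> elts (h x)"
        then obtain y where y: "y \<in> elts \<alpha>" "z = h y" using sub bij unfolding bij_betw_def by blast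
        then have "y \<in> elts x" using iso x z by blast
        then show "z \<in> elts x" using 1 y by (simp add: mem_rel_iff)
      next
        fix z assume "z \<in> elts x"
        then show "z \<in> elts (h x)" using 1 iso sub x by (metis mem_rel_iff subsetD)
      qed
      then show "h x = x" by (rule extensionality)
    qed
  qed
  then have "elts \<beta> = elts \<alpha>" using bij unfolding bij_betw_def by force
  then show ?thesis by (metis extensionality)
qed

lemma small_countable_ordinals: "small {\<alpha> :: 'v::zfc. Ord \<alpha> \<and> countable (elts \<alpha>)}" (is "small ?O")
proof -
  obtain g :: "nat \<Rightarrow> 'v" where g: "inj g" "small (range g)" using small_range_nat by blast
  define f where "f \<alpha> = to_nat_on (elts \<alpha>)" for \<alpha> :: 'v
  define c where "c \<alpha> = {prod_encode (f \<alpha> x, f \<alpha> y) | x y.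
      x \<in> elts \<alpha> \<and> y \<in> elts \<alpha> \<and> (x \<in> elts y \<or> x = y)}" for \<alpha> :: 'v
  have c_iff: "prod_encode (f \<alpha> x, f \<alpha> y) \<in> c \<alpha> \<longleftrightarrow> x \<in> elts y \<or> x = y"
    if "\<alpha> \<in> ?O" "x \<in> elts \<alpha>" "y \<in> elts \<alpha>" for \<alpha> x y :: 'v
  proof -
    have inj: "f \<alpha> u = f \<alpha> w \<longleftrightarrow> u = w" if "u \<in> elts \<alpha>" "w \<in> elts \<alpha>" for u w
      using inj_on_to_nat_on[of "elts \<alpha>"] \<open>\<alpha> \<in> ?O\<close> that
      unfolding f_def by (simp add: inj_on_eq_iff)
    have "prod_encode (f \<alpha> x, f \<alpha> y) \<in> c \<alpha> \<longleftrightarrow> (\<exists>u v. f \<alpha> x = f \<alpha> u \<and> f \<alpha> y = f \<alpha> v \<and>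
        u \<in> elts \<alpha> \<and> v \<in> elts \<alpha> \<and> (u \<in> elts v \<or> u = v))"
      unfolding c_def by (simp add: prod_encode_eq)
    also have "\<dots> \<longleftrightarrow> (\<exists>u v. x = u \<and> y = v \<and> (u \<in> elts v \<or> u = v))"
      using \<open>x \<in> elts \<alpha>\<close> \<open>y \<in> elts \<alpha>\<close> inj by (intro iff_exI) blast
    finally show ?thesis by simp
  qed
  have dom: "f \<alpha> ` elts \<alpha> = {n. prod_encode (n, n) \<in> c \<alpha>}" if "\<alpha> \<in> ?O" for \<alpha> :: 'v
    using that unfolding c_def by (auto simp: prod_encode_eq)
  have inj_c: "inj_on c ?O"
  proof (rule inj_onI)
    fix \<alpha> \<beta> :: 'v assume \<alpha>: "\<alpha> \<in> ?O" and \<beta>: "\<beta> \<in> ?O" and eq: "c \<alpha> = c \<beta>"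
    have bij: "bij_betw (f \<alpha>) (elts \<alpha>) (f \<alpha> ` elts \<alpha>)" "bij_betw (f \<beta>) (elts \<beta>) (f \<alpha> ` elts \<alpha>)"
    proof -
      have "inj_on (f \<alpha>) (elts \<alpha>)" "inj_on (f \<beta>) (elts \<beta>)"
        using \<alpha> \<beta> inj_on_to_nat_on unfolding f_def by blast+
      moreover have "f \<beta> ` elts \<beta> = f \<alpha> ` elts \<alpha>" using dom[OF \<alpha>] dom[OF \<beta>] eq by metis
      ultimately show "bij_betw (f \<alpha>) (elts \<alpha>) (f \<alpha> ` elts \<alpha>)"
        "bij_betw (f \<beta>) (elts \<beta>) (f \<alpha> ` elts \<alpha>)" unfolding bij_betw_def by blast+
    qed
    define h where "h = inv_into (elts \<beta>) (f \<beta>) \<circ> f \<alpha>"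
    have h: "bij_betw h (elts \<alpha>) (elts \<beta>)"
      unfolding h_def by (rule bij_betw_trans[OF bij(1) bij_betw_inv_into[OF bij(2)]])
    have fh: "h x \<in> elts \<beta>" "f \<beta> (h x) = f \<alpha> x" if "x \<in> elts \<alpha>" for x
      using bij_betwE[OF h] bij_betw_inv_into_right[OF bij(2), of "f \<alpha> x"] that
      unfolding h_def by auto
    have "x \<in> elts y \<longleftrightarrow> h x \<in> elts (h y)" if xy: "x \<in> elts \<alpha>" "y \<in> elts \<alpha>" for x y
    proof -
      have "x \<in> elts y \<or> x = y \<longleftrightarrow> h x \<in> elts (h y) \<or> h x = h y"
        using c_iff[OF \<alpha> xy] c_iff[OF \<beta> fh(1)[OF xy(1)] fh(1)[OF xy(2)]] eq fh(2) xy by simp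
      moreover have "h x = h y \<longleftrightarrow> x = y" using h xy unfolding bij_betw_def inj_on_def by blast
      ultimately show ?thesis using mem_irrefl[of x] mem_irrefl[of "h x"] by (cases "x = y") auto
    qed
    moreover have "vtransitive \<alpha>" "vtransitive \<beta>" using \<alpha> \<beta> by (auto simp: Ord_def)
    ultimately show "\<alpha> = \<beta>" by (intro transitive_iso_eq[OF _ _ h])
  qed
  define d where "d \<alpha> = vset (g ` c \<alpha>)" for \<alpha>
  have d: "elts (d \<alpha>) = g ` c \<alpha>" for \<alpha>
    unfolding d_def by (rule elts_vset_small[OF small_subset[OF g(2)]]) auto
  have "inj_on d ?O"
  proof (rule inj_onI)
    fix \<alpha> \<beta> assume "\<alpha> \<in> ?O" "\<beta> \<in> ?O" "d \<alpha> = d \<beta>"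
    then have "g ` c \<alpha> = g ` c \<beta>" using d by metis
    then have "c \<alpha> = c \<beta>" by (simp only: inj_image_eq_iff[OF g(1)])
    then show "\<alpha> = \<beta>" by (rule inj_onD[OF inj_c _ \<open>\<alpha> \<in> ?O\<close> \<open>\<beta> \<in> ?O\<close>])
  qed
  moreover have "small (d ` ?O)"
    by (rule small_subset[OF small_Pow[OF g(2)]]) (use d in blast)
  then have "small (inv_into ?O d ` d ` ?O)" by (rule small_image)
  moreover have "inv_into ?O d ` d ` ?O = ?O"
    by (rule inv_into_image_cancel[OF \<open>inj_on d ?O\<close> subset_refl])
  ultimately show ?thesis by (simp only:)
qed

lemma small_chain_conds: "small (chain_conds S)"
proof -
  let ?O = "{\<alpha> :: 'a. Ord \<alpha> \<and> countable (elts \<alpha>)}"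
  have "small {z. \<exists>i\<in>?O. \<exists>x\<in>elts S. z = vpair i x}" (is "small ?W")
    by (intro small_pairs small_countable_ordinals small_elts)
  then have "small {p. elts p \<subseteq> ?W}" by (rule small_Pow)
  moreover have "chain_conds S \<subseteq> {p. elts p \<subseteq> ?W}"
  proof (intro subsetI CollectI)
    fix p z assume "p \<in> chain_conds S" and "z \<in> elts p"
    then obtain l X i where l: "Ord l" "countable (elts l)" and i: "i \<in> insert l (elts l)"
        and X: "X i \<in> elts S" and z: "z = vpair i (X i)"
      unfolding chain_conds_def by blast
    have "elts i \<subseteq> elts l" using l(1) i by (auto simp: Ord_def vtransitive_def)
    then have "Ord i" "countable (elts i)"
      using l i by (auto simp: Ord_def intro: countable_subset)
    with X z show "\<exists>i\<in>?O. \<exists>x\<in>elts S. z = vpair i x" by blast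
  qed
  ultimately show ?thesis by (rule small_subset)
qed

lemma elts_PS:
  "conds (PS S) = chain_conds S"
  "le (PS S) p q \<longleftrightarrow> p \<in> chain_conds S \<and> q \<in> chain_conds S \<and> elts q \<subseteq> elts p"
proof -
  show 1: "conds (PS S) = chain_conds S"
    by (simp add: conds_def PS_def elts_vset_small small_chain_conds)
  have "small {vpair p q | p q. p \<in> chain_conds S \<and> q \<in> chain_conds S \<and> elts q \<subseteq> elts p}"
    by (rule small_subset[OF small_pairs[OF small_chain_conds[of S] small_chain_conds[of S]]]) auto
  then show "le (PS S) p q \<longleftrightarrow> p \<in> chain_conds S \<and> q \<in> chain_conds S \<and> elts q \<subseteq> elts p"
    unfolding le_def 1 by (auto simp: PS_def elts_vset_small)
qed

end

theory Submission
  imports Defs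
begin

text \<open>
  Both directions rest on one computation: if \<open>\<sigma> : M \<prec> N\<close> maps \<open>P'\<close> to \<open>PS S\<close> and \<open>G\<close> is generic for
  \<open>P'\<close> over \<open>M\<close>, then \<open>\<sigma> ` G\<close> is a directed set of conditions without a longest member, and
  the union of all members of these chains is \<open>\<sigma> ` M \<inter> H \<kappa>\<close>. One inclusion is genericity, the other holds
  because countable elements of \<open>\<sigma> ` M\<close> are subsets of it. Hence \<open>\<sigma> ` G\<close> has a lower bound in \<open>PS S\<close>
  if and only if \<open>\<sigma> ` M \<inter> H \<kappa> \<in> S\<close>.

  If \<open>S\<close> is spread out, the isomorphism supplied for \<open>ran \<sigma>\<close> yields an embedding in the ground model
  whose image of the generic filter has a lower bound, which forces what is required. Conversely,
  \<open>PS S\<close> is definable from \<open>S\<close>, and stationarity makes it countably distributive, so some condition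
  decides all values of the embedding existing in the extension. This embedding then lies in the ground model;
  as \<open>PS S\<close> is separative, that condition is a lower bound of the image of the generic filter.
\<close>

section \<open>Sizes of sets, ordinals and cardinals\<close>

text \<open>No generic extension exists here as an object, so every claim about \<open>V[G]\<close>
  is a claim about conditions. Two facts bridge the gap: satisfaction in structures given by
  canonical names is absolute, and a forced statement may be verified after strengthening the
  condition. The main obstacle lies in the converse direction, where the embedding is given only by
  a name. Deciding all its values means meeting countably many dense sets, and the forcing need not
  be countably closed, because the union of a descending sequence of chains has to belong to
  \<open>S\<close>. Stationarity supplies a member of \<open>S\<close> closed under the construction
  of the sequence, and the sequence is arranged to have exactly this member as its union. Both
  notions concern all sufficiently large \<theta>, and the proof passes between them at one and the
  same \<theta>. Exceeding \<open>chain_bound\<close> puts all auxiliary sets into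
  \<open>H \<theta>\<close>, hence into the model. The free parameters are matched by pairing: in
  one direction the element to be fixed is the image of the tuple of \<open>s\<close>,
  \<open>\<theta>'\<close>, \<open>P'\<close>; in the other \<open>s\<close> is the preimage of the
  element to be fixed.\<close>

lemma lepoll_total: "A \<lesssim> B \<or> B \<lesssim> A"
  unfolding lepoll_def card_of_ordLeq
  by (rule ordLeq_total[OF card_of_Well_order card_of_Well_order])

lemma not_lepoll_imp_lesspoll: "\<not> B \<lesssim> A \<Longrightarrow> A \<prec> B"
  by (metis lepoll_total lesspoll_def eqpoll_imp_lepoll eqpoll_sym)

lemma lesspoll_iff_not_lepoll: "A \<prec> B \<longleftrightarrow> \<not> B \<lesssim> A"
  by (metis lepoll_antisym lesspoll_def not_lepoll_imp_lesspoll)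

lemma countable_lesspoll_uncountable: "countable A \<Longrightarrow> uncountable B \<Longrightarrow> A \<prec> B"
  by (metis countable_lepoll not_lepoll_imp_lesspoll)

lemma infinite_times_lepoll_self: "infinite A \<Longrightarrow> A \<times> A \<lesssim> A"
  by (metis card_of_Times_same_infinite eqpoll_iff_card_of_ordIso eqpoll_imp_lepoll)

section \<open>Small classes and transitive closures\<close>

lemma small_countable: "countable X \<Longrightarrow> small (X :: 'v::zfc set)"
proof -
  assume "countable X"
  obtain g :: "nat \<Rightarrow> 'v" where g: "inj g" "small (range g)" using small_range_nat by blast
  have "X \<subseteq> (from_nat_into X \<circ> inv g) ` range g" if "X \<noteq> {}"
    using range_from_nat_into[OF that \<open>countable X\<close>] g(1) by (simp add: image_comp o_def)
  then show "small X"
    using small_subset[OF small_image[OF g(2)]] small_subset[OF g(2), of "{}"] by (cases "X = {}") auto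
qed

lemma small_Un: "small X \<Longrightarrow> small Y \<Longrightarrow> small (X \<union> Y :: 'v::zfc set)"
proof -
  assume s: "small X" "small Y"
  let ?p = "vset {vset X, vset Y}"
  have "small (\<Union>z\<in>elts ?p. elts z)"
    by (intro small_UN small_elts)
  then show ?thesis using s by (simp add: elts_vset_small)
qed

lemma small_insert: "small X \<Longrightarrow> small (insert (x :: 'v::zfc) X)"
  using small_Un[of "{x}" X] small_countable[of "{x}"] by simp

lemma TC_iff: "y \<in> TC x \<longleftrightarrow> y \<in> elts x \<or> (\<exists>z\<in>elts x. y \<in> TC z)"
  unfolding TC_def by (auto simp: mem_rel_iff[symmetric] elim: tranclE intro: trancl_into_trancl)

lemma TC_unfold: "TC x = elts x \<union> (\<Union>z\<in>elts x. TC z)"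
  by (auto simp: TC_iff[of _ x])

lemma TC_least:
  assumes "elts x \<subseteq> T" and T: "\<And>y. y \<in> T \<Longrightarrow> elts y \<subseteq> T"
  shows "TC x \<subseteq> T"
proof
  fix y assume "y \<in> TC x"
  then have "(y, x) \<in> mem_rel\<^sup>+" by (simp add: TC_def)
  then show "y \<in> T"
    by (induction rule: converse_trancl_induct) (use assms in \<open>auto simp: mem_rel_iff\<close>)
qed

lemma TC_trans: "y \<in> TC x \<Longrightarrow> elts y \<subseteq> TC x"
  unfolding TC_def by (auto simp: mem_rel_iff[symmetric])

lemma small_TC: "small (TC x)"
proof (induction x rule: wf_induct_rule[OF wf_mem_rel])
  case (1 x)
  then show ?case
    unfolding TC_unfold[of x] by (intro small_Un small_elts small_UN) (auto simp: mem_rel_iff)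
qed

section \<open>Ordinals: comparability and successors\<close>

lemma mem_asym: "x \<in> elts y \<Longrightarrow> y \<notin> elts (x :: 'v::zfc)"
  by (metis mem_rel_iff wf_mem_rel wf_asym)

lemma Ord_mem: "Ord a \<Longrightarrow> b \<in> elts a \<Longrightarrow> Ord b"
  unfolding Ord_def vtransitive_def by blast

lemma Ord_trans: "Ord a \<Longrightarrow> b \<in> elts a \<Longrightarrow> c \<in> elts b \<Longrightarrow> c \<in> elts a"
  unfolding Ord_def vtransitive_def by blast

lemma Ord_linear: "Ord a \<Longrightarrow> Ord b \<Longrightarrow> a \<in> elts b \<or> a = b \<or> b \<in> elts a"
proof (induction a arbitrary: b rule: wf_induct_rule[OF wf_mem_rel])
  case (1 a)
  note IHa = "1.IH" and a = \<open>Ord a\<close>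
  from \<open>Ord b\<close> show ?case
  proof (induction b rule: wf_induct_rule[OF wf_mem_rel])
    case (1 b)
    show ?case
    proof (rule ccontr)
      assume ne: "\<not> (a \<in> elts b \<or> a = b \<or> b \<in> elts a)"
      have "elts a \<subseteq> elts b"
        using IHa[OF _ Ord_mem[OF a] \<open>Ord b\<close>] ne a Ord_trans by (auto simp: mem_rel_iff)
      moreover have "elts b \<subseteq> elts a"
        using "1.IH" Ord_mem[OF \<open>Ord b\<close>] ne Ord_trans[OF \<open>Ord b\<close>] by (auto simp: mem_rel_iff)
      ultimately show False using ne extensionality by blast
    qed
  qed
qed

lemma Ord_subset_imp: "Ord a \<Longrightarrow> Ord b \<Longrightarrow> elts a \<subseteq> elts b \<Longrightarrow> a \<in> elts b \<or> a = b"
  using Ord_linear mem_irrefl by blast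

definition vsucc :: "'v::zfc \<Rightarrow> 'v"
  where "vsucc l = vset (insert l (elts l))"

lemma elts_vsucc [simp]: "elts (vsucc l) = insert l (elts l)"
  unfolding vsucc_def by (intro elts_vset_small small_insert small_elts)

lemma Ord_vsucc: "Ord l \<Longrightarrow> Ord (vsucc l)"
  unfolding Ord_def vtransitive_def by auto

lemma not_Limit_vsucc: "\<not> Limit (vsucc l)"
  unfolding Limit_def using mem_irrefl mem_asym by auto

section \<open>Hartogs numbers and thresholds for sufficiently large cardinals\<close>

lemma Card_Ord: "Card \<kappa> \<Longrightarrow> Ord \<kappa>"
  by (simp add: Card_def)

text \<open>Hartogs' argument. An ordinal that injects into \<open>W\<close> is coded by the copy of
  its membership relation on \<open>W\<close>, and \<open>transitive_iso_eq\<close> makes the code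
  determine the ordinal; replacement over the relations on \<open>W\<close> then yields a set. The
  relation is taken reflexive so that its diagonal records the domain.\<close>

lemma small_ordinals_lepoll:
  assumes "small (W :: 'v::zfc set)"
  shows "small {\<alpha> :: 'v. Ord \<alpha> \<and> elts \<alpha> \<lesssim> W}" (is "small ?O")
proof -
  define R where "R f \<alpha> =
      {vpair (f x) (f y) | x y. x \<in> elts \<alpha> \<and> y \<in> elts \<alpha> \<and> (x \<in> elts y \<or> x = y)}"
    for f :: "'v \<Rightarrow> 'v" and \<alpha> :: 'v
  define codes where "codes r \<alpha> \<longleftrightarrow>
      Ord \<alpha> \<and> (\<exists>f. inj_on f (elts \<alpha>) \<and> f ` elts \<alpha> \<subseteq> W \<and> elts r = R f \<alpha>)"
    for r \<alpha> :: 'v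
  let ?P = "{z. \<exists>x\<in>W. \<exists>y\<in>W. z = vpair x y}"
  have P: "small {r. elts r \<subseteq> ?P}"
    by (intro small_Pow small_pairs assms)
  have unique: "\<alpha> = \<beta>" if c: "codes r \<alpha>" "codes r \<beta>" for r \<alpha> \<beta>
  proof -
    obtain f where f: "inj_on f (elts \<alpha>)" and rf: "elts r = R f \<alpha>" and "Ord \<alpha>"
      using c(1) unfolding codes_def by metis
    obtain g where g: "inj_on g (elts \<beta>)" and rg: "elts r = R g \<beta>" and "Ord \<beta>"
      using c(2) unfolding codes_def by metis
    have "f ` elts \<alpha> = {w. vpair w w \<in> elts r}" unfolding rf R_def by auto
    also have "\<dots> = g ` elts \<beta>" unfolding rg R_def by auto
    finally have img: "f ` elts \<alpha> = g ` elts \<beta>" .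
    define h where "h = inv_into (elts \<beta>) g \<circ> f"
    have h: "bij_betw h (elts \<alpha>) (elts \<beta>)"
      unfolding h_def
      by (rule bij_betw_trans[of _ _ "f ` elts \<alpha>"])
         (use f g img in \<open>auto simp: bij_betw_def inj_on_inv_into inv_into_into
             inv_into_image_cancel\<close>)
    have gh: "g (h x) = f x" if "x \<in> elts \<alpha>" for x
      unfolding h_def using img that by (auto intro!: f_inv_into_f)
    have hb: "h x \<in> elts \<beta>" if "x \<in> elts \<alpha>" for x using h that by (rule bij_betw_apply)
    have "x \<in> elts y \<longleftrightarrow> h x \<in> elts (h y)" if xy: "x \<in> elts \<alpha>" "y \<in> elts \<alpha>" for x y
    proof -
      have "x \<in> elts y \<or> x = y \<longleftrightarrow> vpair (f x) (f y) \<in> elts r"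
        unfolding rf R_def using f xy by (auto simp: inj_on_eq_iff)
      also have "\<dots> \<longleftrightarrow> vpair (g (h x)) (g (h y)) \<in> elts r" using gh xy by simp
      also have "\<dots> \<longleftrightarrow> h x \<in> elts (h y) \<or> h x = h y"
        unfolding rg R_def using g hb xy by (auto simp: inj_on_eq_iff)
      finally have "x \<in> elts y \<or> x = y \<longleftrightarrow> h x \<in> elts (h y) \<or> h x = h y" .
      moreover have "h x = h y \<longleftrightarrow> x = y" using h xy unfolding bij_betw_def inj_on_def by blast
      ultimately show ?thesis using mem_irrefl[of x] mem_irrefl[of "h x"] by (cases "x = y") auto
    qed
    then show "\<alpha> = \<beta>" using \<open>Ord \<alpha>\<close> \<open>Ord \<beta>\<close> by (intro transitive_iso_eq[OF _ _ h]) (auto simp: Ord_def)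
  qed
  have "\<exists>r. elts r \<subseteq> ?P \<and> codes r \<alpha>" if "\<alpha> \<in> ?O" for \<alpha>
  proof -
    from that obtain f where f: "inj_on f (elts \<alpha>)" "f ` elts \<alpha> \<subseteq> W"
      unfolding lepoll_def by blast
    have sub: "R f \<alpha> \<subseteq> ?P" using f(2) unfolding R_def by blast
    then have "elts (vset (R f \<alpha>)) = R f \<alpha>"
      by (intro elts_vset_small small_subset[OF small_pairs[OF assms assms] sub])
    then show ?thesis using sub f that unfolding codes_def by (intro exI[of _ "vset (R f \<alpha>)"]) auto
  qed
  then have "?O \<subseteq> (\<lambda>r. SOME \<alpha>. codes r \<alpha>) ` {r. elts r \<subseteq> ?P}"
    using unique by (auto simp: image_def) (metis (mono_tags, lifting) someI_ex)
  then show ?thesis by (rule small_subset[OF small_image[OF P]])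
qed

text \<open>The ordinals injecting into \<open>W\<close> form an ordinal that does not inject into
  \<open>W\<close>, since otherwise it would be an element of itself. Its elements do inject, so
  they are strictly smaller.\<close>

lemma Hartogs_Card:
  fixes W :: "'v::zfc set"
  assumes "small W"
  obtains \<theta> :: 'v where "Card \<theta>" "W \<prec> elts \<theta>"
proof -
  let ?O = "{\<alpha> :: 'v. Ord \<alpha> \<and> elts \<alpha> \<lesssim> W}"
  define \<theta> where "\<theta> = vset ?O"
  have \<theta>: "elts \<theta> = ?O"
    unfolding \<theta>_def by (rule elts_vset_small[OF small_ordinals_lepoll[OF assms]])
  have "b \<in> ?O" if "a \<in> ?O" "b \<in> elts a" for a b
  proof -
    have "elts b \<subseteq> elts a" using that by (auto simp: Ord_def vtransitive_def)
    then show ?thesis using that lepoll_trans[OF subset_imp_lepoll] Ord_mem by blast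
  qed
  then have "vtransitive \<theta>" unfolding vtransitive_def \<theta> by blast
  then have ord: "Ord \<theta>" unfolding Ord_def \<theta> by (simp add: Ord_def)
  have n: "\<not> elts \<theta> \<lesssim> W" using \<theta> ord mem_irrefl[of \<theta>] by blast
  have "elts \<alpha> \<prec> elts \<theta>" if "\<alpha> \<in> elts \<theta>" for \<alpha>
    using that n unfolding \<theta> by (metis (mono_tags, lifting) lepoll_trans mem_Collect_eq not_lepoll_imp_lesspoll)
  then have "Card \<theta>" using ord by (simp add: Card_def)
  then show thesis using not_lepoll_imp_lesspoll[OF n] by (rule that)
qed

lemma Card_subset_of_lepoll: "Card \<kappa> \<Longrightarrow> Card \<mu> \<Longrightarrow> elts \<kappa> \<lesssim> elts \<mu> \<Longrightarrow> elts \<kappa> \<subseteq> elts \<mu>"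
  by (metis Card_def Ord_linear Ord_trans lesspoll_iff_not_lepoll subsetI)

text \<open>A sufficiently large \<theta> may be assumed to exceed any given set: the threshold is
  raised to a cardinal beyond \<open>W\<close> and the old threshold. Both directions use this with
  \<open>W = chain_bound\<close> to carry a property over at a fixed \<theta>.\<close>

lemma suff_largeI_small:
  fixes P Q :: "'v::zfc \<Rightarrow> bool"
  assumes "suff_large P" and W: "small (W :: 'v set)"
    and PQ: "\<And>\<theta>. Card \<theta> \<Longrightarrow> W \<prec> elts \<theta> \<Longrightarrow> P \<theta> \<Longrightarrow> Q \<theta>"
  shows "suff_large Q"
proof -
  obtain \<theta>0 where \<theta>0: "Card \<theta>0" "\<And>\<theta>. Card \<theta> \<Longrightarrow> elts \<theta>0 \<subseteq> elts \<theta> \<Longrightarrow> P \<theta>"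
    using assms(1) unfolding suff_large_def by blast
  have "small (W \<union> elts \<theta>0)" by (intro small_Un W small_elts)
  then obtain \<mu> :: 'v where \<mu>: "Card \<mu>" "W \<union> elts \<theta>0 \<prec> elts \<mu>" by (rule Hartogs_Card)
  have le: "W \<prec> elts \<mu>" by (rule lesspoll_trans1[OF subset_imp_lepoll \<mu>(2)]) auto
  have "elts \<theta>0 \<prec> elts \<mu>" by (rule lesspoll_trans1[OF subset_imp_lepoll \<mu>(2)]) auto
  then have le': "elts \<theta>0 \<subseteq> elts \<mu>"
    by (intro Card_subset_of_lepoll \<theta>0(1) \<mu>(1) lesspoll_imp_lepoll)
  have "Q \<theta>" if "Card \<theta>" "elts \<mu> \<subseteq> elts \<theta>" for \<theta>
  proof (rule PQ[OF that(1)])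
    show "W \<prec> elts \<theta>" using le subset_imp_lepoll[OF that(2)] by (rule lesspoll_trans2)
    show "P \<theta>" using le' that by (intro \<theta>0(2)) auto
  qed
  then show ?thesis unfolding suff_large_def using \<mu>(1) by blast
qed

section \<open>Membership in the sets hereditarily smaller than a cardinal\<close>

lemma in_H_of_TC_subset: "TC x \<subseteq> W \<Longrightarrow> W \<prec> elts \<theta> \<Longrightarrow> x \<in> H \<theta>"
  unfolding H_def using lesspoll_trans1[OF subset_imp_lepoll] by blast

text \<open>By regularity each hull \<open>T y\<close> injects into some ordinal below \<kappa>, and
  countably many such ordinals have a common bound \<beta> below \<kappa> because \<kappa> is
  uncountable. Hence the transitive closure of \<open>x\<close> injects into
  \<open>elts x \<times> elts \<beta>\<close>.\<close>

lemma countable_subset_in_H: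
  assumes reg: "regular_cardinal \<kappa>" and unc: "uncountable (elts \<kappa>)"
    and x: "countable (elts x)" "elts x \<subseteq> H \<kappa>"
  shows "x \<in> H \<kappa>"
proof -
  define T where "T y = insert y (TC y)" for y :: 'a
  have Card: "Card \<kappa>" and bounded: "\<And>X. X \<subseteq> elts \<kappa> \<Longrightarrow> X \<prec> elts \<kappa> \<Longrightarrow> \<exists>\<beta>\<in>elts \<kappa>. X \<subseteq> elts \<beta>"
    using reg unfolding regular_cardinal_def by auto
  have inf: "infinite (elts \<kappa>)" using unc countable_finite by blast
  have "\<exists>\<beta>\<in>elts \<kappa>. T y \<lesssim> elts \<beta>" if "y \<in> elts x" for y
  proof -
    have "TC y \<prec> elts \<kappa>" using x that by (auto simp: H_def)
    then have l: "T y \<prec> elts \<kappa>"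
      unfolding T_def using inf finite_lesspoll_infinite[of "elts \<kappa>" "T y"] infinite_insert_eqpoll[of "TC y" y]
      by (cases "finite (TC y)") (auto intro: eq_lesspoll_trans finite_lesspoll_infinite)
    then obtain f where f: "inj_on f (T y)" "f ` T y \<subseteq> elts \<kappa>"
      using lesspoll_imp_lepoll unfolding lepoll_def by blast
    have "f ` T y \<prec> elts \<kappa>" using l by (rule lesspoll_trans1[OF image_lepoll])
    then obtain \<beta> where "\<beta> \<in> elts \<kappa>" "f ` T y \<subseteq> elts \<beta>" using bounded f(2) by blast
    then show ?thesis using f(1) unfolding lepoll_def by blast
  qed
  then obtain b where b: "\<And>y. y \<in> elts x \<Longrightarrow> b y \<in> elts \<kappa> \<and> T y \<lesssim> elts (b y)" by metis
  have "b ` elts x \<prec> elts \<kappa>"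
    by (intro countable_lesspoll_uncountable countable_image x unc)
  then obtain \<beta> where \<beta>: "\<beta> \<in> elts \<kappa>" "b ` elts x \<subseteq> elts \<beta>" using bounded b by blast
  have "T y \<lesssim> elts \<beta>" if "y \<in> elts x" for y
  proof -
    have "elts (b y) \<subseteq> elts \<beta>"
      using Ord_mem[OF Card_Ord[OF Card] \<beta>(1)] \<beta>(2) that by (auto simp: Ord_def vtransitive_def)
    then show ?thesis using b[OF that] lepoll_trans subset_imp_lepoll by blast
  qed
  then obtain f where f: "\<And>y. y \<in> elts x \<Longrightarrow> inj_on (f y) (T y) \<and> f y ` T y \<subseteq> elts \<beta>"
    unfolding lepoll_def by metis
  have "(\<Union>y\<in>elts x. T y) \<lesssim> elts x \<times> elts \<beta>"
  proof -
    \<comment> \<open>\<open>g z\<close> chooses one hull containing \<open>z\<close>; paired with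
      the position of \<open>z\<close> in that hull it gives an injection.\<close>
    define g where "g z = (SOME y. y \<in> elts x \<and> z \<in> T y)" for z
    have g: "g z \<in> elts x \<and> z \<in> T (g z)" if "z \<in> (\<Union>y\<in>elts x. T y)" for z
      unfolding g_def by (rule someI_ex) (use that in blast)
    have "inj_on (\<lambda>z. (g z, f (g z) z)) (\<Union>y\<in>elts x. T y)"
      by (intro inj_onI) (metis (no_types, lifting) Pair_inject f g inj_on_eq_iff)
    moreover have "(\<lambda>z. (g z, f (g z) z)) ` (\<Union>y\<in>elts x. T y) \<subseteq> elts x \<times> elts \<beta>"
      using f g by (force simp: image_subset_iff)
    ultimately show ?thesis unfolding lepoll_def by blast
  qed
  moreover have "elts x \<times> elts \<beta> \<prec> elts \<kappa>"
  \<comment> \<open>A finite \<beta> leaves a countable product, and \<kappa> is uncountable; an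
    infinite \<beta> absorbs the countable factor.\<close>
  proof (cases "finite (elts \<beta>)")
    case True
    then show ?thesis
      by (intro countable_lesspoll_uncountable countable_SIGMA x unc) (simp add: countable_finite)
  next
    case False
    then have "elts x \<lesssim> elts \<beta>"
      using x(1) unfolding infinite_le_lepoll countable_def
      by (meson lepoll_def lepoll_trans subset_UNIV)
    then have "elts x \<times> elts \<beta> \<lesssim> elts \<beta>"
      by (rule lepoll_trans[OF times_lepoll_mono[OF _ lepoll_refl] infinite_times_lepoll_self[OF False]])
    moreover have "elts \<beta> \<prec> elts \<kappa>" using Card \<beta>(1) by (simp add: Card_def)
    ultimately show ?thesis by (rule lesspoll_trans1)
  qed
  ultimately have "(\<Union>y\<in>elts x. T y) \<prec> elts \<kappa>" by (rule lesspoll_trans1)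
  moreover have "(\<Union>y\<in>elts x. T y) = TC x" unfolding T_def TC_unfold[of x] by auto
  ultimately show ?thesis unfolding H_def by simp
qed

section \<open>Formulas and elementary embeddings\<close>

definition Ex where "Ex n \<phi> = Neg (All n (Neg \<phi>))"
definition Or where "Or \<phi> \<psi> = Neg (Conj (Neg \<phi>) (Neg \<psi>))"
definition Imp where "Imp \<phi> \<psi> = Neg (Conj \<phi> (Neg \<psi>))"
definition Iff where "Iff \<phi> \<psi> = Conj (Imp \<phi> \<psi>) (Imp \<psi> \<phi>)"

lemma fv_connectives [simp]:
  "fv (Ex n \<phi>) = fv \<phi> - {n}" "fv (Or \<phi> \<psi>) = fv \<phi> \<union> fv \<psi>"
  "fv (Imp \<phi> \<psi>) = fv \<phi> \<union> fv \<psi>" "fv (Iff \<phi> \<psi>) = fv \<phi> \<union> fv \<psi>"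
  by (auto simp: Ex_def Or_def Imp_def Iff_def)

lemma sat_connectives [simp]:
  "sat M A (Ex n \<phi>) e \<longleftrightarrow> (\<exists>x\<in>M. sat M A \<phi> (e(n := x)))"
  "sat M A (Or \<phi> \<psi>) e \<longleftrightarrow> sat M A \<phi> e \<or> sat M A \<psi> e"
  "sat M A (Imp \<phi> \<psi>) e \<longleftrightarrow> (sat M A \<phi> e \<longrightarrow> sat M A \<psi> e)"
  "sat M A (Iff \<phi> \<psi>) e \<longleftrightarrow> (sat M A \<phi> e \<longleftrightarrow> sat M A \<psi> e)"
  by (auto simp: Ex_def Or_def Imp_def Iff_def)

lemma finite_fv: "finite (fv \<phi>)"
  by (induction \<phi>) auto

lemma sat_cong: "(\<And>i. i \<in> fv \<phi> \<Longrightarrow> e i = e' i) \<Longrightarrow> sat M A \<phi> e \<longleftrightarrow> sat M A \<phi> e'"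
proof (induction \<phi> arbitrary: e e')
  case (All n \<phi>)
  have "sat M A \<phi> (e(n := x)) \<longleftrightarrow> sat M A \<phi> (e'(n := x))" for x
    by (rule All.IH) (use All.prems in auto)
  then show ?case by simp
next
  case (Conj \<phi> \<psi>)
  have "sat M A \<phi> e \<longleftrightarrow> sat M A \<phi> e'" by (rule Conj.IH(1)) (use Conj.prems in auto)
  moreover have "sat M A \<psi> e \<longleftrightarrow> sat M A \<psi> e'" by (rule Conj.IH(2)) (use Conj.prems in auto)
  ultimately show ?case by simp
next
  case (Neg \<phi>)
  have "sat M A \<phi> e \<longleftrightarrow> sat M A \<phi> e'" by (rule Neg.IH) (use Neg.prems in auto)
  then show ?case by simp
qed simp_all

lemma sat_struct_iso:
  assumes iso: "struct_iso f M A N B"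
  shows "e ` fv \<phi> \<subseteq> M \<Longrightarrow> sat M A \<phi> e \<longleftrightarrow> sat N B \<phi> (f \<circ> e)"
proof (induction \<phi> arbitrary: e)
  case (Eq i j)
  then show ?case using iso by (auto simp: struct_iso_def bij_betw_def inj_on_eq_iff)
next
  case (All n \<phi>)
  have N: "N = f ` M" using iso by (auto simp: struct_iso_def bij_betw_def)
  have "sat M A \<phi> (e(n := x)) \<longleftrightarrow> sat N B \<phi> ((f \<circ> e)(n := f x))" if "x \<in> M" for x
  proof -
    have "e(n := x) ` fv \<phi> \<subseteq> M" using All.prems that by auto
    then show ?thesis using All.IH by (simp only: fun_upd_comp)
  qed
  then show ?case by (simp add: N o_def)
next
  case (Neg \<phi>)
  then show ?case by simp
next
  case (Conj \<phi> \<psi>)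
  then show ?case by (simp add: image_Un)
qed (use iso in \<open>auto simp: struct_iso_def\<close>)

lemma struct_iso_elem_emb: "struct_iso f M A N B \<Longrightarrow> elem_emb f M A N B"
  unfolding elem_emb_def
  by (intro conjI allI impI sat_struct_iso) (auto simp: struct_iso_def bij_betw_def)

lemma elem_embD: "elem_emb \<sigma> M A N B \<Longrightarrow> e ` fv \<phi> \<subseteq> M \<Longrightarrow> sat M A \<phi> e \<longleftrightarrow> sat N B \<phi> (\<sigma> \<circ> e)"
  by (simp add: elem_emb_def)

lemma elem_emb_trans:
  assumes "elem_emb \<sigma> M A N B" "elem_emb \<tau> N B K C"
  shows "elem_emb (\<tau> \<circ> \<sigma>) M A K C"
  unfolding elem_emb_def
proof (intro conjI allI impI)
  show "(\<tau> \<circ> \<sigma>) ` M \<subseteq> K" using assms unfolding elem_emb_def by (metis image_comp image_mono order_trans)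
next
  fix \<phi> e assume e: "e ` fv \<phi> \<subseteq> M"
  then have "(\<sigma> \<circ> e) ` fv \<phi> \<subseteq> N" using assms(1) by (force simp: elem_emb_def)
  then show "sat M A \<phi> e \<longleftrightarrow> sat K C \<phi> (\<tau> \<circ> \<sigma> \<circ> e)"
    using elem_embD[OF assms(1) e] elem_embD[OF assms(2)] by (simp add: comp_assoc)
qed

lemma elem_emb_in: "elem_emb \<sigma> M A N B \<Longrightarrow> x \<in> M \<Longrightarrow> \<sigma> x \<in> N"
  by (auto simp: elem_emb_def)

lemma elem_emb_mem_iff:
  "elem_emb \<sigma> M A N B \<Longrightarrow> x \<in> M \<Longrightarrow> y \<in> M \<Longrightarrow> \<sigma> x \<in> elts (\<sigma> y) \<longleftrightarrow> x \<in> elts y"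
  using elem_embD[of \<sigma> M A N B "(!) [x, y]" "Mem 0 1"] by simp

lemma elem_emb_eq_iff:
  "elem_emb \<sigma> M A N B \<Longrightarrow> x \<in> M \<Longrightarrow> y \<in> M \<Longrightarrow> \<sigma> x = \<sigma> y \<longleftrightarrow> x = y"
  using elem_embD[of \<sigma> M A N B "(!) [x, y]" "Eq 0 1"] by simp

lemma elem_emb_pred_iff:
  "elem_emb \<sigma> M A N B \<Longrightarrow> x \<in> M \<Longrightarrow> \<sigma> x \<in> B \<longleftrightarrow> x \<in> A"
  using elem_embD[of \<sigma> M A N B "(!) [x]" "Pr 0"] by simp

lemma elem_emb_iso_image:
  assumes "elem_emb \<sigma> M A N B"
  shows "struct_iso \<sigma> M A (\<sigma> ` M) (B \<inter> \<sigma> ` M)"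
  unfolding struct_iso_def bij_betw_def
  using elem_emb_mem_iff[OF assms] elem_emb_eq_iff[OF assms] elem_emb_pred_iff[OF assms]
  by (auto intro: inj_onI)

lemma elem_emb_image_elem_sub:
  assumes "elem_emb \<sigma> M A N B"
  shows "elem_sub (\<sigma> ` M) N B"
  unfolding elem_sub_def elem_emb_def
proof (intro conjI allI impI)
  show "id ` \<sigma> ` M \<subseteq> N" using assms by (simp add: elem_emb_def)
next
  fix \<phi> e assume e: "e ` fv \<phi> \<subseteq> \<sigma> ` M"
  define e' where "e' = (\<lambda>i. inv_into M \<sigma> (e i))"
  have e': "e' ` fv \<phi> \<subseteq> M" "\<And>i. i \<in> fv \<phi> \<Longrightarrow> (\<sigma> \<circ> e') i = e i"
    using e by (auto simp: e'_def inv_into_into f_inv_into_f image_subset_iff)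
  have "sat (\<sigma> ` M) (B \<inter> \<sigma> ` M) \<phi> e \<longleftrightarrow> sat (\<sigma> ` M) (B \<inter> \<sigma> ` M) \<phi> (\<sigma> \<circ> e')"
    by (rule sat_cong) (simp only: e'(2))
  also have "\<dots> \<longleftrightarrow> sat M A \<phi> e'"
    using sat_struct_iso[OF elem_emb_iso_image[OF assms] e'(1)] by simp
  also have "\<dots> \<longleftrightarrow> sat N B \<phi> (\<sigma> \<circ> e')" by (rule elem_embD[OF assms e'(1)])
  also have "\<dots> \<longleftrightarrow> sat N B \<phi> (id \<circ> e)"
    by (rule sat_cong) (simp only: e'(2) id_o)
  finally show "sat (\<sigma> ` M) (B \<inter> \<sigma> ` M) \<phi> e \<longleftrightarrow> sat N B \<phi> (id \<circ> e)" .
qed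

text \<open>The recurring way to place a set in the range of \<sigma>: existence of an object
  satisfying the definition reflects to \<open>M\<close>, and the image of a witness there satisfies
  the definition in \<open>N\<close>, so it is \<open>y\<close>.\<close>

lemma elem_emb_definable:
  assumes emb: "elem_emb \<sigma> M A N B" and e: "e ` (fv \<phi> - {k}) \<subseteq> M" and y: "y \<in> N"
    and def: "\<And>z. z \<in> N \<Longrightarrow> sat N B \<phi> ((\<sigma> \<circ> e)(k := z)) \<longleftrightarrow> z = y"
  obtains y' where "y' \<in> M" "\<sigma> y' = y"
proof -
  have "sat N B (Ex k \<phi>) (\<sigma> \<circ> e)" using y def by auto
  then have "sat M A (Ex k \<phi>) e" using elem_embD[OF emb, of e "Ex k \<phi>"] e by simp
  then obtain y' where y': "y' \<in> M" "sat M A \<phi> (e(k := y'))" by auto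
  have "(e(k := y')) ` fv \<phi> \<subseteq> M" using e y' by auto
  then have "sat N B \<phi> (\<sigma> \<circ> e(k := y'))" using elem_embD[OF emb] y'(2) by blast
  then have "\<sigma> y' = y"
    using def[OF elem_emb_in[OF emb y'(1)]] by (simp add: fun_upd_comp)
  then show thesis using that y' by blast
qed

subsection \<open>Transitive classes closed under pairing\<close>

text \<open>Transitivity and pairing make Kuratowski pairs absolute, so that
  \<open>upair_in\<close>, \<open>pair_in\<close> and later \<open>pmem_in\<close> agree with the
  true notions. Full models have the property, and so do the levels \<open>Lset A \<tau>\<close>
  satisfying \<open>ZFC_minus\<close>.\<close>

definition pair_closed :: "'v::zfc set \<Rightarrow> bool"
  where "pair_closed M \<longleftrightarrow> (\<forall>x\<in>M. elts x \<subseteq> M) \<and> (\<forall>x\<in>M. \<forall>y\<in>M. vset {x, y} \<in> M)"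

lemma pair_closed_mem: "pair_closed M \<Longrightarrow> x \<in> M \<Longrightarrow> y \<in> elts x \<Longrightarrow> y \<in> M"
  by (auto simp: pair_closed_def)

lemma pair_closed_vpair: "pair_closed M \<Longrightarrow> x \<in> M \<Longrightarrow> y \<in> M \<Longrightarrow> vpair x y \<in> M"
  unfolding pair_closed_def vpair_def by blast

lemma pair_closed_vpairD:
  assumes "pair_closed M" "vpair x y \<in> M"
  shows "x \<in> M" "y \<in> M"
proof -
  have "vset {x, y} \<in> M"
    using assms pair_closed_mem[of M "vpair x y" "vset {x, y}"] by (simp add: elts_vpair)
  then show "x \<in> M" "y \<in> M" using assms(1) pair_closed_mem[of M "vset {x, y}"] by simp_all
qed

lemma pair_closed_mem_vpairD:
  assumes "pair_closed M" "a \<in> M" "vpair x y \<in> elts a"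
  shows "x \<in> M" "y \<in> M"
  using pair_closed_vpairD[OF assms(1) pair_closed_mem[OF assms]] by auto

lemma upair_in_iff:
  assumes "pair_closed M" "x \<in> M" "y \<in> M" "z \<in> M"
  shows "upair_in M z x y \<longleftrightarrow> z = vset {x, y}"
proof -
  have "elts z \<subseteq> M" using assms(1,4) by (simp add: pair_closed_def)
  then have "upair_in M z x y \<longleftrightarrow> elts z = {x, y}"
    using assms(2,3) unfolding upair_in_def set_eq_iff insert_iff empty_iff by blast
  also have "\<dots> \<longleftrightarrow> z = vset {x, y}" by (metis elts_vset_upair extensionality)
  finally show ?thesis .
qed

lemma pair_in_iff:
  assumes "pair_closed M" "x \<in> M" "y \<in> M" "z \<in> M"
  shows "pair_in M z x y \<longleftrightarrow> z = vpair x y"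
proof -
  have up: "vset {x, x} \<in> M" "vset {x, y} \<in> M" using assms unfolding pair_closed_def by blast+
  have "pair_in M z x y \<longleftrightarrow> (\<forall>w\<in>M. w \<in> elts z \<longleftrightarrow> w = vset {x, x} \<or> w = vset {x, y})"
    unfolding pair_in_def
    by (intro ball_cong refl) (simp only: upair_in_iff[OF assms(1) assms(2,2)] upair_in_iff[OF assms(1-3)])
  also have "\<dots> \<longleftrightarrow> elts z = {vset {x, x}, vset {x, y}}"
  proof -
    have "elts z \<subseteq> M" using assms(1,4) by (simp add: pair_closed_def)
    then show ?thesis using up unfolding set_eq_iff insert_iff empty_iff by blast
  qed
  also have "\<dots> \<longleftrightarrow> z = vpair x y" by (metis elts_vpair extensionality)
  finally show ?thesis .
qed

lemma ZFC_minus_pair_closed: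
  assumes "ZFC_minus M A" and tr: "\<And>x. x \<in> M \<Longrightarrow> elts x \<subseteq> M"
  shows "pair_closed M"
  unfolding pair_closed_def
proof (intro conjI ballI)
  fix x y assume xy: "x \<in> M" "y \<in> M"
  have "\<forall>x\<in>M. \<forall>y\<in>M. \<exists>z\<in>M. upair_in M z x y" using assms(1) by (simp add: ZFC_minus_def)
  then obtain z where z: "z \<in> M" "upair_in M z x y" using xy by blast
  then have "elts z = {x, y}" using tr[OF z(1)] xy unfolding upair_in_def by blast
  then have "z = vset {x, y}" by (metis elts_vset_upair extensionality)
  then show "vset {x, y} \<in> M" using z by simp
qed (rule tr)

text \<open>The bound variables 100 and 101 must not be used for \<open>x\<close>, \<open>y\<close> and \<open>z\<close>.\<close>
definition upairF :: "nat \<Rightarrow> nat \<Rightarrow> nat \<Rightarrow> fm"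
  where "upairF z x y = All 101 (Iff (Mem 101 z) (Or (Eq 101 x) (Eq 101 y)))"

definition pairF :: "nat \<Rightarrow> nat \<Rightarrow> nat \<Rightarrow> fm"
  where "pairF z x y = All 100 (Iff (Mem 100 z) (Or (upairF 100 x x) (upairF 100 x y)))"

lemma fv_pairF [simp]:
  "x < 100 \<Longrightarrow> y < 100 \<Longrightarrow> z < 100 \<Longrightarrow> fv (pairF z x y) = {z, x, y}"
  by (auto simp: pairF_def upairF_def)

lemma sat_pairF [simp]:
  "x < 100 \<Longrightarrow> y < 100 \<Longrightarrow> z < 100 \<Longrightarrow> sat M A (pairF z x y) e \<longleftrightarrow> pair_in M (e z) (e x) (e y)"
  by (simp add: pairF_def upairF_def pair_in_def upair_in_def)

section \<open>Transitivity and ordinals of the relativized constructible hierarchy\<close>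

lemma Defset_subset: "x \<in> Defset M A \<Longrightarrow> elts x \<subseteq> M"
  by (auto simp: Defset_def)

lemma Defset_transitive: "(\<And>x. x \<in> M \<Longrightarrow> elts x \<subseteq> M) \<Longrightarrow> M \<subseteq> Defset M A"
proof
  fix m assume tr: "\<And>x. x \<in> M \<Longrightarrow> elts x \<subseteq> M" and m: "m \<in> M"
  have "elts m = {y \<in> M. sat M A (Mem 0 1) (((!) [m, m])(0 := y))}"
    using tr[OF m] by auto
  moreover have "(!) [m, m] ` (fv (Mem 0 1) - {0}) \<subseteq> M" using m by auto
  ultimately show "m \<in> Defset M A" unfolding Defset_def by blast
qed

text \<open>By induction each earlier level is transitive, hence included in its own definable power
  set, which is part of the later level.\<close>

lemma Lset_transitive: "x \<in> Lset A \<tau> \<Longrightarrow> elts x \<subseteq> Lset A \<tau>"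
proof (induction \<tau> arbitrary: x rule: wf_induct_rule[OF wf_mem_rel])
  case (1 \<tau>)
  then obtain \<alpha> where \<alpha>: "\<alpha> \<in> elts \<tau>" "x \<in> Defset (Lset A \<alpha>) (Lpred A \<alpha>)"
    by (auto simp: Lset.simps[of A \<tau>])
  then have "Lset A \<alpha> \<subseteq> Defset (Lset A \<alpha>) (Lpred A \<alpha>)"
    using "1.IH" by (intro Defset_transitive) (simp add: mem_rel_iff)
  then show ?case
    using \<alpha> Defset_subset[OF \<alpha>(2)] by (subst Lset.simps) blast
qed

text \<open>Being spread out speaks of \<theta> as an element of the model, while subcompleteness
  asks for \<theta> below \<tau>. The two are reconciled because an ordinal definable over stage
  \<alpha> is a subset of \<alpha>.\<close>

lemma Ord_in_Lset: "Ord \<tau> \<Longrightarrow> Ord \<beta> \<Longrightarrow> \<beta> \<in> Lset A \<tau> \<Longrightarrow> \<beta> \<in> elts \<tau>"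
proof (induction \<tau> arbitrary: \<beta> rule: wf_induct_rule[OF wf_mem_rel])
  case (1 \<tau>)
  then obtain \<alpha> where \<alpha>: "\<alpha> \<in> elts \<tau>" "\<beta> \<in> Defset (Lset A \<alpha>) (Lpred A \<alpha>)"
    by (auto simp: Lset.simps[of A \<tau>])
  have "elts \<beta> \<subseteq> elts \<alpha>"
    using "1.IH"[of \<alpha>] \<alpha>(1) Defset_subset[OF \<alpha>(2)] Ord_mem "1.prems"
    by (auto simp: mem_rel_iff)
  then show ?case
    using Ord_subset_imp[OF "1.prems"(2) Ord_mem[OF "1.prems"(1) \<alpha>(1)]] \<alpha>(1) Ord_trans[OF "1.prems"(1)]
    by blast
qed

section \<open>The forcing relation\<close>

text \<open>Applied both to \<open>PS S\<close> and to the preimage of \<open>PS S\<close> under an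
  elementary embedding.\<close>

locale forcing_order =
  fixes P :: "'v::zfc"
  assumes le_refl: "p \<in> conds P \<Longrightarrow> le P p p"
    and le_trans: "le P r q \<Longrightarrow> le P q p \<Longrightarrow> le P r p"
begin

text \<open>Regular open classes of conditions. Their local character (\<open>reg_local\<close>)
  stands in for the forcing theorem: a forced statement may be proved after passing to a stronger
  condition that decides the names involved. Nothing lies below a non-condition, so there a regular
  predicate holds vacuously; hence the hypotheses \<open>p \<in> conds P\<close> further on.\<close>

definition reg :: "('v \<Rightarrow> bool) \<Rightarrow> bool"
  where "reg \<Phi> \<longleftrightarrow> (\<forall>p q. \<Phi> p \<longrightarrow> le P q p \<longrightarrow> \<Phi> q) \<and>
    (\<forall>p. (\<forall>q. le P q p \<longrightarrow> (\<exists>s. le P s q \<and> \<Phi> s)) \<longrightarrow> \<Phi> p)"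

lemma le_conds: "le P q p \<Longrightarrow> q \<in> conds P" "le P q p \<Longrightarrow> p \<in> conds P"
  by (auto simp: le_def)

lemma le_refl_left: "le P q p \<Longrightarrow> le P q q"
  using le_refl le_conds by blast

lemma reg_mono: "reg \<Phi> \<Longrightarrow> \<Phi> p \<Longrightarrow> le P q p \<Longrightarrow> \<Phi> q"
  unfolding reg_def by blast

lemma reg_local: "reg \<Phi> \<Longrightarrow> (\<And>q. le P q p \<Longrightarrow> \<exists>s. le P s q \<and> \<Phi> s) \<Longrightarrow> \<Phi> p"
  unfolding reg_def by blast

lemma regI:
  "(\<And>p q. \<Phi> p \<Longrightarrow> le P q p \<Longrightarrow> \<Phi> q) \<Longrightarrow>
   (\<And>p. (\<And>q. le P q p \<Longrightarrow> \<exists>s. le P s q \<and> \<Phi> s) \<Longrightarrow> \<Phi> p) \<Longrightarrow> reg \<Phi>"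
  unfolding reg_def by blast

lemma reg_dense_ex: "reg (\<lambda>p. \<forall>q. le P q p \<longrightarrow> (\<exists>s. le P s q \<and> \<Phi> s))"
  by (rule regI) (blast intro: le_trans le_refl_left)+

lemma reg_f_or: "reg (f_or P \<Phi> \<Psi>)"
  unfolding f_or_def by (rule reg_dense_ex)

lemma reg_f_ex: "reg (f_ex P \<Phi>)"
  unfolding f_ex_def by (rule reg_dense_ex)

lemma reg_f_mem: "reg (f_mem P a b)"
  unfolding f_mem_def by (rule reg_dense_ex)

lemma reg_f_and: "reg \<Phi> \<Longrightarrow> reg \<Psi> \<Longrightarrow> reg (f_and \<Phi> \<Psi>)"
  unfolding reg_def f_and_def by blast

lemma reg_f_all: "(\<And>x. reg (\<Phi> x)) \<Longrightarrow> reg (f_all \<Phi>)"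
  unfolding reg_def f_all_def by blast

text \<open>The premise \<Phi> travels down to the stronger condition by monotonicity, and the
  conclusion \<Psi> comes back up by local character.\<close>

lemma reg_f_imp:
  assumes "reg \<Phi>" "reg \<Psi>" shows "reg (f_imp P \<Phi> \<Psi>)"
proof (rule regI)
  fix p q assume "f_imp P \<Phi> \<Psi> p" "le P q p"
  then show "f_imp P \<Phi> \<Psi> q" unfolding f_imp_def by (blast intro: le_trans)
next
  fix p assume d: "\<And>q. le P q p \<Longrightarrow> \<exists>s. le P s q \<and> f_imp P \<Phi> \<Psi> s"
  show "f_imp P \<Phi> \<Psi> p" unfolding f_imp_def
  proof (intro allI impI)
    fix q assume q: "le P q p" "\<Phi> q"
    show "\<Psi> q"
    proof (rule reg_local[OF assms(2)])
      fix r assume r: "le P r q"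
      obtain s where s: "le P s r" "f_imp P \<Phi> \<Psi> s" using d le_trans[OF r q(1)] by blast
      have "\<Phi> s" using reg_mono[OF assms(1) q(2)] le_trans[OF s(1) r] by blast
      then have "\<Psi> s" using s le_refl_left unfolding f_imp_def by blast
      then show "\<exists>s. le P s r \<and> \<Psi> s" using s(1) by blast
    qed
  qed
qed

lemma reg_f_not: "reg \<Phi> \<Longrightarrow> reg (f_not P \<Phi>)"
proof (rule regI)
  fix p assume "reg \<Phi>" and d: "\<And>q. le P q p \<Longrightarrow> \<exists>s. le P s q \<and> f_not P \<Phi> s"
  then show "f_not P \<Phi> p"
    unfolding f_not_def by (meson le_refl_left reg_mono)
qed (unfold f_not_def, blast intro: le_trans)

lemma f_exI: "(\<And>q. le P q p \<Longrightarrow> \<exists>x. \<Phi> x q) \<Longrightarrow> f_ex P \<Phi> p"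
  unfolding f_ex_def using le_refl_left by blast

lemma f_exD: "f_ex P \<Phi> p \<Longrightarrow> le P q p \<Longrightarrow> \<exists>s x. le P s q \<and> \<Phi> x s"
  unfolding f_ex_def by blast

lemma f_iffI:
  "(\<And>q. le P q p \<Longrightarrow> \<Phi> q \<longleftrightarrow> \<Psi> q) \<Longrightarrow> f_iff P \<Phi> \<Psi> p"
  unfolding f_iff_def f_and_def f_imp_def by blast

lemma f_iffD: "f_iff P \<Phi> \<Psi> p \<Longrightarrow> le P q p \<Longrightarrow> \<Phi> q \<longleftrightarrow> \<Psi> q"
  unfolding f_iff_def f_and_def f_imp_def by blast

subsection \<open>Equality and membership\<close>

lemma f_eq_iff:
  "f_eq P a b p \<longleftrightarrow>
    (\<forall>c r q. vpair c r \<in> elts a \<longrightarrow> le P q p \<longrightarrow> le P q r \<longrightarrow>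
       (\<exists>s d t. le P s q \<and> vpair d t \<in> elts b \<and> le P s t \<and> f_eq P c d s)) \<and>
    (\<forall>d t q. vpair d t \<in> elts b \<longrightarrow> le P q p \<longrightarrow> le P q t \<longrightarrow>
       (\<exists>s c r. le P s q \<and> vpair c r \<in> elts a \<and> le P s r \<and> f_eq P c d s))"
  by (subst f_eq.simps) blast

lemma f_eqD1:
  assumes "f_eq P a b p" "vpair c r \<in> elts a" "le P q p" "le P q r"
  obtains s d t where "le P s q" "vpair d t \<in> elts b" "le P s t" "f_eq P c d s"
  using assms unfolding f_eq_iff[of a b p] by blast

lemma f_eqD2:
  assumes "f_eq P a b p" "vpair d t \<in> elts b" "le P q p" "le P q t"
  obtains s c r where "le P s q" "vpair c r \<in> elts a" "le P s r" "f_eq P c d s"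
  using assms unfolding f_eq_iff[of a b p] by blast

lemma reg_f_eq: "reg (f_eq P a b)"
proof (rule regI)
  fix p q assume "f_eq P a b p" "le P q p"
  then show "f_eq P a b q" unfolding f_eq_iff[of a b] by (meson le_trans)
next
  fix p assume d: "\<And>q. le P q p \<Longrightarrow> \<exists>s. le P s q \<and> f_eq P a b s"
  show "f_eq P a b p" unfolding f_eq_iff[of a b]
  proof (intro conjI allI impI)
    fix c r q assume c: "vpair c r \<in> elts a" "le P q p" "le P q r"
    obtain q' where q': "le P q' q" "f_eq P a b q'" using d[OF c(2)] by blast
    show "\<exists>s d t. le P s q \<and> vpair d t \<in> elts b \<and> le P s t \<and> f_eq P c d s"
      by (rule f_eqD1[OF q'(2) c(1) le_refl_left[OF q'(1)] le_trans[OF q'(1) c(3)]])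
        (use le_trans[OF _ q'(1)] in blast)
  next
    fix c r q assume c: "vpair c r \<in> elts b" "le P q p" "le P q r"
    obtain q' where q': "le P q' q" "f_eq P a b q'" using d[OF c(2)] by blast
    show "\<exists>s d t. le P s q \<and> vpair d t \<in> elts a \<and> le P s t \<and> f_eq P d c s"
      by (rule f_eqD2[OF q'(2) c(1) le_refl_left[OF q'(1)] le_trans[OF q'(1) c(3)]])
        (use le_trans[OF _ q'(1)] in blast)
  qed
qed

text \<open>Induction runs along the transitive closure of membership, because a subname
  \<open>c\<close> sits inside \<open>a\<close> only through the pair
  \<open>vpair c r\<close>.\<close>

lemma f_eq_refl: "f_eq P a a p"
proof (induction a arbitrary: p rule: wf_induct_rule[OF wf_mem_rel_trancl])
  case (1 a)
  then show ?case unfolding f_eq_iff[of a a] using vpair_fst_mem_trancl le_refl_left by blast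
qed

lemma f_eq_sym: "f_eq P a b p \<Longrightarrow> f_eq P b a p"
proof (induction a arbitrary: b p rule: wf_induct_rule[OF wf_mem_rel_trancl])
  case (1 a)
  show ?case unfolding f_eq_iff[of b a]
  proof (intro conjI allI impI)
    fix c r q assume c: "vpair c r \<in> elts b" "le P q p" "le P q r"
    show "\<exists>s d t. le P s q \<and> vpair d t \<in> elts a \<and> le P s t \<and> f_eq P c d s"
      by (rule f_eqD2[OF "1.prems" c]) (use "1.IH"[OF vpair_fst_mem_trancl] in blast)
  next
    fix c r q assume c: "vpair c r \<in> elts a" "le P q p" "le P q r"
    show "\<exists>s d t. le P s q \<and> vpair d t \<in> elts b \<and> le P s t \<and> f_eq P d c s"
      by (rule f_eqD1[OF "1.prems" c]) (use "1.IH"[OF vpair_fst_mem_trancl[OF c(1)]] in blast)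
  qed
qed

lemma f_eq_mono: "f_eq P a b p \<Longrightarrow> le P q p \<Longrightarrow> f_eq P a b q"
  by (rule reg_mono[OF reg_f_eq])

lemma f_eq_trans: "f_eq P a b p \<Longrightarrow> f_eq P b c p \<Longrightarrow> f_eq P a c p"
proof (induction a arbitrary: b c p rule: wf_induct_rule[OF wf_mem_rel_trancl])
  case (1 a)
  note ab = "1.prems"(1) and bc = "1.prems"(2)
  show ?case unfolding f_eq_iff[of a c]
  proof (intro conjI allI impI)
    fix x r q assume x: "vpair x r \<in> elts a" "le P q p" "le P q r"
    obtain s d t where s: "le P s q" "vpair d t \<in> elts b" "le P s t" "f_eq P x d s"
      by (rule f_eqD1[OF ab x])
    obtain s' e u where s': "le P s' s" "vpair e u \<in> elts c" "le P s' u" "f_eq P d e s'"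
      by (rule f_eqD1[OF bc s(2) le_trans[OF s(1) x(2)] s(3)])
    have "f_eq P x e s'" using "1.IH"[OF vpair_fst_mem_trancl[OF x(1)] f_eq_mono[OF s(4) s'(1)] s'(4)] .
    then show "\<exists>s d t. le P s q \<and> vpair d t \<in> elts c \<and> le P s t \<and> f_eq P x d s"
      using s' le_trans[OF s'(1) s(1)] by blast
  next
    fix x r q assume x: "vpair x r \<in> elts c" "le P q p" "le P q r"
    obtain s d t where s: "le P s q" "vpair d t \<in> elts b" "le P s t" "f_eq P d x s"
      by (rule f_eqD2[OF bc x])
    obtain s' e u where s': "le P s' s" "vpair e u \<in> elts a" "le P s' u" "f_eq P e d s'"
      by (rule f_eqD2[OF ab s(2) le_trans[OF s(1) x(2)] s(3)])
    have "f_eq P e x s'" using "1.IH"[OF vpair_fst_mem_trancl[OF s'(2)] s'(4) f_eq_mono[OF s(4) s'(1)]] .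
    then show "\<exists>s d t. le P s q \<and> vpair d t \<in> elts a \<and> le P s t \<and> f_eq P d x s"
      using s' le_trans[OF s'(1) s(1)] by blast
  qed
qed

lemma f_memD:
  assumes "f_mem P a b p" "le P q p"
  obtains s d t where "le P s q" "vpair d t \<in> elts b" "le P s t" "f_eq P a d s"
  using assms unfolding f_mem_def by blast

lemma f_mem_mono: "f_mem P a b p \<Longrightarrow> le P q p \<Longrightarrow> f_mem P a b q"
  by (rule reg_mono[OF reg_f_mem])

lemma f_memI: "vpair d t \<in> elts b \<Longrightarrow> le P p t \<Longrightarrow> f_eq P a d p \<Longrightarrow> f_mem P a b p"
  unfolding f_mem_def by (meson f_eq_mono le_refl_left le_trans)

lemma f_mem_eq_left: "f_eq P a a' p \<Longrightarrow> f_mem P a b p \<Longrightarrow> f_mem P a' b p"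
  unfolding f_mem_def by (meson f_eq_mono f_eq_sym f_eq_trans le_trans)

lemma f_mem_eq_right:
  assumes "f_eq P b b' p" "f_mem P a b p"
  shows "f_mem P a b' p"
proof (rule reg_local[OF reg_f_mem])
  fix q assume q: "le P q p"
  obtain s d t where s: "le P s q" "vpair d t \<in> elts b" "le P s t" "f_eq P a d s"
    by (rule f_memD[OF assms(2) q])
  obtain s' e u where s': "le P s' s" "vpair e u \<in> elts b'" "le P s' u" "f_eq P d e s'"
    by (rule f_eqD1[OF assms(1) s(2) le_trans[OF s(1) q] s(3)])
  have "f_mem P a b' s'" using f_memI[OF s'(2,3)] f_eq_trans[OF f_eq_mono[OF s(4) s'(1)] s'(4)] .
  then show "\<exists>s. le P s q \<and> f_mem P a b' s" using le_trans[OF s'(1) s(1)] by blast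
qed

lemma f_mem_eq_iff: "f_eq P a a' p \<Longrightarrow> f_eq P b b' p \<Longrightarrow> f_mem P a b p \<longleftrightarrow> f_mem P a' b' p"
  by (meson f_eq_sym f_mem_eq_left f_mem_eq_right)

text \<open>An entry \<open>vpair c r\<close> of a name makes every condition below \<open>r\<close>
  force \<open>c\<close> to be a member, so agreement on forced membership produces the matching
  entries that \<open>f_eq\<close> asks for.\<close>

lemma f_eq_ext:
  assumes "\<And>w q. le P q p \<Longrightarrow> f_mem P w a q \<longleftrightarrow> f_mem P w b q"
  shows "f_eq P a b p"
  unfolding f_eq_iff[of a b]
proof (intro conjI allI impI)
  fix c r q assume c: "vpair c r \<in> elts a" "le P q p" "le P q r"
  have "f_mem P c b q" using assms[OF c(2)] f_memI[OF c(1,3) f_eq_refl] by blast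
  then obtain s d t where "le P s q" "vpair d t \<in> elts b" "le P s t" "f_eq P c d s"
    using le_refl_left[OF c(2)] by (rule f_memD)
  then show "\<exists>s d t. le P s q \<and> vpair d t \<in> elts b \<and> le P s t \<and> f_eq P c d s" by blast
next
  fix c r q assume c: "vpair c r \<in> elts b" "le P q p" "le P q r"
  have "f_mem P c a q" using assms[OF c(2)] f_memI[OF c(1,3) f_eq_refl] by blast
  then obtain s d t where "le P s q" "vpair d t \<in> elts a" "le P s t" "f_eq P c d s"
    using le_refl_left[OF c(2)] by (rule f_memD)
  then show "\<exists>s d t. le P s q \<and> vpair d t \<in> elts a \<and> le P s t \<and> f_eq P d c s"
    using f_eq_sym by blast
qed

subsection \<open>Canonical names\<close>

lemma vpair_in_check: "vpair c r \<in> elts (check P x) \<longleftrightarrow> r \<in> conds P \<and> (\<exists>y\<in>elts x. c = check P y)"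
  unfolding elts_check by auto

text \<open>A canonical name attaches every condition to each of its entries, as there may be no
  largest one. The condition \<open>s\<close> can therefore serve as its own label, and the label
  disappears from the characterization.\<close>

lemma f_mem_check_iff:
  "f_mem P a (check P x) p \<longleftrightarrow> (\<forall>q. le P q p \<longrightarrow> (\<exists>s. le P s q \<and> (\<exists>y\<in>elts x. f_eq P a (check P y) s)))"
proof -
  have "(\<exists>d t. vpair d t \<in> elts (check P x) \<and> le P s t \<and> f_eq P a d s) \<longleftrightarrow>
      (\<exists>y\<in>elts x. f_eq P a (check P y) s)" if "le P s q" for s q
    unfolding vpair_in_check using le_refl_left[OF that] le_conds(1)[OF that] by metis
  then show ?thesis unfolding f_mem_def by metis
qed

lemma f_mem_checkD:
  assumes "f_mem P a (check P x) p" "le P q p"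
  obtains s y where "le P s q" "y \<in> elts x" "f_eq P a (check P y) s"
  using assms unfolding f_mem_check_iff by blast

lemma f_mem_checkI: "y \<in> elts x \<Longrightarrow> f_eq P a (check P y) p \<Longrightarrow> f_mem P a (check P x) p"
  unfolding f_mem_check_iff using f_eq_mono le_refl_left by blast

lemma f_eq_check_iff: "p \<in> conds P \<Longrightarrow> f_eq P (check P x) (check P y) p \<longleftrightarrow> x = y"
proof
  show "x = y" if "p \<in> conds P" "f_eq P (check P x) (check P y) p"
    using that
  proof (induction x arbitrary: y p rule: wf_induct_rule[OF wf_mem_rel])
    case (1 x)
    note p = le_refl[OF "1.prems"(1)]
    have IH: "z = w" if "z \<in> elts x" "f_eq P (check P z) (check P w) s" "s \<in> conds P" for z w s
      using "1.IH" that by (simp add: mem_rel_iff)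
    have "elts x = elts y"
    proof (intro set_eqI iffI)
      fix z assume z: "z \<in> elts x"
      then have "vpair (check P z) p \<in> elts (check P x)" using "1.prems" by (auto simp: vpair_in_check)
      then obtain s d t where "le P s p" "vpair d t \<in> elts (check P y)" "f_eq P (check P z) d s"
        by (rule f_eqD1[OF "1.prems"(2) _ p p])
      then show "z \<in> elts y" using IH[OF z] le_conds(1) unfolding vpair_in_check by blast
    next
      fix z assume z: "z \<in> elts y"
      then have "vpair (check P z) p \<in> elts (check P y)" using "1.prems" by (auto simp: vpair_in_check)
      then obtain s c r where "le P s p" "vpair c r \<in> elts (check P x)" "f_eq P c (check P z) s"
        by (rule f_eqD2[OF "1.prems"(2) _ p p])
      then show "z \<in> elts x" using IH le_conds(1) unfolding vpair_in_check by blast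
    qed
    then show ?case by (rule extensionality)
  qed
qed (simp add: f_eq_refl)

lemma f_mem_check_check_iff: "p \<in> conds P \<Longrightarrow> f_mem P (check P x) (check P y) p \<longleftrightarrow> x \<in> elts y"
  using f_mem_checkI[OF _ f_eq_refl] f_mem_checkD[of "check P x" y p p] le_refl f_eq_check_iff le_conds
  by metis

section \<open>Forced satisfaction and its absoluteness for ground model structures\<close>

lemma reg_f_sat: "reg (f_sat P M A \<phi> e)"
  by (induction \<phi> arbitrary: e)
    (auto intro: reg_f_mem reg_f_eq reg_f_not reg_f_and reg_f_all reg_f_imp)

lemma f_sat_eq_cong:
  "(\<And>i. i \<in> fv \<phi> \<Longrightarrow> f_eq P (e i) (e' i) p) \<Longrightarrow> f_sat P M A \<phi> e p \<longleftrightarrow> f_sat P M A \<phi> e' p"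
proof (induction \<phi> arbitrary: e e' p)
  case (Mem i j)
  then show ?case by (simp add: f_mem_eq_iff)
next
  case (Eq i j)
  then have "f_eq P (e i) (e' i) p" "f_eq P (e j) (e' j) p" by auto
  then show ?case by simp (meson f_eq_sym f_eq_trans)
next
  case (Pr i)
  then show ?case by (simp add: f_mem_eq_iff[OF _ f_eq_refl])
next
  case (Neg \<phi>)
  have "f_sat P M A \<phi> e q \<longleftrightarrow> f_sat P M A \<phi> e' q" if "le P q p" for q
    by (rule Neg.IH) (use f_eq_mono[OF Neg.prems that] in simp)
  then show ?case by (simp add: f_not_def)
next
  case (Conj \<phi> \<psi>)
  have "f_sat P M A \<phi> e p \<longleftrightarrow> f_sat P M A \<phi> e' p" by (rule Conj.IH(1)) (use Conj.prems in auto)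
  moreover have "f_sat P M A \<psi> e p \<longleftrightarrow> f_sat P M A \<psi> e' p"
    by (rule Conj.IH(2)) (use Conj.prems in auto)
  ultimately show ?case by (simp add: f_and_def)
next
  case (All n \<phi>)
  have "f_sat P M A \<phi> (e(n := x)) q \<longleftrightarrow> f_sat P M A \<phi> (e'(n := x)) q" if "le P q p" for x q
    by (rule All.IH) (use f_eq_mono[OF All.prems that] f_eq_refl in simp)
  then show ?case by (simp add: f_all_def f_imp_def)
qed

text \<open>Forcing does not change satisfaction in a ground model structure. In the quantifier
  case, a name for an element of \<open>check P M\<close> is equal to some canonical name below
  every stronger condition, so \<open>reg_local\<close> and \<open>f_sat_eq_cong\<close> reduce it
  to the induction hypothesis.\<close>

lemma f_sat_check_iff:
  "p \<in> conds P \<Longrightarrow>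
    f_sat P (check P M) (check P A) \<phi> (\<lambda>i. check P (e i)) p \<longleftrightarrow> sat (elts M) (elts A) \<phi> e"
proof (induction \<phi> arbitrary: e p)
  case (Neg \<phi>)
  then show ?case using le_conds(1) le_refl by (simp add: f_not_def) blast
next
  case (All n \<phi>)
  have upd: "(\<lambda>i. check P (e i))(n := check P x) = (\<lambda>i. check P ((e(n := x)) i))" for x by auto
  show ?case
  proof
    assume "f_sat P (check P M) (check P A) (All n \<phi>) (\<lambda>i. check P (e i)) p"
    then have "f_sat P (check P M) (check P A) \<phi> ((\<lambda>i. check P (e i))(n := check P x)) p" if "x \<in> elts M" for x
      using that le_refl[OF All.prems] f_mem_check_check_iff[OF All.prems]
      by (simp add: f_all_def f_imp_def)
    then have "sat (elts M) (elts A) \<phi> (e(n := x))" if "x \<in> elts M" for x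
      using that All.IH[OF All.prems] unfolding upd by blast
    then show "sat (elts M) (elts A) (All n \<phi>) e" by simp
  next
    assume s: "sat (elts M) (elts A) (All n \<phi>) e"
    have "f_sat P (check P M) (check P A) \<phi> ((\<lambda>i. check P (e i))(n := x)) q"
      if q: "f_mem P x (check P M) q" for x q
    proof (rule reg_local[OF reg_f_sat])
      fix r assume "le P r q"
      then obtain s y where y: "le P s r" "y \<in> elts M" "f_eq P x (check P y) s"
        by (rule f_mem_checkD[OF q])
      have "f_sat P (check P M) (check P A) \<phi> ((\<lambda>i. check P (e i))(n := check P y)) s"
        unfolding upd All.IH[OF le_conds(1)[OF y(1)]] using s y(2) unfolding sat.simps by blast
      then have "f_sat P (check P M) (check P A) \<phi> ((\<lambda>i. check P (e i))(n := x)) s"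
        by (subst f_sat_eq_cong) (use y(3) f_eq_refl in auto)
      then show "\<exists>s. le P s r \<and> f_sat P (check P M) (check P A) \<phi> ((\<lambda>i. check P (e i))(n := x)) s"
        using y(1) by blast
    qed
    then show "f_sat P (check P M) (check P A) (All n \<phi>) (\<lambda>i. check P (e i)) p"
      by (simp add: f_all_def f_imp_def)
  qed
qed (simp_all add: f_mem_check_check_iff f_eq_check_iff f_and_def)

subsection \<open>Pairs\<close>

lemma f_or_iff_cong:
  "(\<And>s. le P s p \<Longrightarrow> \<Phi> s \<longleftrightarrow> \<Phi>' s) \<Longrightarrow> (\<And>s. le P s p \<Longrightarrow> \<Psi> s \<longleftrightarrow> \<Psi>' s) \<Longrightarrow>
    f_or P \<Phi> \<Psi> p \<longleftrightarrow> f_or P \<Phi>' \<Psi>' p"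
  unfolding f_or_def by (meson le_trans)

lemma f_orI1: "reg \<Phi> \<Longrightarrow> \<Phi> p \<Longrightarrow> f_or P \<Phi> \<Psi> p"
  and f_orI2: "reg \<Psi> \<Longrightarrow> \<Psi> p \<Longrightarrow> f_or P \<Phi> \<Psi> p"
  unfolding f_or_def using reg_mono le_refl_left by blast+

lemma f_orD: "f_or P \<Phi> \<Psi> p \<Longrightarrow> le P q p \<Longrightarrow> \<exists>s. le P s q \<and> (\<Phi> s \<or> \<Psi> s)"
  unfolding f_or_def by blast

lemma f_upair_iff:
  "f_upair P z x y p \<longleftrightarrow>
    (\<forall>w q. le P q p \<longrightarrow> (f_mem P w z q \<longleftrightarrow> f_or P (f_eq P w x) (f_eq P w y) q))"
  unfolding f_upair_def f_all_def f_iff_def f_and_def f_imp_def by blast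

lemma f_pair_iff:
  "f_pair P z x y p \<longleftrightarrow>
    (\<forall>w q. le P q p \<longrightarrow> (f_mem P w z q \<longleftrightarrow> f_or P (f_upair P w x x) (f_upair P w x y) q))"
  unfolding f_pair_def f_all_def f_iff_def f_and_def f_imp_def by blast

lemma reg_f_upair: "reg (f_upair P z x y)"
  unfolding f_upair_def f_iff_def
  by (intro reg_f_all reg_f_and reg_f_imp reg_f_mem reg_f_or)

lemma reg_f_pair: "reg (f_pair P z x y)"
  unfolding f_pair_def f_iff_def
  by (intro reg_f_all reg_f_and reg_f_imp reg_f_mem reg_f_or)

lemma f_eq_cong: "f_eq P x x' p \<Longrightarrow> f_eq P y y' p \<Longrightarrow> f_eq P x y p \<longleftrightarrow> f_eq P x' y' p"
  by (meson f_eq_sym f_eq_trans)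

lemma f_upair_cong:
  assumes "f_eq P z z' p" "f_eq P x x' p" "f_eq P y y' p"
  shows "f_upair P z x y p \<longleftrightarrow> f_upair P z' x' y' p"
proof -
  have "f_mem P w z q \<longleftrightarrow> f_mem P w z' q" if "le P q p" for w q
    by (rule f_mem_eq_iff[OF f_eq_refl f_eq_mono[OF assms(1) that]])
  moreover have "f_or P (f_eq P w x) (f_eq P w y) q \<longleftrightarrow> f_or P (f_eq P w x') (f_eq P w y') q"
    if "le P q p" for w q
    by (rule f_or_iff_cong; rule f_eq_cong[OF f_eq_refl f_eq_mono]) (use assms le_trans that in blast)+
  ultimately show ?thesis unfolding f_upair_iff by simp
qed

lemma f_pair_cong:
  assumes "f_eq P z z' p" "f_eq P x x' p" "f_eq P y y' p"
  shows "f_pair P z x y p \<longleftrightarrow> f_pair P z' x' y' p"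
proof -
  have "f_mem P w z q \<longleftrightarrow> f_mem P w z' q" if "le P q p" for w q
    by (rule f_mem_eq_iff[OF f_eq_refl f_eq_mono[OF assms(1) that]])
  moreover have "f_or P (f_upair P w x x) (f_upair P w x y) q \<longleftrightarrow> f_or P (f_upair P w x' x') (f_upair P w x' y') q"
    if "le P q p" for w q
    by (rule f_or_iff_cong; rule f_upair_cong[OF f_eq_refl f_eq_mono f_eq_mono])
      (use assms le_trans that in blast)+
  ultimately show ?thesis unfolding f_pair_iff by simp
qed

lemma f_upair_unique: "f_upair P z x y p \<Longrightarrow> f_upair P z' x y p \<Longrightarrow> f_eq P z z' p"
  unfolding f_upair_iff by (rule f_eq_ext) blast

text \<open>Injectivity of pairs is argued inside the extension, which takes actual names for
  \<open>{x}\<close> and \<open>{x, y}\<close>. Every condition is attached to both entries.\<close>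

lemma ex_f_upair:
  obtains u where "\<And>p. f_upair P u x y p"
proof -
  let ?u = "vset ((\<lambda>r. vpair x r) ` conds P \<union> (\<lambda>r. vpair y r) ` conds P)"
  have u: "elts ?u = (\<lambda>r. vpair x r) ` conds P \<union> (\<lambda>r. vpair y r) ` conds P"
    unfolding conds_def by (intro elts_vset_small small_Un small_image small_elts)
  have "(\<exists>d t. vpair d t \<in> elts ?u \<and> le P s t \<and> f_eq P w d s) \<longleftrightarrow> f_eq P w x s \<or> f_eq P w y s"
    if "le P s q" for w s q
    using le_refl_left[OF that] le_conds(1)[OF that] unfolding u by (auto simp: image_iff)
  then have "f_upair P ?u x y p" for p
    unfolding f_upair_iff f_mem_def f_or_def by (simp cong: conj_cong)
  then show thesis by (rule that)
qed

lemma f_upair_check: "f_upair P (check P (vset {a, b})) (check P a) (check P b) p"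
  unfolding f_upair_iff f_mem_check_iff f_or_def by simp

lemma f_upair_check_iff:
  "f_upair P w (check P a) (check P b) p \<longleftrightarrow> f_eq P w (check P (vset {a, b})) p"
  using f_upair_unique[OF _ f_upair_check] f_upair_cong[OF _ f_eq_refl f_eq_refl] f_upair_check by blast

lemma f_pair_check: "f_pair P (check P (vpair a b)) (check P a) (check P b) p"
  unfolding f_pair_iff f_mem_check_iff f_or_def f_upair_check_iff elts_vpair by simp

text \<open>The usual argument for Kuratowski pairs, with densely many conditions deciding the
  disjunctions. \<open>{x}\<close> is \<open>{x'}\<close> or \<open>{x', y'}\<close>, so
  \<open>x'\<close> is an element of \<open>{x}\<close> either way; \<open>{x, y}\<close> is one of
  the same two sets, so \<open>y\<close> is \<open>x'\<close> or \<open>y'\<close>.\<close>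

lemma f_pair_inject_aux:
  assumes z: "f_pair P z x y p" "f_pair P z x' y' p" and q: "le P q p"
  shows "\<exists>s. le P s q \<and> f_eq P x x' s" and "\<exists>s. le P s q \<and> (f_eq P y x' s \<or> f_eq P y y' s)"
proof -
  obtain u where u: "\<And>p. f_upair P u x x p" using ex_f_upair[of x x] by blast
  obtain v where v: "\<And>p. f_upair P v x y p" using ex_f_upair[of x y] by blast
  have "f_mem P u z q" "f_mem P v z q"
    using z(1) q u v f_orI1[OF reg_f_upair] f_orI2[OF reg_f_upair] unfolding f_pair_iff by blast+
  then have uv: "f_or P (f_upair P u x' x') (f_upair P u x' y') q"
      "f_or P (f_upair P v x' x') (f_upair P v x' y') q"
    using z(2) q unfolding f_pair_iff by blast+
  obtain s where s: "le P s q" "f_upair P u x' x' s \<or> f_upair P u x' y' s"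
    using f_orD[OF uv(1) le_refl_left[OF q]] by blast
  then have "f_mem P x' u s"
    using f_orI1[OF reg_f_eq f_eq_refl] le_refl_left[OF s(1)] unfolding f_upair_iff by blast
  then have "f_or P (f_eq P x' x) (f_eq P x' x) s"
    using u le_refl_left[OF s(1)] unfolding f_upair_iff by blast
  then obtain t where "le P t s" "f_eq P x' x t"
    using f_orD[OF _ le_refl_left[OF s(1)]] by blast
  then show "\<exists>s. le P s q \<and> f_eq P x x' s" using le_trans[OF _ s(1)] f_eq_sym by blast
  obtain s where s: "le P s q" "f_upair P v x' x' s \<or> f_upair P v x' y' s"
    using f_orD[OF uv(2) le_refl_left[OF q]] by blast
  have "f_mem P y v s"
    using f_orI2[OF reg_f_eq f_eq_refl] v[of s] le_refl_left[OF s(1)] unfolding f_upair_iff by blast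
  then have "f_or P (f_eq P y x') (f_eq P y x') s \<or> f_or P (f_eq P y x') (f_eq P y y') s"
    using s(2) le_refl_left[OF s(1)] unfolding f_upair_iff by blast
  then obtain t where "le P t s" "f_eq P y x' t \<or> f_eq P y y' t"
    using f_orD[OF _ le_refl_left[OF s(1)]] by blast
  then show "\<exists>s. le P s q \<and> (f_eq P y x' s \<or> f_eq P y y' s)" using le_trans[OF _ s(1)] by blast
qed

lemma f_pair_inject:
  assumes z: "f_pair P z x y p" "f_pair P z x' y' p"
  shows "f_eq P x x' p" "f_eq P y y' p"
proof -
  show x: "f_eq P x x' p"
    by (rule reg_local[OF reg_f_eq]) (rule f_pair_inject_aux(1)[OF z])
  show "f_eq P y y' p"
  proof (rule reg_local[OF reg_f_eq])
    fix q assume q: "le P q p"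
    obtain s where s: "le P s q" "f_eq P y x' s \<or> f_eq P y y' s"
      using f_pair_inject_aux(2)[OF z q] by blast
    \<comment> \<open>The same fact with the two pairs exchanged. In the crossed case,
      \<open>y = x'\<close> and \<open>y' = x\<close>, equality of \<open>x\<close> and
      \<open>x'\<close> gives \<open>y = y'\<close>.\<close>
    obtain t where t: "le P t s" "f_eq P y' x t \<or> f_eq P y' y t"
      using f_pair_inject_aux(2)[OF z(2,1) le_trans[OF s(1) q]] by blast
    have "f_eq P x x' t" using f_eq_mono[OF x le_trans[OF t(1) le_trans[OF s(1) q]]] .
    then have "f_eq P y y' t"
      using s(2) t f_eq_mono[OF _ t(1)] f_eq_sym f_eq_trans by meson
    then show "\<exists>s. le P s q \<and> f_eq P y y' s" using le_trans[OF t(1) s(1)] by blast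
  qed
qed

subsection \<open>Functions\<close>

lemma reg_f_app: "reg (f_app P f x y)"
  unfolding f_app_def by (rule reg_f_ex)

lemma f_appI: "f_pair P z x y p \<Longrightarrow> f_mem P z f p \<Longrightarrow> f_app P f x y p"
  unfolding f_app_def f_and_def by (rule f_exI) (meson f_mem_mono reg_f_pair reg_mono)

lemma f_appD:
  assumes "f_app P f x y p" "le P q p"
  obtains s z where "le P s q" "f_pair P z x y s" "f_mem P z f s"
  using f_exD[OF assms[unfolded f_app_def]] unfolding f_and_def by blast

lemma f_app_cong:
  assumes "f_eq P x x' p" "f_eq P y y' p" "f_app P f x y p"
  shows "f_app P f x' y' p"
  unfolding f_app_def f_and_def
proof (subst f_ex_def, intro allI impI)
  fix q assume q: "le P q p"
  obtain s z where s: "le P s q" "f_pair P z x y s" "f_mem P z f s" by (rule f_appD[OF assms(3) q])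
  have "f_pair P z x' y' s"
    using f_pair_cong[OF f_eq_refl f_eq_mono[OF assms(1)] f_eq_mono[OF assms(2)]] s(1,2) le_trans q by blast
  then show "\<exists>s. le P s q \<and> (\<exists>z. f_pair P z x' y' s \<and> f_mem P z f s)" using s by blast
qed

lemma f_app_check:
  "vpair x y \<in> elts f \<Longrightarrow> f_app P (check P f) (check P x) (check P y) p"
  by (rule f_appI[OF f_pair_check]) (rule f_mem_checkI[OF _ f_eq_refl])

text \<open>A stronger condition decides which element of \<open>f\<close> witnesses the
  application, and injectivity of pairs then identifies argument and value.\<close>

lemma f_app_checkD:
  assumes "f_app P (check P f) x y p" "le P q p"
    and f: "\<And>z. z \<in> elts f \<Longrightarrow> \<exists>a b. z = vpair a b"
  obtains s a b where "le P s q" "vpair a b \<in> elts f" "f_eq P x (check P a) s" "f_eq P y (check P b) s"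
proof -
  obtain s z where s: "le P s q" "f_pair P z x y s" "f_mem P z (check P f) s"
    by (rule f_appD[OF assms(1,2)])
  obtain t w where t: "le P t s" "w \<in> elts f" "f_eq P z (check P w) t"
    by (rule f_mem_checkD[OF s(3) le_refl_left[OF s(1)]])
  obtain a b where w: "w = vpair a b" using f[OF t(2)] by blast
  have "f_pair P (check P w) x y t"
    using f_pair_cong[OF t(3) f_eq_refl f_eq_refl] reg_mono[OF reg_f_pair s(2) t(1)] by blast
  then show thesis
    using that[of t a b] f_pair_inject[OF _ f_pair_check[of a b]] le_trans[OF t(1) s(1)] t(2) w by blast
qed

lemma f_funI_check:
  assumes f: "elts f = {vpair x (\<sigma> x) | x. x \<in> elts M}" and \<sigma>: "\<And>x. x \<in> elts M \<Longrightarrow> \<sigma> x \<in> elts N"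
  shows "f_fun P (check P f) (check P M) (check P N) p"
proof -
  have fD: "\<And>z. z \<in> elts f \<Longrightarrow> \<exists>a b. z = vpair a b" unfolding f by blast
  have 1: "f_ex P (\<lambda>x. f_ex P (\<lambda>y. f_and (f_pair P z x y)
        (f_and (f_mem P x (check P M)) (f_mem P y (check P N))))) q"
    if z: "f_mem P z (check P f) q" for z q
    unfolding f_ex_def f_and_def
  proof (intro allI impI)
    fix r assume "le P r q"
    then obtain s w where s: "le P s r" "w \<in> elts f" "f_eq P z (check P w) s"
      by (rule f_mem_checkD[OF z])
    then obtain m where m: "m \<in> elts M" "w = vpair m (\<sigma> m)" unfolding f by blast
    have "f_pair P z (check P m) (check P (\<sigma> m)) t" if "le P t s" for t
      using f_pair_cong[OF f_eq_mono[OF s(3) that] f_eq_refl f_eq_refl] f_pair_check m(2) by blast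
    moreover have "f_mem P (check P m) (check P M) t" "f_mem P (check P (\<sigma> m)) (check P N) t" for t
      by (auto intro!: f_mem_checkI[OF _ f_eq_refl] m \<sigma>)
    ultimately show "\<exists>s. le P s r \<and> (\<exists>x. \<forall>q. le P q s \<longrightarrow> (\<exists>s. le P s q \<and> (\<exists>y. f_pair P z x y s \<and>
        f_mem P x (check P M) s \<and> f_mem P y (check P N) s)))"
      using s(1) le_refl_left by blast
  qed
  have 2: "f_ex P (\<lambda>y. f_app P (check P f) x y) q" if x: "f_mem P x (check P M) q" for x q
    unfolding f_ex_def
  proof (intro allI impI)
    fix r assume "le P r q"
    then obtain s m where s: "le P s r" "m \<in> elts M" "f_eq P x (check P m) s"
      by (rule f_mem_checkD[OF x])
    have "f_app P (check P f) (check P m) (check P (\<sigma> m)) s"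
      by (rule f_app_check) (use s(2) in \<open>auto simp: f\<close>)
    then show "\<exists>s. le P s r \<and> (\<exists>y. f_app P (check P f) x y s)"
      using f_app_cong[OF f_eq_sym[OF s(3)] f_eq_refl] s(1) by blast
  qed
  have 3: "f_eq P y y' q" if y: "f_app P (check P f) x y q" "f_app P (check P f) x y' q" for x y y' q
  proof (rule reg_local[OF reg_f_eq])
    fix r assume r: "le P r q"
    obtain s a b where s: "le P s r" "vpair a b \<in> elts f" "f_eq P x (check P a) s" "f_eq P y (check P b) s"
      by (rule f_app_checkD[OF y(1) r fD])
    obtain t c d where t: "le P t s" "vpair c d \<in> elts f" "f_eq P x (check P c) t" "f_eq P y' (check P d) t"
      by (rule f_app_checkD[OF y(2) le_trans[OF s(1) r] fD])
    have "f_eq P (check P a) (check P c) t"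
      using f_eq_trans[OF f_eq_sym[OF f_eq_mono[OF s(3) t(1)]] t(3)] .
    then have "a = c" using f_eq_check_iff le_conds(1)[OF t(1)] by blast
    then have "b = d" using s(2) t(2) unfolding f by auto
    then have "f_eq P y y' t" using f_eq_mono[OF s(4) t(1)] f_eq_sym[OF t(4)] f_eq_trans by blast
    then show "\<exists>s. le P s r \<and> f_eq P y y' s" using le_trans[OF t(1) s(1)] by blast
  qed
  show ?thesis
    unfolding f_fun_def using 1 2 3 by (auto simp: f_and_def f_all_def f_imp_def)
qed

text \<open>The assignments in question are arbitrary names. Below every condition they can be
  decided to be canonical ones on the free variables, where absoluteness of satisfaction and
  elementarity in the ground model apply.\<close>

lemma f_elem_embI_check:
  assumes f: "elts f = {vpair x (\<sigma> x) | x. x \<in> elts M}"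
    and \<sigma>: "elem_emb \<sigma> (elts M) (elts A) (elts N) (elts B)"
  shows "f_elem_emb P (check P f) (check P M) (check P A) (check P N) (check P B) p"
proof -
  have fD: "\<And>z. z \<in> elts f \<Longrightarrow> \<exists>a b. z = vpair a b" unfolding f by blast
  \<comment> \<open>The names are decided one variable after the other. A formula has only finitely
    many, so this works in an arbitrary forcing.\<close>
  have dec: "\<exists>s m. le P s q \<and> (\<forall>i\<in>I. m i \<in> elts M \<and> f_eq P (e i) (check P (m i)) s \<and>
      f_eq P (e' i) (check P (\<sigma> (m i))) s)"
    if "finite I" "q \<in> conds P" and "\<And>i. i \<in> I \<Longrightarrow> f_app P (check P f) (e i) (e' i) q" for I q and e e' :: "nat \<Rightarrow> 'v"
    using that
  proof (induction I)
    case empty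
    then show ?case using le_refl by blast
  next
    case (insert i I)
    then obtain s m where s: "le P s q" and m: "\<forall>i\<in>I. m i \<in> elts M \<and> f_eq P (e i) (check P (m i)) s \<and>
      f_eq P (e' i) (check P (\<sigma> (m i))) s" by blast
    obtain t a b where t: "le P t s" "vpair a b \<in> elts f" "f_eq P (e i) (check P a) t" "f_eq P (e' i) (check P b) t"
      using f_app_checkD[OF _ s fD] insert.prems(2) by blast
    have "a \<in> elts M" "b = \<sigma> a" using t(2) unfolding f by auto
    then have "\<forall>j\<in>insert i I. (m(i := a)) j \<in> elts M \<and> f_eq P (e j) (check P ((m(i := a)) j)) t \<and>
      f_eq P (e' j) (check P (\<sigma> ((m(i := a)) j))) t"
      using m t(3,4) f_eq_mono[OF _ t(1)] \<open>i \<notin> I\<close> by auto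
    then show ?case using le_trans[OF t(1) s] by blast
  qed
  have "f_sat P (check P M) (check P A) \<phi> e r \<longleftrightarrow> f_sat P (check P N) (check P B) \<phi> e' r"
    if app: "\<And>i. i \<in> fv \<phi> \<Longrightarrow> f_app P (check P f) (e i) (e' i) q" and r: "le P r q" for \<phi> e e' q r
  proof -
    have 1: "\<exists>t. le P t s \<and> (f_sat P (check P M) (check P A) \<phi> e t \<longleftrightarrow> f_sat P (check P N) (check P B) \<phi> e' t)"
      if s: "le P s r" for s
    proof -
      have "f_app P (check P f) (e i) (e' i) s" if "i \<in> fv \<phi>" for i
        using reg_mono[OF reg_f_app app[OF that] le_trans[OF s r]] .
      then obtain t m where t: "le P t s" and m: "\<forall>i\<in>fv \<phi>. m i \<in> elts M \<and>
          f_eq P (e i) (check P (m i)) t \<and> f_eq P (e' i) (check P (\<sigma> (m i))) t"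
        using dec[OF finite_fv le_conds(1)[OF s]] by blast
      note tc = le_conds(1)[OF t]
      have "f_sat P (check P M) (check P A) \<phi> e t \<longleftrightarrow>
          f_sat P (check P M) (check P A) \<phi> (\<lambda>i. check P (m i)) t"
        by (rule f_sat_eq_cong) (use m in blast)
      also have "\<dots> \<longleftrightarrow> sat (elts M) (elts A) \<phi> m" by (rule f_sat_check_iff[OF tc])
      also have "\<dots> \<longleftrightarrow> sat (elts N) (elts B) \<phi> (\<sigma> \<circ> m)" by (rule elem_embD[OF \<sigma>]) (use m in blast)
      also have "\<dots> \<longleftrightarrow> f_sat P (check P N) (check P B) \<phi> (\<lambda>i. check P ((\<sigma> \<circ> m) i)) t"
        by (rule f_sat_check_iff[OF tc, symmetric])
      also have "\<dots> \<longleftrightarrow> f_sat P (check P N) (check P B) \<phi> e' t"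
        by (rule f_sat_eq_cong) (use m f_eq_sym in auto)
      finally show ?thesis using t by blast
    qed
    show ?thesis
      using reg_local[OF reg_f_sat] reg_mono[OF reg_f_sat] 1 by metis
  qed
  then have "f_iff P (f_sat P (check P M) (check P A) \<phi> e) (f_sat P (check P N) (check P B) \<phi> e') q"
    if "\<And>i. i \<in> fv \<phi> \<Longrightarrow> f_app P (check P f) (e i) (e' i) q" for \<phi> e e' q
    using that by (intro f_iffI) blast
  then show ?thesis
    unfolding f_elem_emb_def using f_funI_check[OF f elem_emb_in[OF \<sigma>]]
    by (auto simp: f_and_def f_INF_def f_imp_def)
qed

text \<open>Supplies the density hypothesis when \<open>chain_conds_distributive\<close> is used to
  decide all values of a named embedding.\<close>

lemma f_elem_emb_value_dense:
  assumes emb: "f_elem_emb P f (check P M) A (check P N) B p" and m: "m \<in> elts M" and q: "le P q p"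
  shows "\<exists>s n. le P s q \<and> n \<in> elts N \<and> f_app P f (check P m) (check P n) s"
proof -
  have fn: "f_fun P f (check P M) (check P N) p" using emb unfolding f_elem_emb_def f_and_def by blast
  have "f_mem P (check P m) (check P M) q" by (rule f_mem_checkI[OF m f_eq_refl])
  then have "f_ex P (\<lambda>y. f_app P f (check P m) y) q"
    using fn q unfolding f_fun_def f_and_def f_all_def f_imp_def by blast
  then obtain y r where y: "le P r q" "f_app P f (check P m) y r"
    using f_exD[OF _ le_refl_left[OF q]] by blast
  obtain s z where s: "le P s r" "f_pair P z (check P m) y s" "f_mem P z f s"
    by (rule f_appD[OF y(2) le_refl_left[OF y(1)]])
  have sp: "le P s p" using le_trans s(1) y(1) q by blast
  \<comment> \<open>Totality gives a name \<open>y\<close> for the value without placing it in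
    \<open>N\<close>; the clause on elements of \<open>f\<close> gives a value \<open>y'\<close> in
    \<open>N\<close>. Both are second coordinates of the same pair \<open>z\<close>, hence
    equal.\<close>
  have "f_ex P (\<lambda>x. f_ex P (\<lambda>y. f_and (f_pair P z x y)
        (f_and (f_mem P x (check P M)) (f_mem P y (check P N))))) s"
    using fn sp s(3) unfolding f_fun_def f_and_def f_all_def f_imp_def by blast
  then obtain t x where t: "le P t s" "f_ex P (\<lambda>y. f_and (f_pair P z x y)
        (f_and (f_mem P x (check P M)) (f_mem P y (check P N)))) t"
    using f_exD[OF _ le_refl_left[OF s(1)]] by blast
  then obtain u y' where u: "le P u t" "f_pair P z x y' u" "f_mem P y' (check P N) u"
    using f_exD[OF _ le_refl_left[OF t(1)]] unfolding f_and_def by blast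
  have us: "le P u s" using le_trans[OF u(1) t(1)] .
  have yy: "f_eq P y y' u" using f_pair_inject(2)[OF reg_mono[OF reg_f_pair s(2) us] u(2)] .
  obtain v n where v: "le P v u" "n \<in> elts N" "f_eq P y' (check P n) v"
    by (rule f_mem_checkD[OF u(3) le_refl_left[OF u(1)]])
  have vr: "le P v r" using le_trans[OF v(1) le_trans[OF us s(1)]] .
  have "f_eq P y (check P n) v" using f_eq_trans[OF f_eq_mono[OF yy v(1)] v(3)] .
  then have "f_app P f (check P m) (check P n) v"
    using f_app_cong[OF f_eq_refl _ reg_mono[OF reg_f_app y(2) vr]] by blast
  then show ?thesis using v(2) le_trans[OF vr y(1)] by blast
qed

text \<open>Once \<open>q\<close> decides every value, the forced equivalence can be applied to
  canonical assignments, and absoluteness on both sides turns it into elementarity of a ground model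
  function.\<close>

lemma f_elem_emb_decided:
  assumes emb: "f_elem_emb P f (check P M) (check P A) (check P N) (check P B) p" and q: "le P q p"
    and \<sigma>: "\<And>m. m \<in> elts M \<Longrightarrow> \<sigma> m \<in> elts N \<and> f_app P f (check P m) (check P (\<sigma> m)) q"
  shows "elem_emb \<sigma> (elts M) (elts A) (elts N) (elts B)"
  unfolding elem_emb_def
proof (intro conjI allI impI)
  show "\<sigma> ` elts M \<subseteq> elts N" using \<sigma> by blast
next
  fix \<phi> e assume e: "e ` fv \<phi> \<subseteq> elts M"
  note qc = le_conds(1)[OF q]
  have "f_mem P (check P (e i)) (check P M) q \<and> f_app P f (check P (e i)) (check P ((\<sigma> \<circ> e) i)) q"
    if "i \<in> fv \<phi>" for i using \<sigma> e that qc by (auto simp: f_mem_check_check_iff)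
  moreover
  have "f_iff P (f_sat P (check P M) (check P A) \<phi> d) (f_sat P (check P N) (check P B) \<phi> d') q"
    if "\<forall>i\<in>fv \<phi>. f_mem P (d i) (check P M) q \<and> f_app P f (d i) (d' i) q" for d d'
    using emb q that unfolding f_elem_emb_def f_and_def f_INF_def f_imp_def by blast
  from this[of "\<lambda>i. check P (e i)" "\<lambda>i. check P ((\<sigma> \<circ> e) i)"] calculation
  have "f_iff P (f_sat P (check P M) (check P A) \<phi> (\<lambda>i. check P (e i)))
      (f_sat P (check P N) (check P B) \<phi> (\<lambda>i. check P ((\<sigma> \<circ> e) i))) q"
    by blast
  then show "sat (elts M) (elts A) \<phi> e \<longleftrightarrow> sat (elts N) (elts B) \<phi> (\<sigma> \<circ> e)"
    using f_iffD[OF _ le_refl[OF qc]] f_sat_check_iff[OF qc] by blast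
qed

lemma f_elem_emb_value_unique:
  assumes emb: "f_elem_emb P f M A N B p" and q: "le P q p"
    and ab: "f_app P f x (check P a) p" "f_app P f x (check P b) q"
  shows "a = b"
proof -
  have "f_fun P f M N p" using emb unfolding f_elem_emb_def f_and_def by blast
  then have "f_eq P (check P a) (check P b) q"
    using q ab(2) reg_mono[OF reg_f_app ab(1) q]
    unfolding f_fun_def f_and_def f_all_def f_imp_def by blast
  then show ?thesis using f_eq_check_iff le_conds(1)[OF q] by blast
qed

subsection \<open>The name of the generic filter\<close>

lemma f_mem_gen_nameI: "le P p t \<Longrightarrow> f_mem P (check P t) (gen_name P) p"
  by (rule f_memI[OF _ _ f_eq_refl]) (use le_conds in \<open>auto simp: elts_gen_name\<close>)

text \<open>Forcing \<open>t\<close> into the generic filter yields compatibility with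
  \<open>t\<close> below every stronger condition. Turning this into \<open>p\<close> lying below
  \<open>t\<close> takes separativity, see \<open>chain_separative\<close>.\<close>

lemma f_mem_gen_nameD:
  assumes "f_mem P (check P t) (gen_name P) p" "le P q p"
  shows "\<exists>s. le P s q \<and> le P s t"
proof -
  obtain s d r where s: "le P s q" "vpair d r \<in> elts (gen_name P)" "le P s r" "f_eq P (check P t) d s"
    by (rule f_memD[OF assms])
  then have "t = r" using f_eq_check_iff[OF le_conds(1)[OF s(1)]] by (auto simp: elts_gen_name)
  then show ?thesis using s by blast
qed

end

section \<open>Continuous chains through a stationary set\<close>

locale stationary_chains =
  fixes \<kappa> S :: "'v::zfc"
  assumes regular: "regular_cardinal \<kappa>" and uncountable_\<kappa>: "uncountable (elts \<kappa>)"
    and stationary: "stationary (H \<kappa>) S"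
begin

section \<open>Members of the stationary set and closure properties of
  \<open>H \<kappa>\<close>\<close>

lemma S_subset_H: "x \<in> elts S \<Longrightarrow> y \<in> elts x \<Longrightarrow> y \<in> H \<kappa>"
  and S_countable: "x \<in> elts S \<Longrightarrow> countable (elts x)"
  using stationary by (auto simp: stationary_def ctbl_subsets_def)

lemma countable_in_H: "countable (elts x) \<Longrightarrow> elts x \<subseteq> H \<kappa> \<Longrightarrow> x \<in> H \<kappa>"
  by (rule countable_subset_in_H[OF regular uncountable_\<kappa>])

lemma S_in_H: "x \<in> elts S \<Longrightarrow> x \<in> H \<kappa>"
  using countable_in_H S_countable S_subset_H by blast

lemma pair_in_H: "x \<in> H \<kappa> \<Longrightarrow> y \<in> H \<kappa> \<Longrightarrow> vset {x, y} \<in> H \<kappa>"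
  by (rule countable_in_H) simp_all

lemma vpair_in_H: "x \<in> H \<kappa> \<Longrightarrow> y \<in> H \<kappa> \<Longrightarrow> vpair x y \<in> H \<kappa>"
  unfolding vpair_def by (intro pair_in_H)

lemma countable_Ord_in_H: "Ord i \<Longrightarrow> countable (elts i) \<Longrightarrow> i \<in> H \<kappa>"
proof (induction i rule: wf_induct_rule[OF wf_mem_rel])
  case (1 i)
  have "j \<in> H \<kappa>" if j: "j \<in> elts i" for j
  proof (rule "1.IH")
    have "elts j \<subseteq> elts i" using "1.prems"(1) j by (auto simp: Ord_def vtransitive_def)
    then show "countable (elts j)" using "1.prems"(2) countable_subset by blast
  qed (use j "1.prems" Ord_mem in \<open>auto simp: mem_rel_iff\<close>)
  then show ?case using countable_in_H "1.prems"(2) by blast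
qed

text \<open>The countable sets that include \<open>A\<close> and are closed under \<open>f\<close>
  form a club. Values of \<open>f\<close> are countable sets rather than single elements, so that
  one function can record countably many outcomes at once.\<close>

lemma stationary_closed:
  assumes f: "\<And>x y. x \<in> H \<kappa> \<Longrightarrow> y \<in> H \<kappa> \<Longrightarrow> countable (f x y) \<and> f x y \<subseteq> H \<kappa>"
    and A: "countable A" "A \<subseteq> H \<kappa>"
  obtains s where "s \<in> elts S" "A \<subseteq> elts s" "\<And>x y. x \<in> elts s \<Longrightarrow> y \<in> elts s \<Longrightarrow> f x y \<subseteq> elts s"
proof -
  define C where "C = {s \<in> ctbl_subsets (H \<kappa>). A \<subseteq> elts s \<and> (\<forall>x\<in>elts s. \<forall>y\<in>elts s. f x y \<subseteq> elts s)}"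
  have "club (H \<kappa>) C" unfolding club_def
  proof (intro conjI ballI allI impI)
    show "C \<subseteq> ctbl_subsets (H \<kappa>)" by (auto simp: C_def)
  next
    fix x assume x: "x \<in> ctbl_subsets (H \<kappa>)"
    \<comment> \<open>Closure is reached after \<omega> rounds, since any two elements of the union
      already appear in a common round.\<close>
    define B where "B = rec_nat (elts x \<union> A) (\<lambda>_ X. X \<union> (\<Union>y\<in>X. \<Union>z\<in>X. f y z))"
    have B0: "B 0 = elts x \<union> A" and BS: "B (Suc n) = B n \<union> (\<Union>y\<in>B n. \<Union>z\<in>B n. f y z)" for n
      by (simp_all add: B_def)
    have B: "countable (B n) \<and> B n \<subseteq> H \<kappa>" for n
    proof (induction n)
      case 0
      then show ?case using x A by (auto simp: B0 ctbl_subsets_def)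
    next
      case (Suc n)
      then show ?case unfolding BS using f by (intro conjI countable_Un countable_UN) blast+
    qed
    have mono: "B m \<subseteq> B n" if "m \<le> n" for m n
      by (rule lift_Suc_mono_le[OF _ that]) (auto simp: BS)
    let ?U = "\<Union>n. B n"
    have cU: "countable ?U" using B by auto
    then have U: "elts (vset ?U) = ?U" by (intro elts_vset_small small_countable)
    have "f y z \<subseteq> ?U" if yz: "y \<in> ?U" "z \<in> ?U" for y z
    proof -
      obtain m n where "y \<in> B m" "z \<in> B n" using yz by blast
      then have "y \<in> B (max m n)" "z \<in> B (max m n)"
        using mono[OF max.cobounded1] mono[OF max.cobounded2] by blast+
      then have "f y z \<subseteq> B (Suc (max m n))" unfolding BS by blast
      then show ?thesis by blast
    qed
    then have "vset ?U \<in> C"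
      unfolding C_def ctbl_subsets_def using cU B B0 by (auto simp only: U mem_Collect_eq) blast+
    then show "\<exists>y\<in>C. elts x \<subseteq> elts y" using B0 by (intro bexI[of _ "vset ?U"]) (auto simp: U)
  next
    fix g :: "nat \<Rightarrow> 'v" assume g: "\<forall>n. g n \<in> C \<and> elts (g n) \<subseteq> elts (g (Suc n))"
    have mono: "elts (g m) \<subseteq> elts (g n)" if "m \<le> n" for m n
      by (rule lift_Suc_mono_le[OF _ that]) (use g in auto)
    let ?U = "\<Union>n. elts (g n)"
    have gC: "elts (g n) \<subseteq> H \<kappa>" "countable (elts (g n))" "A \<subseteq> elts (g n)"
      "x \<in> elts (g n) \<Longrightarrow> y \<in> elts (g n) \<Longrightarrow> f x y \<subseteq> elts (g n)" for n x y
      using g by (auto simp: C_def ctbl_subsets_def)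
    have cU: "countable ?U" using gC(2) by auto
    then have U: "elts (vset ?U) = ?U" by (intro elts_vset_small small_countable)
    have "f y z \<subseteq> ?U" if yz: "y \<in> ?U" "z \<in> ?U" for y z
    proof -
      obtain m n where "y \<in> elts (g m)" "z \<in> elts (g n)" using yz by blast
      then have "y \<in> elts (g (max m n))" "z \<in> elts (g (max m n))"
        using mono[OF max.cobounded1] mono[OF max.cobounded2] by blast+
      then show ?thesis using gC(4) by blast
    qed
    moreover have "A \<subseteq> ?U" "?U \<subseteq> H \<kappa>" using gC by blast+
    ultimately have "vset ?U \<in> C" unfolding C_def ctbl_subsets_def using cU U by simp
    then show "\<exists>y\<in>C. elts y = ?U" using U by blast
  qed
  then obtain s where "s \<in> elts S" "s \<in> C" using stationary unfolding stationary_def by blast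
  then show thesis using that unfolding C_def by blast
qed

lemma S_covers: "countable A \<Longrightarrow> A \<subseteq> H \<kappa> \<Longrightarrow> \<exists>s\<in>elts S. A \<subseteq> elts s"
  by (rule stationary_closed[of "\<lambda>_ _. {}" A]) auto

section \<open>The structure of a single condition\<close>

lemma chain_condsD:
  assumes "p \<in> chain_conds S"
  obtains l X where "Ord l" "countable (elts l)" "\<And>i. i \<in> elts l \<or> i = l \<Longrightarrow> X i \<in> elts S"
    "\<And>i j. j \<in> elts l \<or> j = l \<Longrightarrow> i \<in> elts j \<Longrightarrow> X i \<in> elts (X j)"
    "\<And>j. j \<in> elts l \<or> j = l \<Longrightarrow> Limit j \<Longrightarrow> elts (X j) = (\<Union>i\<in>elts j. elts (X i))"
    "\<And>i x. vpair i x \<in> elts p \<longleftrightarrow> (i \<in> elts l \<or> i = l) \<and> x = X i"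
    "\<And>z. z \<in> elts p \<Longrightarrow> \<exists>i x. z = vpair i x"
proof -
  obtain l X where l: "Ord l" "countable (elts l)" "\<forall>i\<in>insert l (elts l). X i \<in> elts S"
    "\<forall>j\<in>insert l (elts l). \<forall>i\<in>elts j. X i \<in> elts (X j)"
    "\<forall>j\<in>insert l (elts l). Limit j \<longrightarrow> elts (X j) = (\<Union>i\<in>elts j. elts (X i))"
    "elts p = {vpair i (X i) | i. i \<in> insert l (elts l)}"
    using assms unfolding chain_conds_def by blast
  show thesis by (rule that[of l X]) (use l in auto)
qed

lemma chain_conds_pair:
  assumes "p \<in> chain_conds S" "z \<in> elts p"
  obtains i x where "z = vpair i x" "vpair i x \<in> elts p" "Ord i" "countable (elts i)" "x \<in> elts S"
proof -
  obtain l X where l: "Ord l" "countable (elts l)" "\<And>i. i \<in> elts l \<or> i = l \<Longrightarrow> X i \<in> elts S"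
    "\<And>i x. vpair i x \<in> elts p \<longleftrightarrow> (i \<in> elts l \<or> i = l) \<and> x = X i" "\<And>z. z \<in> elts p \<Longrightarrow> \<exists>i x. z = vpair i x"
    by (rule chain_condsD[OF assms(1)]) blast
  obtain i x where z: "z = vpair i x" using l(5) assms(2) by blast
  then have i: "i \<in> elts l \<or> i = l" "x = X i" using l(4) assms(2) by blast+
  then have "elts i \<subseteq> elts l" using l(1) by (auto simp: Ord_def vtransitive_def)
  then have "countable (elts i)" using l(2) by (rule countable_subset)
  moreover have "Ord i" using l(1) i(1) Ord_mem by blast
  moreover have "x \<in> elts S" using l(3)[OF i(1)] i(2) by simp
  ultimately
  show thesis using that[OF z] z assms(2) by blast
qed

lemma chain_conds_fst: "p \<in> chain_conds S \<Longrightarrow> vpair i x \<in> elts p \<Longrightarrow> Ord i"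
  and chain_conds_snd: "p \<in> chain_conds S \<Longrightarrow> vpair i x \<in> elts p \<Longrightarrow> x \<in> elts S"
  by (erule chain_conds_pair, assumption, simp)+

lemma chain_conds_functional:
  "p \<in> chain_conds S \<Longrightarrow> vpair i x \<in> elts p \<Longrightarrow> vpair i y \<in> elts p \<Longrightarrow> x = y"
  by (erule chain_condsD) simp

lemma chain_conds_mem:
  "p \<in> chain_conds S \<Longrightarrow> vpair i x \<in> elts p \<Longrightarrow> vpair j y \<in> elts p \<Longrightarrow> i \<in> elts j \<Longrightarrow> x \<in> elts y"
  by (erule chain_condsD) simp

lemma chain_conds_dom:
  "p \<in> chain_conds S \<Longrightarrow> \<exists>l. Ord l \<and> (\<forall>i. (\<exists>x. vpair i x \<in> elts p) \<longleftrightarrow> i \<in> elts l \<or> i = l)"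
  by (erule chain_condsD) auto

lemma chain_conds_dom_trans:
  assumes "p \<in> chain_conds S" "vpair j y \<in> elts p" "i \<in> elts j"
  shows "\<exists>x. vpair i x \<in> elts p"
  using chain_conds_dom[OF assms(1)] assms(2,3) Ord_trans by blast

lemma chain_conds_limit:
  assumes "p \<in> chain_conds S" "vpair j y \<in> elts p" "Limit j"
  shows "z \<in> elts y \<longleftrightarrow> (\<exists>i x. vpair i x \<in> elts p \<and> i \<in> elts j \<and> z \<in> elts x)"
proof -
  obtain l X where l: "Ord l"
    "\<And>j. j \<in> elts l \<or> j = l \<Longrightarrow> Limit j \<Longrightarrow> elts (X j) = (\<Union>i\<in>elts j. elts (X i))"
    "\<And>i x. vpair i x \<in> elts p \<longleftrightarrow> (i \<in> elts l \<or> i = l) \<and> x = X i"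
    by (rule chain_condsD[OF assms(1)]) blast
  have j: "j \<in> elts l \<or> j = l" "y = X j" using l(3) assms(2) by blast+
  then have "i \<in> elts l" if "i \<in> elts j" for i using that Ord_trans[OF l(1)] by blast
  then show ?thesis using l(2)[OF j(1) assms(3)] l(3) j(2) by auto
qed

text \<open>
  Countability of the length needs no separate clause: a chain of length \<open>l + 1\<close> embeds \<open>l\<close>
  into its last member.
\<close>
lemma chain_conds_iff:
  "p \<in> chain_conds S \<longleftrightarrow>
    (\<forall>z\<in>elts p. \<exists>i x. z = vpair i x \<and> x \<in> elts S) \<and>
    (\<exists>l. Ord l \<and> (\<forall>i. (\<exists>x. vpair i x \<in> elts p) \<longleftrightarrow> i \<in> elts l \<or> i = l)) \<and>
    (\<forall>i x y. vpair i x \<in> elts p \<and> vpair i y \<in> elts p \<longrightarrow> x = y) \<and>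
    (\<forall>i x j y. vpair i x \<in> elts p \<and> vpair j y \<in> elts p \<and> i \<in> elts j \<longrightarrow> x \<in> elts y) \<and>
    (\<forall>j y. vpair j y \<in> elts p \<and> Limit j \<longrightarrow>
      (\<forall>z. z \<in> elts y \<longleftrightarrow> (\<exists>i x. vpair i x \<in> elts p \<and> i \<in> elts j \<and> z \<in> elts x)))"
  (is "_ \<longleftrightarrow> ?pair \<and> ?dom \<and> ?fun \<and> ?mem \<and> ?lim")
proof
  assume p: "p \<in> chain_conds S"
  have "\<exists>i x. z = vpair i x \<and> x \<in> elts S" if "z \<in> elts p" for z
    using chain_conds_pair[OF p that] by blast
  then show "?pair \<and> ?dom \<and> ?fun \<and> ?mem \<and> ?lim"
    using chain_conds_dom[OF p] chain_conds_functional[OF p] chain_conds_mem[OF p] chain_conds_limit[OF p]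
    by (intro conjI ballI allI impI) blast+
next
  assume r: "?pair \<and> ?dom \<and> ?fun \<and> ?mem \<and> ?lim"
  then have ?pair ?dom ?fun ?mem ?lim by blast+
  from \<open>?dom\<close> obtain l where l: "Ord l" "\<And>i. (\<exists>x. vpair i x \<in> elts p) \<longleftrightarrow> i \<in> elts l \<or> i = l" by blast
  define X where "X i = (THE x. vpair i x \<in> elts p)" for i
  have X: "vpair i x \<in> elts p \<longleftrightarrow> (i \<in> elts l \<or> i = l) \<and> x = X i" for i x
  proof
    assume "vpair i x \<in> elts p"
    moreover then have "X i = x" unfolding X_def using \<open>?fun\<close> by (intro the_equality) blast+
    ultimately show "(i \<in> elts l \<or> i = l) \<and> x = X i" using l(2) by blast
  next
    assume a: "(i \<in> elts l \<or> i = l) \<and> x = X i"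
    then obtain y where y: "vpair i y \<in> elts p" using l(2) by blast
    then have "X i = y" unfolding X_def using \<open>?fun\<close> by (intro the_equality) blast+
    then show "vpair i x \<in> elts p" using a y by simp
  qed
  have sub: "i \<in> elts l \<or> i = l" if "j \<in> elts l \<or> j = l" "i \<in> elts j" for i j
    using that Ord_trans[OF l(1)] by blast
  have XS: "X i \<in> elts S" if "i \<in> elts l \<or> i = l" for i
    using that X[of i "X i"] \<open>?pair\<close> vpair_inject by metis
  have Xmem: "X i \<in> elts (X j)" if "j \<in> elts l \<or> j = l" "i \<in> elts j" for i j
  proof -
    have "vpair i (X i) \<in> elts p" "vpair j (X j) \<in> elts p" using X that(1) sub[OF that] by blast+
    then show ?thesis using \<open>?mem\<close> that(2) by blast
  qed
  have "inj_on X (elts l)"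
  proof (rule inj_onI)
    fix i j assume ij: "i \<in> elts l" "j \<in> elts l" "X i = X j"
    have "i \<notin> elts j" "j \<notin> elts i" using Xmem ij mem_irrefl[of "X j"] by metis+
    then show "i = j" using Ord_linear[OF Ord_mem[OF l(1) ij(1)] Ord_mem[OF l(1) ij(2)]] by blast
  qed
  moreover have "X ` elts l \<subseteq> elts (X l)" using Xmem by blast
  ultimately have "countable (elts l)"
    using S_countable[OF XS] by (metis countable_image_inj_on countable_subset)
  moreover have "elts (X j) = (\<Union>i\<in>elts j. elts (X i))" if "j \<in> elts l \<or> j = l" "Limit j" for j
  proof -
    have "z \<in> elts (X j) \<longleftrightarrow> (\<exists>i x. vpair i x \<in> elts p \<and> i \<in> elts j \<and> z \<in> elts x)" for z
      using \<open>?lim\<close> X[of j "X j"] that by blast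
    also have "(\<exists>i x. vpair i x \<in> elts p \<and> i \<in> elts j \<and> z \<in> elts x) \<longleftrightarrow> (\<exists>i\<in>elts j. z \<in> elts (X i))" for z
      unfolding X using sub[OF that(1)] by metis
    finally show ?thesis by blast
  qed
  moreover have "elts p = {vpair i (X i) | i. i \<in> insert l (elts l)}"
  proof (intro set_eqI iffI)
    fix z assume z: "z \<in> elts p"
    then obtain i x where "z = vpair i x" using \<open>?pair\<close> by blast
    moreover then have "x = X i" "i \<in> insert l (elts l)" using X[of i x] z by blast+
    ultimately show "z \<in> {vpair i (X i) | i. i \<in> insert l (elts l)}" by blast
  next
    fix z assume "z \<in> {vpair i (X i) | i. i \<in> insert l (elts l)}"
    then show "z \<in> elts p" using X by blast
  qed
  ultimately show "p \<in> chain_conds S"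
    unfolding chain_conds_def using l(1) XS Xmem
    by (intro CollectI exI[of _ l] exI[of _ X]) simp
qed

lemma chain_conds_countable: "p \<in> chain_conds S \<Longrightarrow> countable (elts p)"
proof -
  assume "p \<in> chain_conds S"
  then obtain l and X :: "'v \<Rightarrow> 'v" where l: "countable (elts l)"
    and p: "elts p = {vpair i (X i) | i. i \<in> insert l (elts l)}"
    unfolding chain_conds_def by blast
  have "elts p = (\<lambda>i. vpair i (X i)) ` insert l (elts l)" unfolding p by blast
  then show ?thesis using l by simp
qed

section \<open>Members of a chain and one-step extensions\<close>

definition members :: "'v \<Rightarrow> 'v set"
  where "members p = {x. \<exists>i. vpair i x \<in> elts p}"

lemma countable_members: "p \<in> chain_conds S \<Longrightarrow> countable (members p)"
proof -
  assume p: "p \<in> chain_conds S"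
  have "members p \<subseteq> vsnd ` elts p" unfolding members_def by (force simp: image_iff)
  then show ?thesis by (rule countable_subset) (rule countable_image[OF chain_conds_countable[OF p]])
qed

lemma members_S: "p \<in> chain_conds S \<Longrightarrow> x \<in> members p \<Longrightarrow> x \<in> elts S"
  unfolding members_def using chain_conds_snd by blast

lemma chain_conds_in_H: "p \<in> chain_conds S \<Longrightarrow> p \<in> H \<kappa>"
proof (rule countable_in_H[OF chain_conds_countable])
  assume p: "p \<in> chain_conds S"
  show "elts p \<subseteq> H \<kappa>"
    using chain_conds_pair[OF p] vpair_in_H countable_Ord_in_H S_in_H by (metis subsetI)
qed

text \<open>The new member receives a successor index, where continuity asks for nothing; all that
  is required of \<open>Z\<close> is to contain the earlier members as elements.\<close>

lemma chain_extend:
  assumes p: "p \<in> chain_conds S" and l: "Ord l" "\<And>i. (\<exists>x. vpair i x \<in> elts p) \<longleftrightarrow> i \<in> elts l \<or> i = l"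
    and Z: "Z \<in> elts S" "\<And>i x. vpair i x \<in> elts p \<Longrightarrow> x \<in> elts Z"
  obtains q where "q \<in> chain_conds S" "elts q = insert (vpair (vsucc l) Z) (elts p)"
proof -
  let ?q = "vset (insert (vpair (vsucc l) Z) (elts p))"
  have q: "elts ?q = insert (vpair (vsucc l) Z) (elts p)"
    by (intro elts_vset_small small_insert small_elts)
  have new: "vpair (vsucc l) x \<notin> elts p" for x
    using l(2)[of "vsucc l"] mem_irrefl[of "vsucc l"] mem_asym[of l "vsucc l"] elts_vsucc[of l] by auto
  have old: "vsucc l \<notin> elts j" if "vpair j x \<in> elts p" for j x
    using that l(2)[of j] mem_asym[of "vsucc l" j] mem_irrefl[of l] mem_asym[of l "vsucc l"] elts_vsucc[of l] by auto
  have "?q \<in> chain_conds S"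
    unfolding chain_conds_iff q
  proof (intro conjI)
    show "\<forall>z\<in>insert (vpair (vsucc l) Z) (elts p). \<exists>i x. z = vpair i x \<and> x \<in> elts S"
      using p Z(1) unfolding chain_conds_iff[of p] by blast
    show "\<exists>k. Ord k \<and> (\<forall>i. (\<exists>x. vpair i x \<in> insert (vpair (vsucc l) Z) (elts p)) \<longleftrightarrow> i \<in> elts k \<or> i = k)"
      using Ord_vsucc[OF l(1)] l(2) by (intro exI[of _ "vsucc l"]) auto
    show "\<forall>i x y. vpair i x \<in> insert (vpair (vsucc l) Z) (elts p) \<and>
        vpair i y \<in> insert (vpair (vsucc l) Z) (elts p) \<longrightarrow> x = y"
      using new chain_conds_functional[OF p] by auto
    show "\<forall>i x j y. vpair i x \<in> insert (vpair (vsucc l) Z) (elts p) \<and>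
        vpair j y \<in> insert (vpair (vsucc l) Z) (elts p) \<and> i \<in> elts j \<longrightarrow> x \<in> elts y"
      using old chain_conds_mem[OF p] Z(2) mem_irrefl[of "vsucc l"] by auto
    show "\<forall>j y. vpair j y \<in> insert (vpair (vsucc l) Z) (elts p) \<and> Limit j \<longrightarrow>
        (\<forall>z. (z \<in> elts y) = (\<exists>i x. vpair i x \<in> insert (vpair (vsucc l) Z) (elts p) \<and> i \<in> elts j \<and> z \<in> elts x))"
    proof (intro allI impI)
      fix j y z assume "vpair j y \<in> insert (vpair (vsucc l) Z) (elts p) \<and> Limit j"
      then have j: "vpair j y \<in> elts p" "Limit j" using not_Limit_vsucc by auto
      show "(z \<in> elts y) = (\<exists>i x. vpair i x \<in> insert (vpair (vsucc l) Z) (elts p) \<and> i \<in> elts j \<and> z \<in> elts x)"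
        using chain_conds_limit[OF p j] old[OF j(1)] by auto
    qed
  qed
  then show thesis using q by (rule that)
qed

text \<open>A legal new last member has to contain the members of \<open>p\<close>. Together with
  \<open>A\<close> these are countably many elements of \<open>H \<kappa>\<close>, so
  \<open>S\<close> has a member covering them.\<close>

lemma chain_extend_containing:
  assumes p: "p \<in> chain_conds S" and A: "countable A" "A \<subseteq> H \<kappa>"
  obtains q j Z where "q \<in> chain_conds S" "elts p \<subseteq> elts q" "vpair j Z \<in> elts q" "A \<subseteq> elts Z"
    "\<And>i x. vpair i x \<in> elts p \<Longrightarrow> x \<in> elts Z"
proof -
  have "countable (A \<union> members p)" using A(1) countable_members[OF p] by blast
  moreover have "A \<union> members p \<subseteq> H \<kappa>" using A(2) S_in_H members_S[OF p] by blast
  ultimately obtain Z where Z: "Z \<in> elts S" "A \<union> members p \<subseteq> elts Z"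
    using S_covers by blast
  obtain l where l: "Ord l" "\<And>i. (\<exists>x. vpair i x \<in> elts p) \<longleftrightarrow> i \<in> elts l \<or> i = l"
    using chain_conds_dom[OF p] by blast
  obtain q where q: "q \<in> chain_conds S" "elts q = insert (vpair (vsucc l) Z) (elts p)"
    by (rule chain_extend[OF p l Z(1)]) (use Z(2) in \<open>auto simp: members_def\<close>)
  then show thesis using that[of q "vsucc l" Z] Z(2) unfolding members_def by blast
qed

text \<open>The last clause rules out a longest chain, so the domains unite to a limit ordinal. It
  also says that each member is an element of the union of all members, which is what
  \<open>\<in>\<close>-increase demands of a set placed on top.\<close>

definition directed :: "'v set \<Rightarrow> bool"
  where "directed C \<longleftrightarrow> C \<subseteq> chain_conds S \<and> C \<noteq> {} \<and>
    (\<forall>p\<in>C. \<forall>q\<in>C. \<exists>r\<in>C. elts p \<subseteq> elts r \<and> elts q \<subseteq> elts r) \<and>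
    (\<forall>p\<in>C. \<forall>i x. vpair i x \<in> elts p \<longrightarrow> (\<exists>q\<in>C. \<exists>j y. vpair j y \<in> elts q \<and> x \<in> elts y))"

lemma directedD:
  assumes "directed C" "p \<in> C" "q \<in> C"
  obtains r where "r \<in> C" "r \<in> chain_conds S" "elts p \<subseteq> elts r" "elts q \<subseteq> elts r"
  using assms unfolding directed_def by blast

lemma directed_Limit:
  assumes C: "directed C"
  obtains \<delta> where "Limit \<delta>" "\<And>i. i \<in> elts \<delta> \<longleftrightarrow> (\<exists>p\<in>C. \<exists>x. vpair i x \<in> elts p)"
proof -
  let ?D = "{i. \<exists>p\<in>C. \<exists>x. vpair i x \<in> elts p}"
  have CS: "p \<in> chain_conds S" if "p \<in> C" for p using C that unfolding directed_def by blast
  have "?D \<subseteq> {\<alpha>. Ord \<alpha> \<and> countable (elts \<alpha>)}"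
    using chain_conds_pair[OF CS] by (smt (verit, ccfv_SIG) mem_Collect_eq subsetI vpair_inject)
  then have D: "elts (vset ?D) = ?D"
    by (intro elts_vset_small small_subset[OF small_countable_ordinals])
  have ord: "Ord i" if "i \<in> ?D" for i using that chain_conds_fst[OF CS] by blast
  have tr: "j \<in> ?D" if "i \<in> ?D" "j \<in> elts i" for i j
    using that chain_conds_dom_trans[OF CS] by blast
  have "Ord (vset ?D)"
    unfolding Ord_def D
  proof (intro conjI ballI)
    show "vtransitive (vset ?D)" unfolding vtransitive_def D using tr by blast
  qed (use ord in \<open>simp add: Ord_def\<close>)
  moreover have "?D \<noteq> {}"
  proof -
    obtain p where p: "p \<in> C" using C unfolding directed_def by blast
    then show ?thesis using chain_conds_dom[OF CS[OF p]] by blast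
  qed
  moreover have "\<exists>j\<in>?D. i \<in> elts j" if i: "i \<in> ?D" for i
  proof -
    obtain p x where p: "p \<in> C" "vpair i x \<in> elts p" using i by blast
    then obtain q j y where q: "q \<in> C" "vpair j y \<in> elts q" "x \<in> elts y"
      using C unfolding directed_def by blast
    obtain r where r: "r \<in> C" "r \<in> chain_conds S" "elts p \<subseteq> elts r" "elts q \<subseteq> elts r"
      by (rule directedD[OF C p(1) q(1)])
    have ij: "vpair i x \<in> elts r" "vpair j y \<in> elts r" using p q r by blast+
    \<comment> \<open>In the common extension \<open>r\<close> indices are ordered as the members
      are: \<open>j \<in> elts i\<close> would give \<open>y \<in> elts x\<close>, against
      \<open>x \<in> elts y\<close>.\<close>
    have "j \<notin> elts i" using chain_conds_mem[OF r(2) ij(2,1)] mem_asym[OF q(3)] by blast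
    moreover have "i \<noteq> j" using chain_conds_functional[OF r(2) ij(1)] ij(2) q(3) mem_irrefl[of x] by blast
    ultimately have "i \<in> elts j"
      using Ord_linear[OF chain_conds_fst[OF r(2) ij(1)] chain_conds_fst[OF r(2) ij(2)]] by blast
    then show ?thesis using q by blast
  qed
  ultimately have "Limit (vset ?D)" unfolding Limit_def D by blast
  then show thesis using that[of "vset ?D"] unfolding D by blast
qed

text \<open>The bound is the union of the chains with \<open>s\<close> added at the limit index
  \<delta>. Continuity at \<delta> requires \<open>s\<close> to be exactly the union of all members,
  and membership of that union in \<open>S\<close> is the only obstacle to a bound.\<close>

lemma directed_bound:
  assumes C: "directed C" and s: "s \<in> elts S"
    "\<And>z. z \<in> elts s \<longleftrightarrow> (\<exists>p\<in>C. \<exists>i x. vpair i x \<in> elts p \<and> z \<in> elts x)"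
  obtains q where "q \<in> chain_conds S" "\<And>p. p \<in> C \<Longrightarrow> elts p \<subseteq> elts q"
proof -
  obtain \<delta> where \<delta>: "Limit \<delta>" "\<And>i. i \<in> elts \<delta> \<longleftrightarrow> (\<exists>p\<in>C. \<exists>x. vpair i x \<in> elts p)"
    by (rule directed_Limit[OF C]) blast
  have CS: "p \<in> chain_conds S" if "p \<in> C" for p using C that unfolding directed_def by blast
  define U where "U = (\<Union>p\<in>C. elts p)"
  let ?q = "vset (insert (vpair \<delta> s) U)"
  have U: "small U"
    unfolding U_def by (intro small_UN small_elts small_subset[OF small_chain_conds[of S]]) (use CS in blast)
  then have q: "elts ?q = insert (vpair \<delta> s) U" by (intro elts_vset_small small_insert)
  have common: "\<exists>r\<in>C. u \<in> elts r \<and> v \<in> elts r" if uv: "u \<in> U" "v \<in> U" for u v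
  proof -
    obtain p q where pq: "p \<in> C" "q \<in> C" "u \<in> elts p" "v \<in> elts q" using uv unfolding U_def by blast
    obtain r where "r \<in> C" "elts p \<subseteq> elts r" "elts q \<subseteq> elts r" by (rule directedD[OF C pq(1,2)])
    then show ?thesis using pq by blast
  qed
  have \<delta>U: "i \<in> elts \<delta> \<longleftrightarrow> (\<exists>x. vpair i x \<in> U)" for i unfolding \<delta>(2) U_def by blast
  have new: "vpair \<delta> x \<notin> U" for x using \<delta>U mem_irrefl[of \<delta>] by blast
  have old: "\<delta> \<notin> elts j" if "vpair j x \<in> U" for j x using \<delta>U that mem_asym[of \<delta> j] by blast
  have "?q \<in> chain_conds S"
    unfolding chain_conds_iff q
  proof (intro conjI)
    show "\<forall>z\<in>insert (vpair \<delta> s) U. \<exists>i x. z = vpair i x \<and> x \<in> elts S"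
      using CS s(1) chain_conds_pair unfolding U_def by (metis UN_E insertE)
    show "\<exists>k. Ord k \<and> (\<forall>i. (\<exists>x. vpair i x \<in> insert (vpair \<delta> s) U) \<longleftrightarrow> i \<in> elts k \<or> i = k)"
      using \<delta>(1) \<delta>U by (intro exI[of _ \<delta>]) (auto simp: Limit_def)
    show "\<forall>i x y. vpair i x \<in> insert (vpair \<delta> s) U \<and> vpair i y \<in> insert (vpair \<delta> s) U \<longrightarrow> x = y"
    proof (intro allI impI)
      fix i x y assume "vpair i x \<in> insert (vpair \<delta> s) U \<and> vpair i y \<in> insert (vpair \<delta> s) U"
      then consider "x = s" "y = s" | "vpair i x \<in> U" "vpair i y \<in> U" using new by auto
      then show "x = y" using common CS chain_conds_functional by cases blast+
    qed
    show "\<forall>i x j y. vpair i x \<in> insert (vpair \<delta> s) U \<and> vpair j y \<in> insert (vpair \<delta> s) U \<and> i \<in> elts j \<longrightarrow> x \<in> elts y"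
    proof (intro allI impI)
      fix i x j y assume a: "vpair i x \<in> insert (vpair \<delta> s) U \<and> vpair j y \<in> insert (vpair \<delta> s) U \<and> i \<in> elts j"
      then have x: "vpair i x \<in> U" using old mem_irrefl[of \<delta>] by auto
      show "x \<in> elts y"
      proof (cases "vpair j y \<in> U")
        case True
        then show ?thesis using common[OF x] CS chain_conds_mem a by blast
      next
        case False
        then have "y = s" using a by auto
        moreover have "\<exists>q\<in>C. \<exists>j y. vpair j y \<in> elts q \<and> x \<in> elts y"
          using x C unfolding U_def directed_def by blast
        ultimately show ?thesis using s(2)[of x] by blast
      qed
    qed
    show "\<forall>j y. vpair j y \<in> insert (vpair \<delta> s) U \<and> Limit j \<longrightarrow>
        (\<forall>z. (z \<in> elts y) = (\<exists>i x. vpair i x \<in> insert (vpair \<delta> s) U \<and> i \<in> elts j \<and> z \<in> elts x))"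
    proof (intro allI impI)
      fix j y z assume a: "vpair j y \<in> insert (vpair \<delta> s) U \<and> Limit j"
      show "(z \<in> elts y) = (\<exists>i x. vpair i x \<in> insert (vpair \<delta> s) U \<and> i \<in> elts j \<and> z \<in> elts x)"
      proof (cases "vpair j y \<in> U")
        case True
        then obtain p where p: "p \<in> C" "vpair j y \<in> elts p" unfolding U_def by blast
        \<comment> \<open>Below an index of \<open>p\<close>, the union has no entries beyond those
          of \<open>p\<close>, so continuity there is inherited from \<open>p\<close> alone.\<close>
        have "vpair i x \<in> elts p \<longleftrightarrow> vpair i x \<in> insert (vpair \<delta> s) U" if i: "i \<in> elts j" for i x
        proof
          assume ix: "vpair i x \<in> insert (vpair \<delta> s) U"
          obtain x' where x': "vpair i x' \<in> elts p" using chain_conds_dom_trans[OF CS[OF p(1)] p(2) i] by blast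
          have "vpair i x \<in> U" using ix old[OF True] i by auto
          then have "x = x'"
            using common[of "vpair i x" "vpair i x'"] p(1) x' CS chain_conds_functional unfolding U_def by blast
          then show "vpair i x \<in> elts p" using x' by simp
        qed (use p(1) U_def in blast)
        then show ?thesis using chain_conds_limit[OF CS[OF p(1)] p(2)] a by blast
      next
        case False
        then have jy: "y = s" "j = \<delta>" using a by auto
        show ?thesis unfolding jy s(2) using \<delta>U mem_irrefl[of \<delta>] unfolding U_def by auto
      qed
    qed
  qed
  moreover have "elts p \<subseteq> elts ?q" if "p \<in> C" for p using that unfolding q using U_def by blast
  ultimately show thesis by (rule that)
qed

text \<open>Converse to \<open>directed_bound\<close>: a common extension has the limit \<delta> in
  its domain, and by continuity its member at \<delta> is the union of all members of the
  chains.\<close>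

lemma directed_bounded_imp:
  assumes C: "directed C" and q: "q \<in> chain_conds S" "\<And>p. p \<in> C \<Longrightarrow> elts p \<subseteq> elts q"
  obtains s where "s \<in> elts S" "\<And>z. z \<in> elts s \<longleftrightarrow> (\<exists>p\<in>C. \<exists>i x. vpair i x \<in> elts p \<and> z \<in> elts x)"
proof -
  obtain \<delta> where \<delta>: "Limit \<delta>" "\<And>i. i \<in> elts \<delta> \<longleftrightarrow> (\<exists>p\<in>C. \<exists>x. vpair i x \<in> elts p)"
    by (rule directed_Limit[OF C]) blast
  obtain l where l: "Ord l" "\<And>i. (\<exists>x. vpair i x \<in> elts q) \<longleftrightarrow> i \<in> elts l \<or> i = l"
    using chain_conds_dom[OF q(1)] by blast
  have "elts \<delta> \<subseteq> elts (vsucc l)"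
  proof
    fix i assume "i \<in> elts \<delta>"
    then obtain p x where "p \<in> C" "vpair i x \<in> elts p" using \<delta>(2) by blast
    then have "vpair i x \<in> elts q" using q(2) by blast
    then show "i \<in> elts (vsucc l)" using l(2)[of i] by auto
  qed
  \<comment> \<open>All indices of the chains are at most \<open>l\<close>, so \<delta> is at most
    \<open>vsucc l\<close>; being a limit it differs from this successor and is an index of
    \<open>q\<close>.\<close>
  moreover have "Ord \<delta>" "\<delta> \<noteq> vsucc l" using \<delta>(1) not_Limit_vsucc[of l] unfolding Limit_def by blast+
  ultimately have "\<delta> \<in> elts (vsucc l)"
    using Ord_subset_imp[OF _ Ord_vsucc[OF l(1)]] by blast
  then obtain s where s: "vpair \<delta> s \<in> elts q" using l(2) by auto
  have "z \<in> elts s \<longleftrightarrow> (\<exists>p\<in>C. \<exists>i x. vpair i x \<in> elts p \<and> z \<in> elts x)" for z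
    unfolding chain_conds_limit[OF q(1) s \<delta>(1)]
  proof
    assume "\<exists>i x. vpair i x \<in> elts q \<and> i \<in> elts \<delta> \<and> z \<in> elts x"
    then obtain i x where ix: "vpair i x \<in> elts q" "i \<in> elts \<delta>" "z \<in> elts x" by blast
    then obtain p y where p: "p \<in> C" "vpair i y \<in> elts p" using \<delta>(2) by blast
    then have "y = x" using chain_conds_functional[OF q(1) _ ix(1)] q(2) by blast
    then show "\<exists>p\<in>C. \<exists>i x. vpair i x \<in> elts p \<and> z \<in> elts x" using p ix by blast
  qed (use q(2) \<delta>(2) in blast)
  then show thesis using that chain_conds_snd[OF q(1) s] by blast
qed

text \<open>Take \<open>s\<close> in \<open>S\<close> closed under a function choosing extensions
  into the dense sets. A sequence of conditions built inside \<open>s\<close> along an enumeration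
  of \<open>s\<close> meets all \<open>D n\<close> and has \<open>s\<close> as the union of its
  members, so \<open>directed_bound\<close> gives a lower bound.\<close>

lemma chain_conds_distributive:
  assumes p: "p \<in> chain_conds S"
    and dense: "\<And>n q. q \<in> chain_conds S \<Longrightarrow> elts p \<subseteq> elts q \<Longrightarrow> \<exists>r\<in>chain_conds S. elts q \<subseteq> elts r \<and> r \<in> D n"
    and opn: "\<And>n q r. q \<in> D n \<Longrightarrow> q \<in> chain_conds S \<Longrightarrow> r \<in> chain_conds S \<Longrightarrow> elts q \<subseteq> elts r \<Longrightarrow> r \<in> D n"
  obtains q where "q \<in> chain_conds S" "elts p \<subseteq> elts q" "\<And>n :: nat. q \<in> D n"
proof -
  let ?Q = "{q \<in> chain_conds S. elts p \<subseteq> elts q}"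
  \<comment> \<open>An acceptable answer \<open>r\<close> to \<open>q\<close> does three things at
    once: it enters \<open>D n\<close>, it covers the given point \<open>x\<close>, and it has a
    member above all members of \<open>q\<close>, which later yields directedness.\<close>
  define \<Psi> where "\<Psi> n q x r \<longleftrightarrow> r \<in> ?Q \<and> elts q \<subseteq> elts r \<and> r \<in> D n \<and>
      (\<exists>j Z. vpair j Z \<in> elts r \<and> x \<in> elts Z \<and> (\<forall>i y. vpair i y \<in> elts q \<longrightarrow> y \<in> elts Z))"
    for n q x r
  define E where "E n q x = (SOME r. \<Psi> n q x r)" for n q x
  have "\<exists>r. \<Psi> n q x r"
    if q: "q \<in> ?Q" and x: "x \<in> H \<kappa>" for n q x
  proof -
    obtain q' j Z where q': "q' \<in> chain_conds S" "elts q \<subseteq> elts q'" "vpair j Z \<in> elts q'" "{x} \<subseteq> elts Z"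
      "\<And>i x. vpair i x \<in> elts q \<Longrightarrow> x \<in> elts Z"
      by (rule chain_extend_containing[of q "{x}"]) (use q x in auto)
    obtain r where "r \<in> chain_conds S" "elts q' \<subseteq> elts r" "r \<in> D n" using dense[OF q'(1)] q q'(2) by blast
    then have "\<Psi> n q x r" unfolding \<Psi>_def using q' q by blast
    then show ?thesis by blast
  qed
  then have "\<Psi> n q x (E n q x)" if "q \<in> ?Q" "x \<in> H \<kappa>" for n q x
    unfolding E_def using that by (blast intro: someI_ex)
  then have E: "\<And>n q x. q \<in> ?Q \<Longrightarrow> x \<in> H \<kappa> \<Longrightarrow> E n q x \<in> ?Q \<and> elts q \<subseteq> elts (E n q x) \<and>
      E n q x \<in> D n \<and> (\<exists>j Z. vpair j Z \<in> elts (E n q x) \<and> x \<in> elts Z \<and>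
      (\<forall>i y. vpair i y \<in> elts q \<longrightarrow> y \<in> elts Z))"
    unfolding \<Psi>_def by blast
  \<comment> \<open>Closure under the first part keeps the constructed conditions in
    \<open>s\<close> for all \<open>n\<close> simultaneously. Closure under the second keeps their
    members, and the elements of these, in \<open>s\<close>, so that the union does not exceed
    \<open>s\<close>.\<close>
  define f where "f q x = (if q \<in> ?Q then range (\<lambda>n. E n q x) \<union> (\<Union>y\<in>members q. insert y (elts y)) else {})"
    for q x
  have "countable (f q x) \<and> f q x \<subseteq> H \<kappa>" if x: "x \<in> H \<kappa>" for q x
  proof (cases "q \<in> ?Q")
    case True
    then have y: "y \<in> elts S" if "y \<in> members q" for y using members_S that by blast
    have "countable (\<Union>y\<in>members q. insert y (elts y))"
      using True y S_countable countable_members by (intro countable_UN) auto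
    moreover have "(\<Union>y\<in>members q. insert y (elts y)) \<subseteq> H \<kappa>" using y S_in_H S_subset_H by blast
    moreover have "range (\<lambda>n. E n q x) \<subseteq> H \<kappa>" using E[OF True x] chain_conds_in_H by blast
    ultimately show ?thesis using True unfolding f_def by simp
  qed (auto simp: f_def)
  moreover have "countable {p}" "{p} \<subseteq> H \<kappa>" using p chain_conds_in_H by auto
  ultimately obtain s where s: "s \<in> elts S" "{p} \<subseteq> elts s" "\<And>q x. q \<in> elts s \<Longrightarrow> x \<in> elts s \<Longrightarrow> f q x \<subseteq> elts s"
    by (rule stationary_closed[of f "{p}"]) blast+
  define e where "e = from_nat_into (elts s)"
  have e: "range e = elts s" unfolding e_def using S_countable[OF s(1)] s(2) by (intro range_from_nat_into) auto
  \<comment> \<open>Step \<open>n\<close> enters \<open>D n\<close> and covers the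
    \<open>n\<close>-th element of \<open>s\<close>.\<close>
  define c where "c = rec_nat p (\<lambda>n q. E n q (e n))"
  have c0: "c 0 = p" and cS: "c (Suc n) = E n (c n) (e n)" for n by (simp_all add: c_def)
  have eH: "e n \<in> H \<kappa>" for n using e S_subset_H[OF s(1)] by blast
  have c: "c n \<in> ?Q \<and> c n \<in> elts s" for n
  proof (induction n)
    case 0
    then show ?case using p s(2) by (simp add: c0)
  next
    case (Suc n)
    have "E n (c n) (e n) \<in> f (c n) (e n)" using Suc unfolding f_def by auto
    moreover have "f (c n) (e n) \<subseteq> elts s" using s(3) Suc e by blast
    ultimately show ?case using E[of "c n" "e n" n] Suc eH unfolding cS by blast
  qed
  have mono: "elts (c m) \<subseteq> elts (c n)" if "m \<le> n" for m n
    by (rule lift_Suc_mono_le[OF _ that]) (use c E eH in \<open>simp add: cS\<close>)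
  have step: "\<exists>j Z. vpair j Z \<in> elts (c (Suc n)) \<and> e n \<in> elts Z \<and> (\<forall>i y. vpair i y \<in> elts (c n) \<longrightarrow> y \<in> elts Z)" for n
    using E[of "c n" "e n" n] c eH unfolding cS by blast
  have ys: "insert y (elts y) \<subseteq> elts s" if "vpair i y \<in> elts (c n)" for i y n
  proof -
    have "y \<in> members (c n)" using that unfolding members_def by blast
    then have "insert y (elts y) \<subseteq> f (c n) p" unfolding f_def using c by auto
    then show ?thesis using s(2,3) c by blast
  qed
  have dir: "directed (range c)"
    unfolding directed_def
  proof (intro conjI ballI allI impI)
    fix p q assume "p \<in> range c" "q \<in> range c"
    then obtain m n where "p = c m" "q = c n" by blast
    then show "\<exists>r\<in>range c. elts p \<subseteq> elts r \<and> elts q \<subseteq> elts r"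
      using mono[of m "max m n"] mono[of n "max m n"] by auto
  next
    fix p i x assume "p \<in> range c" "vpair i x \<in> elts p"
    then show "\<exists>q\<in>range c. \<exists>j y. vpair j y \<in> elts q \<and> x \<in> elts y" using step by blast
  qed (use c in auto)
  have sz: "z \<in> elts s \<longleftrightarrow> (\<exists>p\<in>range c. \<exists>i x. vpair i x \<in> elts p \<and> z \<in> elts x)" for z
  proof
    assume "z \<in> elts s"
    then obtain n where "z = e n" using e by blast
    then show "\<exists>p\<in>range c. \<exists>i x. vpair i x \<in> elts p \<and> z \<in> elts x" using step[of n] by blast
  qed (use ys in blast)
  obtain q where q: "q \<in> chain_conds S" "\<And>p. p \<in> range c \<Longrightarrow> elts p \<subseteq> elts q"
    by (rule directed_bound[OF dir s(1) sz]) blast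
  have "q \<in> D n" for n
  proof (rule opn[OF _ _ q(1)])
    show "c (Suc n) \<in> D n" using E[of "c n" "e n" n] c eH unfolding cS by blast
  qed (use c q(2) in auto)
  moreover have "elts p \<subseteq> elts q" using q(2)[of "c 0"] c0 by auto
  ultimately show thesis using that q(1) by blast
qed

text \<open>If \<open>r\<close> were longer than \<open>q\<close>, it would have some member
  \<open>z\<close> at the first index beyond \<open>q\<close>; extending \<open>q\<close> there by a
  \<open>Z\<close> containing \<open>z\<close> gives a condition incompatible with \<open>r\<close>,
  since \<open>Z = z\<close> is excluded by foundation. So the domain of \<open>r\<close> is
  included in that of \<open>q\<close>, and a common extension forces agreement.\<close>

lemma chain_separative:
  assumes q: "q \<in> chain_conds S" and r: "r \<in> chain_conds S"
    and compat: "\<And>q'. q' \<in> chain_conds S \<Longrightarrow> elts q \<subseteq> elts q' \<Longrightarrow>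
      \<exists>s\<in>chain_conds S. elts q' \<subseteq> elts s \<and> elts r \<subseteq> elts s"
  shows "elts r \<subseteq> elts q"
proof -
  obtain l where l: "Ord l" "\<And>i. (\<exists>x. vpair i x \<in> elts q) \<longleftrightarrow> i \<in> elts l \<or> i = l"
    using chain_conds_dom[OF q] by blast
  obtain k where k: "Ord k" "\<And>i. (\<exists>x. vpair i x \<in> elts r) \<longleftrightarrow> i \<in> elts k \<or> i = k"
    using chain_conds_dom[OF r] by blast
  have no: "l \<notin> elts k"
  proof
    assume lk: "l \<in> elts k"
    then have "elts (vsucc l) \<subseteq> elts k" using Ord_trans[OF k(1) lk] by auto
    then have "vsucc l \<in> elts k \<or> vsucc l = k" by (rule Ord_subset_imp[OF Ord_vsucc[OF l(1)] k(1)])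
    then obtain z where z: "vpair (vsucc l) z \<in> elts r" using k(2) by blast
    have "countable (insert z (members q))" "insert z (members q) \<subseteq> H \<kappa>"
      using countable_members[OF q] members_S[OF q] S_in_H chain_conds_snd[OF r z] by auto
    then obtain Z where Z: "Z \<in> elts S" "insert z (members q) \<subseteq> elts Z"
      using S_covers by blast
    have mem: "x \<in> elts Z" if "vpair i x \<in> elts q" for i x
      using that Z(2) unfolding members_def by blast
    obtain q' where q': "q' \<in> chain_conds S" "elts q' = insert (vpair (vsucc l) Z) (elts q)"
      by (rule chain_extend[OF q l Z(1) mem])
    then obtain s where s: "s \<in> chain_conds S" "elts q' \<subseteq> elts s" "elts r \<subseteq> elts s"
      using compat[OF q'(1)] by blast
    then have "Z = z" using chain_conds_functional[OF s(1), of "vsucc l" Z z] q'(2) z by blast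
    then show False using Z(2) mem_irrefl[of z] by blast
  qed
  have "k \<in> elts l \<or> k = l" using Ord_linear[OF k(1) l(1)] no by blast
  then have kl: "i \<in> elts l \<or> i = l" if "i \<in> elts k \<or> i = k" for i
    using that Ord_trans[OF l(1)] by blast
  obtain s where s: "s \<in> chain_conds S" "elts q \<subseteq> elts s" "elts r \<subseteq> elts s" using compat[OF q] by blast
  show ?thesis
  proof
    fix z assume z: "z \<in> elts r"
    then obtain i x where ix: "z = vpair i x" using chain_conds_pair[OF r] by blast
    then have "i \<in> elts k \<or> i = k" using k(2)[of i] z by blast
    then obtain y where y: "vpair i y \<in> elts q" using kl[of i] l(2)[of i] by blast
    have "x = y" by (rule chain_conds_functional[OF s(1), of i]) (use s y z ix in blast)+
    then show "z \<in> elts q" using y ix by simp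
  qed
qed

section \<open>Chains of length one and the order of the chain forcing\<close>

lemma singleton_chain:
  assumes x: "x \<in> elts S"
  shows "vset {vpair (vset {}) x} \<in> chain_conds S" "elts (vset {vpair (vset {}) x}) = {vpair (vset {}) x}"
proof -
  have 0: "elts (vset {} :: 'v) = {}" by (intro elts_vset_small small_countable) simp
  show 1: "elts (vset {vpair (vset {}) x}) = {vpair (vset {}) x}"
    by (intro elts_vset_small small_countable) simp
  have "Ord (vset {} :: 'v)" by (simp add: Ord_def vtransitive_def 0)
  then show "vset {vpair (vset {}) x} \<in> chain_conds S"
    unfolding chain_conds_iff 1 using x by (auto simp: 0 Limit_def intro!: exI[of _ "vset {}"])
qed

text \<open>Each element of \<open>S\<close> forms a chain of length one, so \<open>S\<close> can be
  read off from the conditions; this makes \<open>S\<close> definable from the forcing.\<close>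

lemma S_eq: "x \<in> elts S \<longleftrightarrow> (\<exists>p\<in>chain_conds S. \<exists>i. vpair i x \<in> elts p)"
proof
  assume x: "x \<in> elts S"
  have "vpair (vset {}) x \<in> elts (vset {vpair (vset {}) x})" unfolding singleton_chain(2)[OF x] by simp
  then show "\<exists>p\<in>chain_conds S. \<exists>i. vpair i x \<in> elts p" using singleton_chain(1)[OF x] by blast
qed (use chain_conds_snd in blast)

lemma chain_conds_nonempty: "chain_conds S \<noteq> {}"
  using singleton_chain(1) S_covers[of "{}"] by blast

lemma forcing_PS: "forcing (PS S)"
proof -
  have "\<exists>C R. PS S = vpair C R" unfolding PS_def by blast
  moreover have "\<exists>q\<in>conds (PS S). \<exists>p\<in>conds (PS S). z = vpair q p" if "z \<in> elts (vsnd (PS S))" for z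
  proof -
    have "small {vpair p q | p q. p \<in> chain_conds S \<and> q \<in> chain_conds S \<and> elts q \<subseteq> elts p}"
      by (rule small_subset[OF small_pairs[OF small_chain_conds[of S] small_chain_conds[of S]]]) auto
    then show ?thesis using that unfolding elts_PS by (auto simp: PS_def elts_vset_small)
  qed
  ultimately show ?thesis
    unfolding forcing_def elts_PS using chain_conds_nonempty by blast
qed

lemma forcing_order_PS: "forcing_order (PS S)"
  using forcing_PS unfolding forcing_def forcing_order_def by blast

end

section \<open>Definability over transitive models\<close>

definition pmem_in :: "'v::zfc set \<Rightarrow> 'v \<Rightarrow> 'v \<Rightarrow> 'v \<Rightarrow> bool"
  where "pmem_in M p i x \<longleftrightarrow> (\<exists>z\<in>M. z \<in> elts p \<and> pair_in M z i x)"

lemma pmem_in_iff: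
  assumes "pair_closed M" "p \<in> M" "i \<in> M" "x \<in> M"
  shows "pmem_in M p i x \<longleftrightarrow> vpair i x \<in> elts p"
  unfolding pmem_in_def using pair_in_iff[OF assms(1,3,4)] pair_closed_vpair[OF assms(1,3,4)] by blast

text \<open>Bound variables of the auxiliary formulas range from 99 to 104, so that parameter
  variables below 99 are never captured.\<close>

definition pmemF :: "nat \<Rightarrow> nat \<Rightarrow> nat \<Rightarrow> fm"
  where "pmemF p i x = Ex 99 (Conj (Mem 99 p) (pairF 99 i x))"

lemma fv_pmemF [simp]: "p < 99 \<Longrightarrow> i < 99 \<Longrightarrow> x < 99 \<Longrightarrow> fv (pmemF p i x) = {p, i, x}"
  by (auto simp: pmemF_def)

lemma sat_pmemF [simp]:
  "p < 99 \<Longrightarrow> i < 99 \<Longrightarrow> x < 99 \<Longrightarrow> sat M A (pmemF p i x) e \<longleftrightarrow> pmem_in M (e p) (e i) (e x)"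
  by (simp add: pmemF_def pmem_in_def)

definition transF :: "nat \<Rightarrow> fm"
  where "transF v = All 102 (Imp (Mem 102 v) (All 103 (Imp (Mem 103 102) (Mem 103 v))))"

definition OrdF :: "nat \<Rightarrow> fm"
  where "OrdF v = Conj (transF v) (All 104 (Imp (Mem 104 v) (transF 104)))"

definition LimitF :: "nat \<Rightarrow> fm"
  where "LimitF v = Conj (OrdF v) (Conj (Ex 102 (Mem 102 v))
    (All 102 (Imp (Mem 102 v) (Ex 103 (Conj (Mem 103 v) (Mem 102 103))))))"

lemma fv_OrdF_LimitF [simp]: "v < 99 \<Longrightarrow> fv (OrdF v) = {v}" "v < 99 \<Longrightarrow> fv (LimitF v) = {v}"
  by (auto simp: OrdF_def LimitF_def transF_def)

lemma sat_transF:
  assumes M: "pair_closed M" and v: "v \<noteq> 102" "v \<noteq> 103" "e v \<in> M"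
  shows "sat M A (transF v) e \<longleftrightarrow> vtransitive (e v)"
  unfolding transF_def vtransitive_def using v(1,2) pair_closed_mem[OF M] v(3) by simp blast

lemma sat_OrdF:
  assumes M: "pair_closed M" and v: "v < 99" "e v \<in> M"
  shows "sat M A (OrdF v) e \<longleftrightarrow> Ord (e v)"
proof -
  have "sat M A (transF v) e \<longleftrightarrow> vtransitive (e v)" by (rule sat_transF[OF M]) (use v in auto)
  moreover have "sat M A (transF 104) (e(104 := x)) \<longleftrightarrow> vtransitive x" if "x \<in> M" for x
    by (subst sat_transF[OF M]) (use that in auto)
  ultimately show ?thesis
    unfolding OrdF_def Ord_def using v pair_closed_mem[OF M v(2)] by auto
qed

lemma sat_LimitF:
  assumes M: "pair_closed M" and v: "v < 99" "e v \<in> M"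
  shows "sat M A (LimitF v) e \<longleftrightarrow> Limit (e v)"
  unfolding LimitF_def Limit_def sat.simps sat_OrdF[where e = e, OF M v]
  using v pair_closed_mem[OF M v(2)] by simp blast

lemma chain_formula_iff_aux:
  assumes M: "pair_closed M" and p: "p \<in> M"
  shows "(\<exists>x\<in>M. pmem_in M p i x) \<and> i \<in> M \<longleftrightarrow> (\<exists>x. vpair i x \<in> elts p)"
  using pmem_in_iff[OF M p] pair_closed_mem_vpairD[OF M p] by metis

text \<open>Defines \<open>chain_conds\<close>, cf. \<open>chain_conds_iff\<close>: variable 2 is the condition, variable 1 is \<open>S\<close>.\<close>
definition chainF :: fm
  where "chainF =
    Conj (All 3 (Imp (Mem 3 2) (Ex 4 (Ex 5 (Conj (pairF 3 4 5) (Mem 5 1))))))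
   (Conj (Ex 3 (Conj (OrdF 3) (All 4 (Iff (Ex 5 (pmemF 2 4 5)) (Or (Mem 4 3) (Eq 4 3))))))
   (Conj (All 3 (All 4 (All 5 (Imp (Conj (pmemF 2 3 4) (pmemF 2 3 5)) (Eq 4 5)))))
   (Conj (All 3 (All 4 (All 5 (All 6
            (Imp (Conj (pmemF 2 3 4) (Conj (pmemF 2 5 6) (Mem 3 5))) (Mem 4 6))))))
         (All 5 (All 6 (Imp (Conj (pmemF 2 5 6) (LimitF 5))
            (All 7 (Iff (Mem 7 6) (Ex 3 (Ex 4 (Conj (pmemF 2 3 4) (Conj (Mem 3 5) (Mem 7 4)))))))))))))"

lemma fv_chainF [simp]: "fv chainF = {1, 2}"
  by (auto simp: chainF_def)

text \<open>Absoluteness of the conditions. Every object quantified over is a coordinate of an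
  element of \<open>p\<close>, or an element of such a coordinate, so restricting the quantifiers to
  \<open>M\<close> changes nothing.\<close>

lemma (in stationary_chains) sat_chainF:
  assumes M: "pair_closed M" and e: "e 1 = S" "e 2 \<in> M" and S: "S \<in> M"
  shows "sat M A chainF e \<longleftrightarrow> e 2 \<in> chain_conds S"
proof -
  define p where "p = e 2"
  have p: "p \<in> M" using e by (simp add: p_def)
  note mem = pair_closed_mem[OF M] and pD = pair_closed_mem_vpairD[OF M p] and pm = pmem_in_iff[OF M p]
  let ?dom = "\<lambda>l i. (\<exists>x. vpair i x \<in> elts p) \<longleftrightarrow> i \<in> elts l \<or> i = l"
  have 1: "sat M A (All 3 (Imp (Mem 3 2) (Ex 4 (Ex 5 (Conj (pairF 3 4 5) (Mem 5 1)))))) e \<longleftrightarrow>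
      (\<forall>z\<in>elts p. \<exists>i x. z = vpair i x \<and> x \<in> elts S)" (is "?L \<longleftrightarrow> ?R")
  proof -
    have "?L \<longleftrightarrow> (\<forall>z\<in>M. z \<in> elts p \<longrightarrow> (\<exists>i\<in>M. \<exists>x\<in>M. pair_in M z i x \<and> x \<in> elts S))"
      using e by (simp add: p_def)
    also have "\<dots> \<longleftrightarrow> (\<forall>z\<in>M. z \<in> elts p \<longrightarrow> (\<exists>i\<in>M. \<exists>x\<in>M. z = vpair i x \<and> x \<in> elts S))"
      using pair_in_iff[OF M] by (intro ball_cong refl imp_cong bex_cong) blast
    also have "\<dots> \<longleftrightarrow> ?R" using mem[OF p] pD by metis
    finally show ?thesis .
  qed
  have 2: "sat M A (Ex 3 (Conj (OrdF 3) (All 4 (Iff (Ex 5 (pmemF 2 4 5)) (Or (Mem 4 3) (Eq 4 3)))))) e \<longleftrightarrow>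
      (\<exists>l. Ord l \<and> (\<forall>i. ?dom l i))" (is "?L \<longleftrightarrow> ?R")
  proof -
    have "?L \<longleftrightarrow> (\<exists>l\<in>M. Ord l \<and> (\<forall>i\<in>M. (\<exists>x\<in>M. pmem_in M p i x) \<longleftrightarrow> i \<in> elts l \<or> i = l))"
      unfolding sat_connectives sat.simps using e by (simp add: p_def sat_OrdF[OF M])
    also have "\<dots> \<longleftrightarrow> (\<exists>l\<in>M. Ord l \<and> (\<forall>i\<in>M. ?dom l i))"
      using chain_formula_iff_aux[OF M p] by (intro bex_cong refl conj_cong ball_cong) blast
    also have "\<dots> \<longleftrightarrow> ?R"
    proof
      assume "\<exists>l\<in>M. Ord l \<and> (\<forall>i\<in>M. ?dom l i)"
      then obtain l where l: "l \<in> M" "Ord l" "\<And>i. i \<in> M \<Longrightarrow> ?dom l i" by blast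
      have "?dom l i" for i using l(3) l(1) mem[OF l(1)] pD(1) by blast
      then show ?R using l by blast
    next
      assume ?R
      then obtain l where l: "Ord l" "\<And>i. ?dom l i" by blast
      \<comment> \<open>The ordinal \<open>l\<close> is itself an index, the last one, and therefore
        a coordinate of an element of \<open>p\<close>.\<close>
      then have "l \<in> M" using pD(1) by blast
      then show "\<exists>l\<in>M. Ord l \<and> (\<forall>i\<in>M. ?dom l i)" using l by blast
    qed
    finally show ?thesis .
  qed
  have 3: "sat M A (All 3 (All 4 (All 5 (Imp (Conj (pmemF 2 3 4) (pmemF 2 3 5)) (Eq 4 5))))) e \<longleftrightarrow>
      (\<forall>i x y. vpair i x \<in> elts p \<and> vpair i y \<in> elts p \<longrightarrow> x = y)" (is "?L \<longleftrightarrow> ?R")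
  proof -
    have "?L \<longleftrightarrow> (\<forall>i\<in>M. \<forall>x\<in>M. \<forall>y\<in>M. pmem_in M p i x \<and> pmem_in M p i y \<longrightarrow> x = y)" by (simp add: p_def)
    also have "\<dots> \<longleftrightarrow> (\<forall>i\<in>M. \<forall>x\<in>M. \<forall>y\<in>M. vpair i x \<in> elts p \<and> vpair i y \<in> elts p \<longrightarrow> x = y)"
      by (intro ball_cong refl) (simp add: pm)
    also have "\<dots> \<longleftrightarrow> ?R" using pD by blast
    finally show ?thesis .
  qed
  have 4: "sat M A (All 3 (All 4 (All 5 (All 6
            (Imp (Conj (pmemF 2 3 4) (Conj (pmemF 2 5 6) (Mem 3 5))) (Mem 4 6)))))) e \<longleftrightarrow>
      (\<forall>i x j y. vpair i x \<in> elts p \<and> vpair j y \<in> elts p \<and> i \<in> elts j \<longrightarrow> x \<in> elts y)" (is "?L \<longleftrightarrow> ?R")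
  proof -
    have "?L \<longleftrightarrow> (\<forall>i\<in>M. \<forall>x\<in>M. \<forall>j\<in>M. \<forall>y\<in>M.
        pmem_in M p i x \<and> pmem_in M p j y \<and> i \<in> elts j \<longrightarrow> x \<in> elts y)" by (simp add: p_def)
    also have "\<dots> \<longleftrightarrow> (\<forall>i\<in>M. \<forall>x\<in>M. \<forall>j\<in>M. \<forall>y\<in>M.
        vpair i x \<in> elts p \<and> vpair j y \<in> elts p \<and> i \<in> elts j \<longrightarrow> x \<in> elts y)"
      by (intro ball_cong refl) (simp add: pm)
    also have "\<dots> \<longleftrightarrow> ?R" using pD by blast
    finally show ?thesis .
  qed
  have 5: "sat M A (All 5 (All 6 (Imp (Conj (pmemF 2 5 6) (LimitF 5))
            (All 7 (Iff (Mem 7 6) (Ex 3 (Ex 4 (Conj (pmemF 2 3 4) (Conj (Mem 3 5) (Mem 7 4)))))))))) e \<longleftrightarrow>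
      (\<forall>j y. vpair j y \<in> elts p \<and> Limit j \<longrightarrow>
        (\<forall>z. z \<in> elts y \<longleftrightarrow> (\<exists>i x. vpair i x \<in> elts p \<and> i \<in> elts j \<and> z \<in> elts x)))" (is "?L \<longleftrightarrow> ?R")
  proof -
    have "?L \<longleftrightarrow> (\<forall>j\<in>M. \<forall>y\<in>M. pmem_in M p j y \<and> Limit j \<longrightarrow>
        (\<forall>z\<in>M. z \<in> elts y \<longleftrightarrow> (\<exists>i\<in>M. \<exists>x\<in>M. pmem_in M p i x \<and> i \<in> elts j \<and> z \<in> elts x)))"
      unfolding sat_connectives sat.simps by (simp add: p_def sat_LimitF[OF M])
    also have "\<dots> \<longleftrightarrow> (\<forall>j\<in>M. \<forall>y\<in>M. vpair j y \<in> elts p \<and> Limit j \<longrightarrow>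
        (\<forall>z\<in>M. z \<in> elts y \<longleftrightarrow> (\<exists>i\<in>M. \<exists>x\<in>M. vpair i x \<in> elts p \<and> i \<in> elts j \<and> z \<in> elts x)))"
      by (intro ball_cong refl) (simp add: pm)
    also have "\<dots> \<longleftrightarrow> ?R"
    proof -
      define Q where "Q j z \<longleftrightarrow> (\<exists>i x. vpair i x \<in> elts p \<and> i \<in> elts j \<and> z \<in> elts x)" for j z
      have Q: "(\<exists>i\<in>M. \<exists>x\<in>M. vpair i x \<in> elts p \<and> i \<in> elts j \<and> z \<in> elts x) \<longleftrightarrow> Q j z" for j z
        unfolding Q_def using pD by blast
      have "Q j z \<Longrightarrow> z \<in> M" for j z unfolding Q_def using pD(2) mem by blast
      then have "(\<forall>z\<in>M. z \<in> elts y \<longleftrightarrow> Q j z) \<longleftrightarrow> (\<forall>z. z \<in> elts y \<longleftrightarrow> Q j z)" if "y \<in> M" for j y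
        using mem[OF that] by blast
      then show ?thesis unfolding Q unfolding Q_def[symmetric] using pD by blast
    qed
    finally show ?thesis .
  qed
  show ?thesis
    unfolding chainF_def sat.simps(5)[of M A] 1 2 3 4 5 unfolding p_def[symmetric] chain_conds_iff ..
qed

section \<open>Elementary embeddings of countable models and generic filters\<close>

locale elementary_embedding =
  fixes \<sigma> :: "'v::zfc \<Rightarrow> 'v" and M N A B :: "'v set"
  assumes emb: "elem_emb \<sigma> M A N B" and pair_closed_M: "pair_closed M" and pair_closed_N: "pair_closed N"
begin

lemmas mem_iff = elem_emb_mem_iff[OF emb] and eq_iff = elem_emb_eq_iff[OF emb] and in_N = elem_emb_in[OF emb]
lemmas memM = pair_closed_mem[OF pair_closed_M] and memN = pair_closed_mem[OF pair_closed_N]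
lemmas vpairM = pair_closed_vpair[OF pair_closed_M] and vpairN = pair_closed_vpair[OF pair_closed_N]

lemma emb_vpair:
  assumes "x \<in> M" "y \<in> M" shows "\<sigma> (vpair x y) = vpair (\<sigma> x) (\<sigma> y)"
proof -
  let ?e = "(!) [vpair x y, x, y]"
  have "sat M A (pairF 0 1 2) ?e"
    using assms vpairM[OF assms] by (simp add: pair_in_iff[OF pair_closed_M])
  moreover have "?e ` fv (pairF 0 1 2) \<subseteq> M" using assms vpairM[OF assms] by simp
  ultimately have "sat N B (pairF 0 1 2) (\<sigma> \<circ> ?e)" using elem_embD[OF emb] by blast
  then show ?thesis
    using assms vpairM[OF assms] in_N by (simp add: pair_in_iff[OF pair_closed_N])
qed

lemma emb_vpairD:
  assumes a: "a \<in> M" "\<sigma> a = vpair u v"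
  obtains u' v' where "u' \<in> M" "v' \<in> M" "a = vpair u' v'" "\<sigma> u' = u" "\<sigma> v' = v"
proof -
  have uv: "u \<in> N" "v \<in> N" using pair_closed_vpairD[OF pair_closed_N] in_N[OF a(1)] a(2) by metis+
  have pN: "vpair u v \<in> N" using in_N[OF a(1)] a(2) by simp
  obtain u' where u': "u' \<in> M" "\<sigma> u' = u"
  proof (rule elem_emb_definable[OF emb, of "(!) [a, a]" "Ex 2 (pairF 1 0 2)" 0 u])
    fix z assume z: "z \<in> N"
    then show "sat N B (Ex 2 (pairF 1 0 2)) ((\<sigma> \<circ> (!) [a, a])(0 := z)) \<longleftrightarrow> z = u"
      using uv pN a by (auto simp: pair_in_iff[OF pair_closed_N])
  qed (use a uv in auto)
  obtain v' where v': "v' \<in> M" "\<sigma> v' = v"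
  proof (rule elem_emb_definable[OF emb, of "(!) [a, a]" "Ex 2 (pairF 1 2 0)" 0 v])
    fix z assume z: "z \<in> N"
    then show "sat N B (Ex 2 (pairF 1 2 0)) ((\<sigma> \<circ> (!) [a, a])(0 := z)) \<longleftrightarrow> z = v"
      using uv pN a by (auto simp: pair_in_iff[OF pair_closed_N])
  qed (use a uv in auto)
  have "\<sigma> (vpair u' v') = \<sigma> a" using emb_vpair u' v' a by simp
  then have "a = vpair u' v'" using eq_iff vpairM u' v' a by metis
  then show thesis using that u' v' by blast
qed

lemma emb_definable:
  assumes e: "set xs \<subseteq> M" and fv: "fv \<phi> \<subseteq> insert 0 {i. 0 < i \<and> i \<le> length xs}" and y: "y \<in> N"
    and def: "\<And>z. z \<in> N \<Longrightarrow> sat N B \<phi> ((!) (z # map \<sigma> xs)) \<longleftrightarrow> z = y"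
  obtains y' where "y' \<in> M" "\<sigma> y' = y"
\<comment> \<open>Variable 0 is the object being defined and the parameters start at variable 1;
  \<open>undefined\<close> only fills position 0, which is overwritten by the candidate.\<close>
proof (rule elem_emb_definable[OF emb, of "(!) (undefined # xs)" \<phi> 0 y])
  show "(!) (undefined # xs) ` (fv \<phi> - {0}) \<subseteq> M"
  proof
    fix v assume "v \<in> (!) (undefined # xs) ` (fv \<phi> - {0})"
    then obtain i where i: "i \<in> fv \<phi>" "i \<noteq> 0" "v = (undefined # xs) ! i" by blast
    then have "0 < i" "i \<le> length xs" using fv by auto
    then show "v \<in> M" using i e by (cases i) auto
  qed
  fix z assume z: "z \<in> N"
  have "sat N B \<phi> ((\<sigma> \<circ> (!) (undefined # xs))(0 := z)) \<longleftrightarrow> sat N B \<phi> ((!) (z # map \<sigma> xs))"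
  proof (rule sat_cong)
    fix i assume "i \<in> fv \<phi>"
    then have "i = 0 \<or> (0 < i \<and> i \<le> length xs)" using fv by auto
    then show "((\<sigma> \<circ> (!) (undefined # xs))(0 := z)) i = (z # map \<sigma> xs) ! i" by (cases i) auto
  qed
  then show "sat N B \<phi> ((\<sigma> \<circ> (!) (undefined # xs))(0 := z)) \<longleftrightarrow> z = y" using def[OF z] by simp
qed (use y that in auto)

text \<open>With \<open>emb_vsucc\<close> this keeps the natural numbers in the range, and
  \<open>emb_app\<close> does the same for values of functions; together they give
  \<open>countable_elt_subset_range\<close>.\<close>

lemma emb_empty:
  assumes "n \<in> N" "elts n = {}"
  obtains n' where "n' \<in> M" "\<sigma> n' = n"
proof (rule emb_definable[of "[]" "All 1 (Neg (Mem 1 0))" n])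
  fix z assume z: "z \<in> N"
  have "sat N B (All 1 (Neg (Mem 1 0))) ((!) (z # map \<sigma> [])) \<longleftrightarrow> elts z = {}"
    using memN[OF z] by auto
  also have "\<dots> \<longleftrightarrow> z = n" using assms(2) extensionality by metis
  finally show "sat N B (All 1 (Neg (Mem 1 0))) ((!) (z # map \<sigma> [])) \<longleftrightarrow> z = n" .
qed (use assms that in auto)

lemma emb_vsucc:
  assumes m: "m \<in> M" and n: "n \<in> N" "elts n = insert (\<sigma> m) (elts (\<sigma> m))"
  obtains n' where "n' \<in> M" "\<sigma> n' = n"
proof (rule emb_definable[of "[m]" "All 2 (Iff (Mem 2 0) (Or (Mem 2 1) (Eq 2 1)))" n])
  fix z assume z: "z \<in> N"
  have "sat N B (All 2 (Iff (Mem 2 0) (Or (Mem 2 1) (Eq 2 1)))) ((!) (z # map \<sigma> [m])) \<longleftrightarrow>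
      (\<forall>w\<in>N. w \<in> elts z \<longleftrightarrow> w \<in> elts (\<sigma> m) \<or> w = \<sigma> m)" by simp
  also have "\<dots> \<longleftrightarrow> elts z = insert (\<sigma> m) (elts (\<sigma> m))"
    using memN[OF z] memN[OF in_N[OF m]] in_N[OF m] by blast
  also have "\<dots> \<longleftrightarrow> z = n" using n(2) extensionality by metis
  finally show "sat N B (All 2 (Iff (Mem 2 0) (Or (Mem 2 1) (Eq 2 1)))) ((!) (z # map \<sigma> [m])) \<longleftrightarrow> z = n" .
qed (use assms that in auto)

lemma emb_app:
  assumes f: "f \<in> M" and n: "n \<in> M" and z: "vpair (\<sigma> n) z \<in> elts (\<sigma> f)"
    and unique: "\<And>w. vpair (\<sigma> n) w \<in> elts (\<sigma> f) \<Longrightarrow> w = z"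
  obtains z' where "z' \<in> M" "\<sigma> z' = z"
proof (rule emb_definable[of "[n, f]" "pmemF 2 1 0" z])
  show "z \<in> N" using pair_closed_mem_vpairD[OF pair_closed_N in_N[OF f] z] by blast
  fix w assume w: "w \<in> N"
  have "sat N B (pmemF 2 1 0) ((!) (w # map \<sigma> [n, f])) \<longleftrightarrow> vpair (\<sigma> n) w \<in> elts (\<sigma> f)"
    using pmem_in_iff[OF pair_closed_N in_N[OF f] in_N[OF n] w] by simp
  also have "\<dots> \<longleftrightarrow> w = z" using z unique by blast
  finally show "sat N B (pmemF 2 1 0) ((!) (w # map \<sigma> [n, f])) \<longleftrightarrow> w = z" .
qed (use f n that in auto)

end

primrec vnat :: "nat \<Rightarrow> 'v::zfc" where
  "vnat 0 = vset {}"
| "vnat (Suc n) = vsucc (vnat n)"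

lemma elts_vnat_0: "elts (vnat 0 :: 'v::zfc) = {}"
  unfolding vnat.simps by (intro elts_vset_small small_countable) simp

lemma vnat_mem: "m < n \<Longrightarrow> (vnat m :: 'v::zfc) \<in> elts (vnat n)"
  by (induction n) (auto simp: less_Suc_eq)

lemma inj_vnat: "inj (vnat :: nat \<Rightarrow> 'v::zfc)"
  by (rule linorder_injI) (metis vnat_mem mem_irrefl)

lemma elts_vnat_subset: "elts (vnat n :: 'v::zfc) \<subseteq> range vnat"
proof (induction n)
  case (Suc n)
  then show ?case by auto
qed (simp add: elts_vnat_0 del: vnat.simps)

text \<open>
  A function from natural numbers is recognised by its domain being closed under predecessors;
  foundation then makes every argument a natural number.
\<close>
definition seqF :: fm
  where "seqF = Conj (All 2 (Imp (Mem 2 1) (Ex 3 (pmemF 0 3 2))))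
   (Conj (All 2 (All 3 (All 4 (Imp (Conj (pmemF 0 2 3) (pmemF 0 2 4)) (Eq 3 4)))))
         (All 2 (All 3 (Imp (pmemF 0 2 3) (Or (All 4 (Neg (Mem 4 2)))
            (Ex 5 (Ex 6 (Conj (pmemF 0 5 6) (All 4 (Iff (Mem 4 2) (Or (Mem 4 5) (Eq 4 5))))))))))))"

lemma fv_seqF: "fv seqF = {0, 1}"
  by (auto simp: seqF_def)

lemma sat_seqF:
  assumes M: "pair_closed M" and e: "e 0 = f" "e 1 = c" "f \<in> M" "c \<in> M"
  shows "sat M A seqF e \<longleftrightarrow>
    (\<forall>z\<in>elts c. \<exists>n. vpair n z \<in> elts f) \<and>
    (\<forall>n z z'. vpair n z \<in> elts f \<and> vpair n z' \<in> elts f \<longrightarrow> z = z') \<and>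
    (\<forall>n z. vpair n z \<in> elts f \<longrightarrow> elts n = {} \<or>
      (\<exists>m y. vpair m y \<in> elts f \<and> elts n = insert m (elts m)))"
proof -
  note fD = pair_closed_mem_vpairD[OF M e(3)] and pm = pmem_in_iff[OF M e(3)] and mem = pair_closed_mem[OF M]
  have "sat M A seqF e \<longleftrightarrow>
    (\<forall>z\<in>M. z \<in> elts c \<longrightarrow> (\<exists>n\<in>M. pmem_in M f n z)) \<and>
    (\<forall>n\<in>M. \<forall>z\<in>M. \<forall>z'\<in>M. pmem_in M f n z \<and> pmem_in M f n z' \<longrightarrow> z = z') \<and>
    (\<forall>n\<in>M. \<forall>z\<in>M. pmem_in M f n z \<longrightarrow> (\<forall>w\<in>M. w \<notin> elts n) \<or>
      (\<exists>m\<in>M. \<exists>y\<in>M. pmem_in M f m y \<and> (\<forall>w\<in>M. w \<in> elts n \<longleftrightarrow> w \<in> elts m \<or> w = m)))"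
    using e(1,2) by (simp add: seqF_def)
  also have "\<dots> \<longleftrightarrow>
    (\<forall>z\<in>M. z \<in> elts c \<longrightarrow> (\<exists>n\<in>M. vpair n z \<in> elts f)) \<and>
    (\<forall>n\<in>M. \<forall>z\<in>M. \<forall>z'\<in>M. vpair n z \<in> elts f \<and> vpair n z' \<in> elts f \<longrightarrow> z = z') \<and>
    (\<forall>n\<in>M. \<forall>z\<in>M. vpair n z \<in> elts f \<longrightarrow> elts n = {} \<or>
      (\<exists>m\<in>M. \<exists>y\<in>M. vpair m y \<in> elts f \<and> elts n = insert m (elts m)))"
  proof -
    have "(\<forall>w\<in>M. w \<notin> elts n) \<longleftrightarrow> elts n = {}" if "n \<in> M" for n using mem[OF that] by blast
    moreover have "(\<forall>w\<in>M. w \<in> elts n \<longleftrightarrow> w \<in> elts m \<or> w = m) \<longleftrightarrow> elts n = insert m (elts m)"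
      if "n \<in> M" "m \<in> M" for n m using mem[OF that(1)] mem[OF that(2)] that by blast
    ultimately show ?thesis by (simp add: pm)
  qed
  also have "(\<forall>z\<in>M. z \<in> elts c \<longrightarrow> (\<exists>n\<in>M. vpair n z \<in> elts f)) \<longleftrightarrow> (\<forall>z\<in>elts c. \<exists>n. vpair n z \<in> elts f)"
    using fD mem[OF e(4)] by metis
  also have "(\<forall>n\<in>M. \<forall>z\<in>M. \<forall>z'\<in>M. vpair n z \<in> elts f \<and> vpair n z' \<in> elts f \<longrightarrow> z = z') \<longleftrightarrow>
      (\<forall>n z z'. vpair n z \<in> elts f \<and> vpair n z' \<in> elts f \<longrightarrow> z = z')"
    using fD by metis
  also have "(\<forall>n\<in>M. \<forall>z\<in>M. vpair n z \<in> elts f \<longrightarrow> elts n = {} \<or>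
      (\<exists>m\<in>M. \<exists>y\<in>M. vpair m y \<in> elts f \<and> elts n = insert m (elts m))) \<longleftrightarrow>
      (\<forall>n z. vpair n z \<in> elts f \<longrightarrow> elts n = {} \<or>
      (\<exists>m y. vpair m y \<in> elts f \<and> elts n = insert m (elts m)))"
    using fD by metis
  finally show ?thesis .
qed

context elementary_embedding
begin

text \<open>The enumeration \<open>f\<close> need not lie in the range. Elementarity replaces it by
  some \<open>\<sigma> g\<close> with the properties stated by \<open>seqF\<close>; its arguments
  are natural numbers, hence in the range, and so are its values.\<close>

lemma countable_elt_subset_range:
  assumes c: "c \<in> M" and f: "f \<in> N"
    and h: "elts (\<sigma> c) = range h" "elts f = {vpair (vnat n) (h n) | n. True}"
  shows "elts (\<sigma> c) \<subseteq> \<sigma> ` M"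
proof -
  have "(\<forall>z\<in>elts (\<sigma> c). \<exists>n. vpair n z \<in> elts f) \<and>
    (\<forall>n z z'. vpair n z \<in> elts f \<and> vpair n z' \<in> elts f \<longrightarrow> z = z') \<and>
    (\<forall>n z. vpair n z \<in> elts f \<longrightarrow> elts n = {} \<or>
      (\<exists>m y. vpair m y \<in> elts f \<and> elts n = insert m (elts m)))"
  proof (intro conjI ballI allI impI)
    fix z assume "z \<in> elts (\<sigma> c)"
    then show "\<exists>n. vpair n z \<in> elts f" using h by auto
  next
    fix n z z' assume "vpair n z \<in> elts f \<and> vpair n z' \<in> elts f"
    then show "z = z'" using inj_vnat unfolding h(2) by (auto dest: injD)
  next
    fix n z assume "vpair n z \<in> elts f"
    then obtain k where k: "n = vnat k" unfolding h(2) by auto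
    show "elts n = {} \<or> (\<exists>m y. vpair m y \<in> elts f \<and> elts n = insert m (elts m))"
    proof (cases k)
      case 0
      show ?thesis unfolding k 0 elts_vnat_0 by blast
    next
      case (Suc l)
      have "vpair (vnat l) (h l) \<in> elts f" unfolding h(2) by blast
      then show ?thesis using k Suc by auto
    qed
  qed
  then have "sat N B seqF ((\<sigma> \<circ> (!) [c, c])(0 := f))"
    by (subst sat_seqF[OF pair_closed_N _ _ f in_N[OF c]]) simp_all
  then have "sat N B (Ex 0 seqF) (\<sigma> \<circ> (!) [c, c])" using f by auto
  moreover have "(!) [c, c] ` fv (Ex 0 seqF) \<subseteq> M" using c by (simp add: fv_seqF)
  ultimately have "sat M A (Ex 0 seqF) ((!) [c, c])" using elem_embD[OF emb] by blast
  then obtain g where g: "g \<in> M" "sat M A seqF (((!) [c, c])(0 := g))" by auto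
  have "((!) [c, c])(0 := g) ` fv seqF \<subseteq> M" using c g(1) by (simp add: fv_seqF)
  then have "sat N B seqF (\<sigma> \<circ> ((!) [c, c])(0 := g))" using elem_embD[OF emb] g(2) by blast
  then have "(\<forall>z\<in>elts (\<sigma> c). \<exists>n. vpair n z \<in> elts (\<sigma> g)) \<and>
    (\<forall>n z z'. vpair n z \<in> elts (\<sigma> g) \<and> vpair n z' \<in> elts (\<sigma> g) \<longrightarrow> z = z') \<and>
    (\<forall>n z. vpair n z \<in> elts (\<sigma> g) \<longrightarrow> elts n = {} \<or>
      (\<exists>m y. vpair m y \<in> elts (\<sigma> g) \<and> elts n = insert m (elts m)))"
    by (subst (asm) sat_seqF[OF pair_closed_N _ _ in_N[OF g(1)] in_N[OF c]]) simp_all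
  then have onto: "\<And>z. z \<in> elts (\<sigma> c) \<Longrightarrow> \<exists>n. vpair n z \<in> elts (\<sigma> g)"
    and func: "\<And>n z z'. vpair n z \<in> elts (\<sigma> g) \<Longrightarrow> vpair n z' \<in> elts (\<sigma> g) \<Longrightarrow> z = z'"
    and pred: "\<And>n z. vpair n z \<in> elts (\<sigma> g) \<Longrightarrow> elts n = {} \<or>
      (\<exists>m y. vpair m y \<in> elts (\<sigma> g) \<and> elts n = insert m (elts m))" by blast+
  \<comment> \<open>By \<in>-induction: an argument is empty or the successor of another argument,
    and the range is closed under both cases.\<close>
  have dom: "n \<in> \<sigma> ` M" if "vpair n z \<in> elts (\<sigma> g)" for n z
    using that
  proof (induction n arbitrary: z rule: wf_induct_rule[OF wf_mem_rel])
    case (1 n)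
    have n: "n \<in> N" using pair_closed_mem_vpairD[OF pair_closed_N in_N[OF g(1)] "1.prems"] by blast
    from pred[OF "1.prems"] show ?case
    proof
      assume "elts n = {}"
      then show ?thesis using emb_empty[OF n] by blast
    next
      assume "\<exists>m y. vpair m y \<in> elts (\<sigma> g) \<and> elts n = insert m (elts m)"
      then obtain m y where m: "vpair m y \<in> elts (\<sigma> g)" "elts n = insert m (elts m)" by blast
      then have "m \<in> \<sigma> ` M" using "1.IH"[of m] by (simp add: mem_rel_iff)
      then obtain m' where "m' \<in> M" "m = \<sigma> m'" by blast
      then show ?thesis using emb_vsucc[of m' n] n m(2) by blast
    qed
  qed
  show ?thesis
  proof
    fix z assume "z \<in> elts (\<sigma> c)"
    then obtain n where n: "vpair n z \<in> elts (\<sigma> g)" using onto by blast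
    then obtain n' where n': "n' \<in> M" "n = \<sigma> n'" using dom by blast
    obtain z' where "z' \<in> M" "\<sigma> z' = z"
      using emb_app[OF g(1) n'(1), of z] n n'(2) func by blast
    then show "z \<in> \<sigma> ` M" by blast
  qed
qed

end

section \<open>Embeddings fixing the chain forcing\<close>

context stationary_chains
begin

text \<open>A transitive class containing the conditions, their indices and members; the natural
  numbers are added as arguments of enumerations.\<close>

definition chain_base :: "'v set"
  where "chain_base = TC (PS S) \<union> range vnat"

text \<open>
  If \<open>\<theta>\<close> is larger than this set, then \<open>H \<theta>\<close> contains \<open>PS S\<close>, the dense sets used below, and
  enumerations of the countable sets occurring in conditions, which are sets of pairs from the base.
\<close>
definition chain_bound :: "'v set"
  where "chain_bound = chain_base \<union> {z. \<exists>x\<in>chain_base. \<exists>y\<in>chain_base. z = vset {x, y}} \<union>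
    {z. \<exists>x\<in>chain_base. \<exists>y\<in>chain_base. z = vpair x y}"

lemma small_chain_bound: "small chain_bound"
proof -
  have b: "small chain_base"
    unfolding chain_base_def by (intro small_Un small_TC small_countable) simp
  have "small (\<Union>x\<in>chain_base. (\<lambda>y. vset {x, y}) ` chain_base)" by (intro small_UN small_image b)
  moreover have "(\<Union>x\<in>chain_base. (\<lambda>y. vset {x, y}) ` chain_base) =
      {z. \<exists>x\<in>chain_base. \<exists>y\<in>chain_base. z = vset {x, y}}" by blast
  ultimately show ?thesis unfolding chain_bound_def using b by (intro small_Un small_pairs) simp_all
qed

lemma chain_base_trans: "x \<in> chain_base \<Longrightarrow> elts x \<subseteq> chain_base"
  unfolding chain_base_def using TC_trans elts_vnat_subset by blast

text \<open>The unordered pairs in \<open>chain_bound\<close> are there for this purpose, being the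
  elements of the ordered ones. By transitivity a subset of \<open>chain_bound\<close> has its
  transitive closure inside it as well.\<close>

lemma chain_bound_trans: "x \<in> chain_bound \<Longrightarrow> elts x \<subseteq> chain_bound"
proof -
  assume "x \<in> chain_bound"
  then consider "x \<in> chain_base" | a b where "x = vset {a, b}" "a \<in> chain_base" "b \<in> chain_base"
    | a b where "x = vpair a b" "a \<in> chain_base" "b \<in> chain_base"
    unfolding chain_bound_def by blast
  then show ?thesis
  proof cases
    case 1
    then show ?thesis using chain_base_trans unfolding chain_bound_def by blast
  next
    case 2
    then show ?thesis unfolding chain_bound_def by simp
  next
    case 3
    then show ?thesis unfolding 3(1) elts_vpair unfolding chain_bound_def by blast
  qed
qed

lemma in_H_of_subset_chain_bound: "elts x \<subseteq> chain_bound \<Longrightarrow> chain_bound \<prec> elts \<theta> \<Longrightarrow> x \<in> H \<theta>"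
  by (rule in_H_of_TC_subset[OF TC_least]) (auto dest: chain_bound_trans)

abbreviation conds_set :: 'v
  where "conds_set \<equiv> vset (chain_conds S)"

abbreviation order_set :: 'v
  where "order_set \<equiv> vset {vpair p q | p q. p \<in> chain_conds S \<and> q \<in> chain_conds S \<and> elts q \<subseteq> elts p}"

lemma elts_conds_set: "elts conds_set = chain_conds S"
  by (rule elts_vset_small[OF small_chain_conds])

lemma elts_order_set:
  "elts order_set = {vpair p q | p q. p \<in> chain_conds S \<and> q \<in> chain_conds S \<and> elts q \<subseteq> elts p}"
  by (rule elts_vset_small, rule small_subset[OF small_pairs[OF small_chain_conds[of S] small_chain_conds[of S]]])
    auto

lemma PS_eq: "PS S = vpair conds_set order_set"
  by (simp add: PS_def)

lemma PS_subset_base: "elts (PS S) \<subseteq> chain_base"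
  unfolding chain_base_def using TC_unfold[of "PS S"] by blast

lemma conds_order_set_in_base: "conds_set \<in> chain_base" "order_set \<in> chain_base"
proof -
  have "vset {conds_set, order_set} \<in> elts (PS S)" unfolding PS_eq elts_vpair by blast
  then have "elts (vset {conds_set, order_set}) \<subseteq> chain_base" using PS_subset_base chain_base_trans by blast
  then show "conds_set \<in> chain_base" "order_set \<in> chain_base" by simp_all
qed

lemma chain_conds_in_base: "p \<in> chain_conds S \<Longrightarrow> p \<in> chain_base"
  using chain_base_trans[OF conds_order_set_in_base(1)] unfolding elts_conds_set by blast

lemma S_in_base: "x \<in> elts S \<Longrightarrow> x \<in> chain_base"
proof -
  assume "x \<in> elts S"
  then obtain p i where p: "p \<in> chain_conds S" "vpair i x \<in> elts p" using S_eq by blast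
  then have "vpair i x \<in> chain_base" using chain_conds_in_base chain_base_trans by blast
  then have "vset {i, x} \<in> chain_base" using chain_base_trans[of "vpair i x"] by (simp add: elts_vpair)
  then show ?thesis using chain_base_trans[of "vset {i, x}"] by simp
qed

end

text \<open>The assumption \<open>chain_bound_N\<close> is the form in which the largeness of
  \<theta> reaches the model.\<close>

locale chain_embedding = stationary_chains \<kappa> S + elementary_embedding \<sigma> M N A B
  for \<kappa> S :: "'v::zfc" and \<sigma> M N A B +
  assumes chain_bound_N: "elts x \<subseteq> chain_bound \<Longrightarrow> x \<in> N"
begin

lemma subset_base_N: "elts x \<subseteq> chain_base \<Longrightarrow> x \<in> N"
  by (rule chain_bound_N) (auto simp: chain_bound_def)

lemma chain_conds_N: "p \<in> chain_conds S \<Longrightarrow> p \<in> N"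
  using chain_conds_in_base chain_base_trans subset_base_N by blast

lemma S_N: "S \<in> N"
  using S_in_base subset_base_N by blast

lemma conds_set_N: "conds_set \<in> N" and order_set_N: "order_set \<in> N"
  using conds_order_set_in_base chain_base_trans subset_base_N by blast+

text \<open>Subcompleteness gives an embedding with \<open>PS S\<close> in its range, while being
  spread out speaks of substructures containing \<open>S\<close>. \<open>S\<close> is the set of
  second coordinates of elements of conditions.\<close>

lemma S_in_range:
  assumes P': "P' \<in> M" "\<sigma> P' = PS S"
  shows "S \<in> \<sigma> ` M"
proof -
  obtain C' where C': "C' \<in> M" "\<sigma> C' = conds_set"
    by (rule emb_vpairD[OF P'(1) P'(2)[unfolded PS_eq]])
  let ?\<phi> = "All 2 (Iff (Mem 2 0) (Ex 3 (Conj (Mem 3 1) (Ex 4 (pmemF 3 4 2)))))"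
  obtain S' where "S' \<in> M" "\<sigma> S' = S"
  proof (rule emb_definable[of "[C']" ?\<phi> S])
    fix z assume z: "z \<in> N"
    have "sat N B ?\<phi> ((!) (z # map \<sigma> [C'])) \<longleftrightarrow>
        (\<forall>x\<in>N. x \<in> elts z \<longleftrightarrow> (\<exists>p\<in>N. p \<in> chain_conds S \<and> (\<exists>i\<in>N. pmem_in N p i x)))"
      by (simp add: C'(2) elts_conds_set)
    also have "\<dots> \<longleftrightarrow> (\<forall>x\<in>N. x \<in> elts z \<longleftrightarrow> x \<in> elts S)"
    proof (intro ball_cong refl iff_exI arg_cong[where f = "\<lambda>b. _ = b"])
      fix x assume x: "x \<in> N"
      have "(\<exists>i\<in>N. pmem_in N p i x) \<longleftrightarrow> (\<exists>i. vpair i x \<in> elts p)" if "p \<in> N" for p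
        using pmem_in_iff[OF pair_closed_N that _ x] pair_closed_mem_vpairD(1)[OF pair_closed_N that] by blast
      then show "(\<exists>p\<in>N. p \<in> chain_conds S \<and> (\<exists>i\<in>N. pmem_in N p i x)) \<longleftrightarrow> x \<in> elts S"
        unfolding S_eq using chain_conds_N by blast
    qed
    also have "\<dots> \<longleftrightarrow> elts z = elts S" using memN[OF z] memN[OF S_N] by blast
    also have "\<dots> \<longleftrightarrow> z = S" using extensionality by blast
    finally show "sat N B ?\<phi> ((!) (z # map \<sigma> [C'])) \<longleftrightarrow> z = S" .
  qed (use C' S_N in auto)
  then show ?thesis by blast
qed

text \<open>Needed for the opposite passage. Carrier, order and their pair are shown to be in the
  range one after the other, each definable from the preceding.\<close>

lemma PS_in_range:
  assumes S': "S' \<in> M" "\<sigma> S' = S"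
  shows "PS S \<in> \<sigma> ` M"
proof -
  let ?\<phi> = "All 2 (Iff (Mem 2 0) chainF)"
  obtain C' where C': "C' \<in> M" "\<sigma> C' = conds_set"
  proof (rule emb_definable[of "[S']" ?\<phi> conds_set])
    fix z assume z: "z \<in> N"
    have "sat N B ?\<phi> ((!) (z # map \<sigma> [S'])) \<longleftrightarrow> (\<forall>p\<in>N. p \<in> elts z \<longleftrightarrow> p \<in> chain_conds S)"
      by (simp add: sat_chainF[OF pair_closed_N _ _ S_N] S'(2))
    also have "\<dots> \<longleftrightarrow> elts z = elts conds_set"
      unfolding elts_conds_set using memN[OF z] chain_conds_N by blast
    also have "\<dots> \<longleftrightarrow> z = conds_set" using extensionality by blast
    finally show "sat N B ?\<phi> ((!) (z # map \<sigma> [S'])) \<longleftrightarrow> z = conds_set" .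
  qed (use S' conds_set_N in auto)
  let ?\<psi> = "All 2 (Iff (Mem 2 0) (Ex 3 (Ex 4 (Conj (pairF 2 3 4)
      (Conj (Mem 3 1) (Conj (Mem 4 1) (All 5 (Imp (Mem 5 4) (Mem 5 3)))))))))"
  obtain R' where R': "R' \<in> M" "\<sigma> R' = order_set"
  proof (rule emb_definable[of "[C']" ?\<psi> order_set])
    fix z assume z: "z \<in> N"
    have "sat N B ?\<psi> ((!) (z # map \<sigma> [C'])) \<longleftrightarrow>
      (\<forall>w\<in>N. w \<in> elts z \<longleftrightarrow> (\<exists>p\<in>N. \<exists>q\<in>N. pair_in N w p q \<and> p \<in> chain_conds S \<and> q \<in> chain_conds S \<and>
        (\<forall>x\<in>N. x \<in> elts q \<longrightarrow> x \<in> elts p)))"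
      by (simp add: C'(2) elts_conds_set)
    also have "\<dots> \<longleftrightarrow> (\<forall>w\<in>N. w \<in> elts z \<longleftrightarrow> w \<in> elts order_set)"
    proof (intro ball_cong refl arg_cong[where f = "\<lambda>b. _ = b"])
      fix w assume w: "w \<in> N"
      have sub: "(\<forall>x\<in>N. x \<in> elts q \<longrightarrow> x \<in> elts p) \<longleftrightarrow> elts q \<subseteq> elts p" if "q \<in> N" for p q
        using memN[OF that] by blast
      have "(\<exists>p\<in>N. \<exists>q\<in>N. pair_in N w p q \<and> p \<in> chain_conds S \<and> q \<in> chain_conds S \<and>
        (\<forall>x\<in>N. x \<in> elts q \<longrightarrow> x \<in> elts p)) \<longleftrightarrow>
        (\<exists>p\<in>N. \<exists>q\<in>N. w = vpair p q \<and> p \<in> chain_conds S \<and> q \<in> chain_conds S \<and> elts q \<subseteq> elts p)"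
        using w by (intro bex_cong refl) (simp add: sub pair_in_iff[OF pair_closed_N])
      also have "\<dots> \<longleftrightarrow> w \<in> elts order_set" unfolding elts_order_set using chain_conds_N by blast
      finally show "(\<exists>p\<in>N. \<exists>q\<in>N. pair_in N w p q \<and> p \<in> chain_conds S \<and> q \<in> chain_conds S \<and>
        (\<forall>x\<in>N. x \<in> elts q \<longrightarrow> x \<in> elts p)) \<longleftrightarrow> w \<in> elts order_set" .
    qed
    also have "\<dots> \<longleftrightarrow> elts z = elts order_set" using memN[OF z] memN[OF order_set_N] by blast
    also have "\<dots> \<longleftrightarrow> z = order_set" using extensionality by blast
    finally show "sat N B ?\<psi> ((!) (z # map \<sigma> [C'])) \<longleftrightarrow> z = order_set" .
  qed (use C' order_set_N in auto)
  have "\<sigma> (vpair C' R') = PS S" using emb_vpair[OF C'(1) R'(1)] C'(2) R'(2) PS_eq by simp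
  then show ?thesis using vpairM[OF C'(1) R'(1)] by (metis imageI)
qed

end

locale generic_chain_embedding = chain_embedding +
  fixes P'
  assumes P'_M: "P' \<in> M" and emb_P': "\<sigma> P' = PS S"
begin

lemma conds_order_preimage:
  obtains C' R' where "C' \<in> M" "R' \<in> M" "P' = vpair C' R'" "\<sigma> C' = conds_set" "\<sigma> R' = order_set"
  by (rule emb_vpairD[OF P'_M emb_P'[unfolded PS_eq]])

lemma conds_M: "p \<in> conds P' \<Longrightarrow> p \<in> M"
  by (rule conds_order_preimage) (use memM in \<open>auto simp: conds_def\<close>)

lemma conds_iff: "p \<in> M \<Longrightarrow> p \<in> conds P' \<longleftrightarrow> \<sigma> p \<in> chain_conds S"
proof -
  assume p: "p \<in> M"
  obtain C' R' where C: "C' \<in> M" "R' \<in> M" "P' = vpair C' R'" "\<sigma> C' = conds_set" "\<sigma> R' = order_set"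
    by (rule conds_order_preimage)
  have "p \<in> conds P' \<longleftrightarrow> p \<in> elts C'" by (simp add: conds_def C(3))
  also have "\<dots> \<longleftrightarrow> \<sigma> p \<in> chain_conds S" using mem_iff[OF p C(1)] C(4) elts_conds_set by simp
  finally show ?thesis .
qed

lemma le_iff: "p \<in> M \<Longrightarrow> q \<in> M \<Longrightarrow> le P' p q \<longleftrightarrow> le (PS S) (\<sigma> p) (\<sigma> q)"
proof -
  assume pq: "p \<in> M" "q \<in> M"
  obtain C' R' where C: "C' \<in> M" "R' \<in> M" "P' = vpair C' R'" "\<sigma> C' = conds_set" "\<sigma> R' = order_set"
    by (rule conds_order_preimage)
  have "vpair p q \<in> elts R' \<longleftrightarrow> vpair (\<sigma> p) (\<sigma> q) \<in> elts order_set"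
    using mem_iff[OF vpairM[OF pq] C(2)] C(5) emb_vpair[OF pq] by simp
  then show ?thesis
    unfolding le_def conds_iff[OF pq(1)] conds_iff[OF pq(2)] elts_PS(1) by (simp add: C(3) PS_eq)
qed

lemma forcing_order_P': "forcing_order P'"
proof (unfold_locales)
  interpret F: forcing_order "PS S" by (rule forcing_order_PS)
  show "le P' p p" if "p \<in> conds P'" for p
    using that conds_M[OF that] le_iff F.le_refl conds_iff elts_PS(1) by metis
  fix p q r assume "le P' r q" "le P' q p"
  moreover then have "p \<in> M" "q \<in> M" "r \<in> M" using conds_M unfolding le_def by blast+
  ultimately show "le P' r p" using le_iff F.le_trans by metis
qed

lemma conds_P'_nonempty: "conds P' \<noteq> {}"
proof -
  obtain C' R' where C: "C' \<in> M" "R' \<in> M" "P' = vpair C' R'" "\<sigma> C' = conds_set" "\<sigma> R' = order_set"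
    by (rule conds_order_preimage)
  have "sat N B (Ex 0 (Mem 0 1)) (\<sigma> \<circ> (!) [C', C'])"
    using chain_conds_nonempty chain_conds_N by (auto simp: C(4) elts_conds_set)
  moreover have "(!) [C', C'] ` fv (Ex 0 (Mem 0 1)) \<subseteq> M" using C(1) by simp
  ultimately have "sat M A (Ex 0 (Mem 0 1)) ((!) [C', C'])" using elem_embD[OF emb] by blast
  then show ?thesis by (auto simp: conds_def C(3))
qed

text \<open>The dense set consists of the conditions with a member containing
  \<open>\<sigma> x\<close>. It is definable from \<open>\<sigma> x\<close> and the set of
  conditions, so it is the image of some \<open>D'\<close>; its density is stated through the order
  relation and reflected to \<open>M\<close>, where genericity can use it.\<close>

lemma dense_preimage:
  assumes x: "x \<in> M" "\<sigma> x \<in> H \<kappa>"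
  obtains D' where "D' \<in> M" "dense P' (elts D')"
    "\<And>r. r \<in> elts D' \<Longrightarrow> \<exists>i X. vpair i X \<in> elts (\<sigma> r) \<and> \<sigma> x \<in> elts X"
proof -
  obtain C' R' where C: "C' \<in> M" "R' \<in> M" "P' = vpair C' R'" "\<sigma> C' = conds_set" "\<sigma> R' = order_set"
    by (rule conds_order_preimage)
  let ?D = "vset {p \<in> chain_conds S. \<exists>i X. vpair i X \<in> elts p \<and> \<sigma> x \<in> elts X}"
  have D: "elts ?D = {p \<in> chain_conds S. \<exists>i X. vpair i X \<in> elts p \<and> \<sigma> x \<in> elts X}"
    by (rule elts_vset_small, rule small_subset[OF small_chain_conds[of S]]) blast
  have DN: "?D \<in> N" by (rule subset_base_N) (use chain_conds_in_base in \<open>auto simp: D\<close>)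
  let ?\<phi> = "All 3 (Iff (Mem 3 0) (Conj (Mem 3 1) (Ex 4 (Ex 5 (Conj (pmemF 3 4 5) (Mem 2 5))))))"
  obtain D' where D': "D' \<in> M" "\<sigma> D' = ?D"
  proof (rule emb_definable[of "[C', x]" ?\<phi> ?D])
    fix z assume z: "z \<in> N"
    have "sat N B ?\<phi> ((!) (z # map \<sigma> [C', x])) \<longleftrightarrow>
      (\<forall>p\<in>N. p \<in> elts z \<longleftrightarrow> p \<in> chain_conds S \<and> (\<exists>i\<in>N. \<exists>X\<in>N. pmem_in N p i X \<and> \<sigma> x \<in> elts X))"
      by (simp add: C(4) elts_conds_set)
    also have "\<dots> \<longleftrightarrow> (\<forall>p\<in>N. p \<in> elts z \<longleftrightarrow> p \<in> elts ?D)"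
    proof (intro ball_cong refl arg_cong[where f = "\<lambda>b. _ = b"])
      fix p assume p: "p \<in> N"
      have "(\<exists>i\<in>N. \<exists>X\<in>N. pmem_in N p i X \<and> \<sigma> x \<in> elts X) \<longleftrightarrow> (\<exists>i X. vpair i X \<in> elts p \<and> \<sigma> x \<in> elts X)"
        using pmem_in_iff[OF pair_closed_N p] pair_closed_mem_vpairD[OF pair_closed_N p] by metis
      then show "p \<in> chain_conds S \<and> (\<exists>i\<in>N. \<exists>X\<in>N. pmem_in N p i X \<and> \<sigma> x \<in> elts X) \<longleftrightarrow> p \<in> elts ?D"
        unfolding D by blast
    qed
    also have "\<dots> \<longleftrightarrow> elts z = elts ?D" using memN[OF z] memN[OF DN] by blast
    also have "\<dots> \<longleftrightarrow> z = ?D" using extensionality by blast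
    finally show "sat N B ?\<phi> ((!) (z # map \<sigma> [C', x])) \<longleftrightarrow> z = ?D" .
  qed (use C x DN in auto)
  \<comment> \<open>Variables 0, 1 and 2 stand for the conditions, the dense set and the order
    relation.\<close>
  let ?\<psi> = "All 3 (Imp (Mem 3 0) (Ex 4 (Conj (Mem 4 1) (pmemF 2 4 3))))"
  have "sat N B ?\<psi> (\<sigma> \<circ> (!) [C', D', R'])"
  proof -
    have "\<exists>q\<in>N. q \<in> elts ?D \<and> pmem_in N order_set q p" if p: "p \<in> chain_conds S" for p
    proof -
      obtain q j Z where q: "q \<in> chain_conds S" "elts p \<subseteq> elts q" "vpair j Z \<in> elts q" "{\<sigma> x} \<subseteq> elts Z"
        by (rule chain_extend_containing[of p "{\<sigma> x}"]) (use p x in auto)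
      then have "q \<in> elts ?D" "vpair q p \<in> elts order_set" unfolding D elts_order_set using p by blast+
      then show ?thesis
        using pmem_in_iff[OF pair_closed_N order_set_N] chain_conds_N q(1) p by blast
    qed
    then show ?thesis by (simp add: C D' elts_conds_set)
  qed
  moreover have "(!) [C', D', R'] ` fv ?\<psi> \<subseteq> M" using C(1,2) D'(1) by auto
  ultimately have "sat M A ?\<psi> ((!) [C', D', R'])" using elem_embD[OF emb] by blast
  then have *: "\<forall>p\<in>M. p \<in> elts C' \<longrightarrow> (\<exists>q\<in>M. q \<in> elts D' \<and> pmem_in M R' q p)" by simp
  have r: "\<sigma> r \<in> elts ?D" if "r \<in> elts D'" for r using mem_iff[OF memM[OF D'(1) that] D'(1)] that D'(2) by simp
  have sub: "elts D' \<subseteq> conds P'" using r conds_iff[OF memM[OF D'(1)]] unfolding D by blast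
  have "dense P' (elts D')"
    unfolding dense_def
  proof (intro conjI ballI sub)
    fix p assume p: "p \<in> conds P'"
    then have pC: "p \<in> elts C'" "p \<in> M" using conds_M by (simp_all add: conds_def C(3))
    then obtain q where q: "q \<in> M" "q \<in> elts D'" "pmem_in M R' q p" using * by blast
    then have "vpair q p \<in> elts R'" using pmem_in_iff[OF pair_closed_M C(2) q(1) pC(2)] by blast
    then have "le P' q p" using sub q(2) p by (auto simp: le_def C(3))
    then show "\<exists>q\<in>elts D'. le P' q p" using q(2) by blast
  qed
  then show thesis using that[OF D'(1)] r unfolding D by blast
qed

text \<open>An enumeration of the set consists of pairs from \<open>chain_base\<close>, so it is a
  subset of \<open>chain_bound\<close> and lies in \<open>N\<close>.\<close>

lemma countable_range_subset:
  assumes c: "c \<in> M" "countable (elts (\<sigma> c))" "elts (\<sigma> c) \<subseteq> chain_base"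
  shows "elts (\<sigma> c) \<subseteq> \<sigma> ` M"
proof (cases "elts (\<sigma> c) = {}")
  case False
  let ?h = "from_nat_into (elts (\<sigma> c))"
  have h: "elts (\<sigma> c) = range ?h" using range_from_nat_into[OF False c(2)] by simp
  let ?f = "vset {vpair (vnat n) (?h n) | n. True}"
  have f: "elts ?f = {vpair (vnat n) (?h n) | n. True}"
    by (intro elts_vset_small small_countable) (simp add: full_SetCompr_eq)
  have "?h n \<in> chain_base" "vnat n \<in> chain_base" for n
    using h c(3) unfolding chain_base_def by blast+
  then have "elts ?f \<subseteq> chain_bound" unfolding f chain_bound_def by blast
  then have "?f \<in> N" by (rule chain_bound_N)
  then show ?thesis by (rule countable_elt_subset_range[OF c(1) _ h f])
qed simp

lemma generic_image:
  assumes G: "generic_over M P' G"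
  shows "directed (\<sigma> ` G)"
    and "(\<exists>p\<in>\<sigma> ` G. \<exists>i X. vpair i X \<in> elts p \<and> z \<in> elts X) \<longleftrightarrow> z \<in> \<sigma> ` M \<and> z \<in> H \<kappa>"
proof -
  have GP: "G \<subseteq> conds P'" "G \<noteq> {}" using G unfolding generic_over_def by blast+
  have GM: "r \<in> M" if "r \<in> G" for r using GP(1) conds_M that by blast
  have GS: "\<sigma> r \<in> chain_conds S" if "r \<in> G" for r using GP(1) conds_iff[OF GM[OF that]] that by blast
  \<comment> \<open>Countability is used twice: the chain \<open>\<sigma> r\<close> is countable, so
    its entries and with them its members are in the range; each member is countable in turn, so its
    elements are in the range too.\<close>
  have member: "X \<in> elts S \<and> X \<in> \<sigma> ` M \<and> elts X \<subseteq> \<sigma> ` M" if r: "r \<in> G" "vpair i X \<in> elts (\<sigma> r)" for r i X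
  proof -
    have "elts (\<sigma> r) \<subseteq> \<sigma> ` M"
      by (rule countable_range_subset[OF GM[OF r(1)] chain_conds_countable[OF GS[OF r(1)]]])
        (rule chain_base_trans[OF chain_conds_in_base[OF GS[OF r(1)]]])
    then obtain a where a: "a \<in> M" "\<sigma> a = vpair i X" using r(2) by (metis imageE subsetD)
    obtain X' where X': "X' \<in> M" "\<sigma> X' = X" using emb_vpairD[OF a] by metis
    have X: "X \<in> elts S" by (rule chain_conds_snd[OF GS[OF r(1)] r(2)])
    have "elts X \<subseteq> \<sigma> ` M"
      using countable_range_subset[OF X'(1)] S_countable[OF X] chain_base_trans[OF S_in_base[OF X]]
      unfolding X'(2) by blast
    then show ?thesis using X X' by blast
  qed
  have hit: "\<exists>p\<in>\<sigma> ` G. \<exists>i X. vpair i X \<in> elts p \<and> z \<in> elts X" if z: "z \<in> \<sigma> ` M" "z \<in> H \<kappa>" for z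
  proof -
    obtain x where x: "x \<in> M" "z = \<sigma> x" using z(1) by blast
    obtain D' where D': "D' \<in> M" "dense P' (elts D')"
      "\<And>r. r \<in> elts D' \<Longrightarrow> \<exists>i X. vpair i X \<in> elts (\<sigma> r) \<and> \<sigma> x \<in> elts X"
      using dense_preimage[OF x(1)] z(2) x(2) by metis
    then obtain r where "r \<in> G" "r \<in> elts D'" using G unfolding generic_over_def by blast
    then show ?thesis using D'(3) x(2) by blast
  qed
  show "(\<exists>p\<in>\<sigma> ` G. \<exists>i X. vpair i X \<in> elts p \<and> z \<in> elts X) \<longleftrightarrow> z \<in> \<sigma> ` M \<and> z \<in> H \<kappa>"
  proof
    assume "\<exists>p\<in>\<sigma> ` G. \<exists>i X. vpair i X \<in> elts p \<and> z \<in> elts X"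
    then obtain r i X where r: "r \<in> G" "vpair i X \<in> elts (\<sigma> r)" "z \<in> elts X" by blast
    note X = member[OF r(1,2)]
    have "z \<in> H \<kappa>" by (rule S_subset_H[OF _ r(3)]) (use X in blast)
    then show "z \<in> \<sigma> ` M \<and> z \<in> H \<kappa>" using X r(3) by blast
  qed (use hit in blast)
  have "\<exists>r\<in>G. elts (\<sigma> p) \<subseteq> elts (\<sigma> r) \<and> elts (\<sigma> q) \<subseteq> elts (\<sigma> r)" if pq: "p \<in> G" "q \<in> G" for p q
  proof -
    obtain r where r: "r \<in> G" "le P' r p" "le P' r q" using G pq unfolding generic_over_def by blast
    then have "le (PS S) (\<sigma> r) (\<sigma> p)" "le (PS S) (\<sigma> r) (\<sigma> q)" using le_iff GM pq by simp_all
    then show ?thesis using r(1) unfolding elts_PS by blast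
  qed
  moreover have "\<exists>q\<in>\<sigma> ` G. \<exists>j y. vpair j y \<in> elts q \<and> X \<in> elts y"
    if r: "r \<in> G" "vpair i X \<in> elts (\<sigma> r)" for r i X
  \<comment> \<open>A member of a chain is itself an element of \<open>H \<kappa>\<close> in the
    range, so genericity puts it into some member; this is the clause excluding a longest
    chain.\<close>
  proof (rule hit)
    show "X \<in> \<sigma> ` M" "X \<in> H \<kappa>" using member[OF r] S_in_H by blast+
  qed
  ultimately show "directed (\<sigma> ` G)"
    unfolding directed_def using GP(2) GS by (intro conjI ballI allI impI) auto
qed

end

text \<open>Rasiowa-Sikorski: only countably many dense sets belong to \<open>M\<close>, and the
  upward closure of a descending sequence through them is generic.\<close>

lemma (in forcing_order) ex_generic:
  assumes M: "countable M" and ne: "conds P \<noteq> {}"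
  shows "\<exists>G. generic_over M P G"
proof -
  define \<D> where "\<D> = {D \<in> M. dense P (elts D)}"
  have "countable \<D>" unfolding \<D>_def using M by simp
  \<comment> \<open>The default \<open>conds P\<close> gives the construction something to meet if
    \<open>M\<close> contains no dense set at all.\<close>
  define D where "D n = (if \<D> = {} then conds P else elts (from_nat_into \<D> n))" for n
  have dense: "\<exists>q\<in>D n. le P q p" if "p \<in> conds P" for n p
  proof (cases "\<D> = {}")
    case False
    have "from_nat_into \<D> n \<in> \<D>" by (rule from_nat_into[OF False])
    then have "dense P (D n)" unfolding D_def if_not_P[OF False] by (simp only: \<D>_def mem_Collect_eq)
    then show ?thesis using that unfolding dense_def by blast
  qed (use that le_refl in \<open>auto simp: D_def\<close>)
  obtain p0 where p0: "p0 \<in> conds P" using ne by blast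
  define c where "c = rec_nat p0 (\<lambda>n p. SOME q. q \<in> D n \<and> le P q p)"
  have c0: "c 0 = p0" and cS: "c (Suc n) = (SOME q. q \<in> D n \<and> le P q (c n))" for n by (simp_all add: c_def)
  have step: "c (Suc n) \<in> D n \<and> le P (c (Suc n)) (c n)" if "c n \<in> conds P" for n
    unfolding cS by (rule someI_ex) (use dense[OF that] in blast)
  have cc: "c n \<in> conds P" for n
    by (induction n) (use p0 c0 step le_conds in auto)
  have mono: "le P (c n) (c m)" if "m \<le> n" for m n
    using that by (induction rule: dec_induct) (use cc le_refl le_trans step in blast)+
  let ?G = "{q. \<exists>n. le P (c n) q}"
  have "generic_over M P ?G"
    unfolding generic_over_def
  proof (intro conjI ballI allI impI)
    show "?G \<subseteq> conds P" using le_conds by blast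
    show "?G \<noteq> {}" using mono by blast
    show "q \<in> ?G" if "p \<in> ?G" "le P p q" for p q using that le_trans by blast
    show "\<exists>r\<in>?G. le P r p \<and> le P r q" if pq: "p \<in> ?G" "q \<in> ?G" for p q
    proof -
      obtain m n where mn: "le P (c m) p" "le P (c n) q" using pq by blast
      have "le P (c (max m n)) p" by (rule le_trans[OF mono mn(1)]) simp
      moreover have "le P (c (max m n)) q" by (rule le_trans[OF mono mn(2)]) simp
      moreover have "c (max m n) \<in> ?G" using mono by blast
      ultimately show ?thesis by blast
    qed
    show "?G \<inter> elts E \<noteq> {}" if E: "E \<in> M" "dense P (elts E)" for E
    proof -
      have "E \<in> \<D>" using E by (simp add: \<D>_def)
      then obtain n where "from_nat_into \<D> n = E" using from_nat_into_surj[OF \<open>countable \<D>\<close>] by blast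
      then have "D n = elts E" using \<open>E \<in> \<D>\<close> by (auto simp: D_def)
      then show ?thesis using step[OF cc[of n]] mono[of "Suc n" "Suc n"] by auto
    qed
  qed
  then show ?thesis by blast
qed

section \<open>Spread out sets and infinity-subcompleteness\<close>

text \<open>The requirement at one \<theta>. Both implications are proved at this level and lifted
  by \<open>suff_largeI_small\<close>.\<close>

definition spread_out_at :: "'v::zfc \<Rightarrow> 'v \<Rightarrow> 'v \<Rightarrow> bool"
  where "spread_out_at \<kappa> S \<theta> \<longleftrightarrow> (\<forall>\<tau> A X a.
      Ord \<tau> \<and> H \<theta> \<subseteq> Lset A \<tau> \<and> ZFC_minus (Lset A \<tau>) (Lpred A \<tau>) \<and>
      X \<subseteq> Lset A \<tau> \<and> S \<in> X \<and> a \<in> X \<and> \<theta> \<in> X \<and>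
      elem_sub X (Lset A \<tau>) (Lpred A \<tau>) \<and> countable X \<and> collapse_full X (Lpred A \<tau>) \<longrightarrow>
      (\<exists>Y \<pi>. Y \<subseteq> Lset A \<tau> \<and> elem_sub Y (Lset A \<tau>) (Lpred A \<tau>) \<and>
         struct_iso \<pi> X (Lpred A \<tau> \<inter> X) Y (Lpred A \<tau> \<inter> Y) \<and> \<pi> a = a \<and>
         (\<exists>s\<in>elts S. elts s = Y \<inter> H \<kappa>)))"

lemma spread_out_iff:
  "spread_out \<kappa> S \<longleftrightarrow> stationary (H \<kappa>) S \<and> suff_large (spread_out_at \<kappa> S)"
  unfolding spread_out_def spread_out_at_def ..

definition forces_embedding :: "'v::zfc \<Rightarrow> 'v \<Rightarrow> 'v \<Rightarrow> 'v \<Rightarrow> 'v \<Rightarrow> 'v set \<Rightarrow> 'v \<Rightarrow> 'v \<Rightarrow> 'v \<Rightarrow> bool"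
  where "forces_embedding P M B N C G t u = f_ex P (\<lambda>f.
    f_and (f_elem_emb P f (check P M) (check P B) (check P N) (check P C))
   (f_and (f_app P f (check P t) (check P u))
          (f_all (\<lambda>x. f_all (\<lambda>y.
             f_imp P (f_and (f_mem P x (check P (vset G))) (f_app P f x y))
                     (f_mem P y (gen_name P)))))))"

definition inf_subcomplete_at :: "'v::zfc \<Rightarrow> 'v \<Rightarrow> bool"
  where "inf_subcomplete_at P \<theta> \<longleftrightarrow> P \<in> H \<theta> \<and>
      (\<forall>\<tau> A M B \<sigma> \<theta>' P' G' s.
         Ord \<tau> \<and> \<theta> \<in> elts \<tau> \<and> H \<theta> \<subseteq> Lset A \<tau> \<and> ZFC_minus (Lset A \<tau>) (Lpred A \<tau>) \<and>
         vtransitive M \<and> countable (elts M) \<and> elts B \<subseteq> elts M \<and> full M B \<and>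
         elem_emb \<sigma> (elts M) (elts B) (Lset A \<tau>) (Lpred A \<tau>) \<and>
         {P, \<theta>} \<subseteq> \<sigma> ` elts M \<and>
         \<theta>' \<in> elts M \<and> P' \<in> elts M \<and> \<sigma> (vpair \<theta>' P') = vpair \<theta> P \<and>
         generic_over (elts M) P' G' \<and> s \<in> elts M \<longrightarrow>
         (\<exists>p\<in>conds P. forces_embedding P M B (vset (Lset A \<tau>)) (vset (Lpred A \<tau>)) G'
            (vpair s (vpair \<theta>' P')) (\<sigma> (vpair s (vpair \<theta>' P'))) p))"

lemma inf_subcomplete_iff: "inf_subcomplete P \<longleftrightarrow> forcing P \<and> suff_large (inf_subcomplete_at P)"
  unfolding inf_subcomplete_def inf_subcomplete_at_def forces_embedding_def ..

context forcing_order
begin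

text \<open>The canonical name of \<sigma> is the witness. If \<open>x\<close> is in
  \<open>G\<close> and is mapped to \<open>y\<close>, a stronger condition decides \<open>x\<close>
  as some \<open>a\<close> in \<open>G\<close> and \<open>y\<close> as \<open>\<sigma> a\<close>;
  since \<open>p\<close> lies below \<open>\<sigma> a\<close>, this value is forced into the generic
  filter.\<close>

lemma forces_embeddingI:
  assumes \<sigma>: "elem_emb \<sigma> (elts M) (elts B) (elts N) (elts C)"
    and G: "G \<subseteq> elts M" "small G" and p: "\<And>r. r \<in> G \<Longrightarrow> le P p (\<sigma> r)" and t: "t \<in> elts M"
  shows "forces_embedding P M B N C G t (\<sigma> t) p"
proof -
  let ?f = "vset {vpair x (\<sigma> x) | x. x \<in> elts M}"
  have "{vpair x (\<sigma> x) | x. x \<in> elts M} = (\<lambda>x. vpair x (\<sigma> x)) ` elts M" by blast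
  then have f: "elts ?f = {vpair x (\<sigma> x) | x. x \<in> elts M}"
    using elts_vset_small[OF small_image[OF small_elts[of M]]] by metis
  have gen: "f_mem P y (gen_name P) q"
    if q: "le P q p" and xy: "f_mem P x (check P (vset G)) q"
      "f_app P (check P ?f) x y q" for q x y
  proof (rule reg_local[OF reg_f_mem])
    fix q' assume q': "le P q' q"
    have fD: "\<And>z. z \<in> elts ?f \<Longrightarrow> \<exists>a b. z = vpair a b" unfolding f by blast
    obtain s a b where s: "le P s q'" "vpair a b \<in> elts ?f" "f_eq P x (check P a) s"
      "f_eq P y (check P b) s"
      by (rule f_app_checkD[OF xy(2) q' fD])
    obtain r m where r: "le P r s" "m \<in> elts (vset G)" "f_eq P x (check P m) r"
      by (rule f_mem_checkD[OF xy(1) le_trans[OF s(1) q']])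
    have "f_eq P (check P a) (check P m) r"
      by (rule f_eq_trans[OF f_eq_sym[OF f_eq_mono[OF s(3) r(1)]] r(3)])
    then have "a = m" using f_eq_check_iff le_conds(1)[OF r(1)] by blast
    moreover have "b = \<sigma> a" using s(2) unfolding f by auto
    ultimately have b: "a \<in> G" "b = \<sigma> a" using r(2) elts_vset_small[OF G(2)] by auto
    have rp: "le P r p" using le_trans[OF r(1) le_trans[OF s(1) le_trans[OF q' q]]] .
    have "f_mem P (check P b) (gen_name P) r"
      by (rule f_mem_gen_nameI) (use le_trans[OF rp p[OF b(1)]] b(2) in simp)
    then have "f_mem P y (gen_name P) r"
      by (rule f_mem_eq_left[OF f_eq_sym[OF f_eq_mono[OF s(4) r(1)]]])
    then show "\<exists>s. le P s q' \<and> f_mem P y (gen_name P) s"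
      using le_trans[OF r(1) s(1)] by blast
  qed
  show ?thesis
    unfolding forces_embedding_def
  proof (rule f_exI, intro exI[of _ "check P ?f"])
    fix q assume q: "le P q p"
    have "f_elem_emb P (check P ?f) (check P M) (check P B) (check P N) (check P C) q"
      by (rule f_elem_embI_check[OF f \<sigma>])
    moreover have "f_app P (check P ?f) (check P t) (check P (\<sigma> t)) q"
      by (rule f_app_check) (use t f in blast)
    ultimately show "f_and (f_elem_emb P (check P ?f) (check P M) (check P B) (check P N) (check P C))
      (f_and (f_app P (check P ?f) (check P t) (check P (\<sigma> t)))
        (f_all (\<lambda>x. f_all (\<lambda>y.
           f_imp P (f_and (f_mem P x (check P (vset G))) (f_app P (check P ?f) x y))
             (f_mem P y (gen_name P)))))) q"
      unfolding f_and_def f_all_def f_imp_def using gen le_trans[OF _ q] by blast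
  qed
qed

end

context stationary_chains
begin

section \<open>The two implications at a fixed \<theta>\<close>

lemma PS_in_H: "chain_bound \<prec> elts \<theta> \<Longrightarrow> PS S \<in> H \<theta>"
  by (rule in_H_of_subset_chain_bound) (use PS_subset_base in \<open>auto simp: chain_bound_def\<close>)

lemma Lset_pair_closed: "ZFC_minus (Lset A \<tau>) (Lpred A \<tau>) \<Longrightarrow> pair_closed (Lset A \<tau>)"
  by (erule ZFC_minus_pair_closed) (rule Lset_transitive)

lemma full_pair_closed: "full M B \<Longrightarrow> pair_closed (elts M)"
  unfolding full_def by (rule ZFC_minus_pair_closed[of _ "elts B"]) (auto simp: vtransitive_def)

lemma chain_embeddingI:
  assumes "elem_emb \<sigma> (elts M) (elts B) (Lset A \<tau>) (Lpred A \<tau>)" "full M B"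
    and "ZFC_minus (Lset A \<tau>) (Lpred A \<tau>)" "chain_bound \<prec> elts \<theta>" "H \<theta> \<subseteq> Lset A \<tau>"
  shows "chain_embedding \<kappa> S \<sigma> (elts M) (Lset A \<tau>) (elts B) (Lpred A \<tau>)"
proof (unfold_locales)
  show "x \<in> Lset A \<tau>" if "elts x \<subseteq> chain_bound" for x
    using in_H_of_subset_chain_bound[OF that assms(4)] assms(5) by blast
qed (use assms Lset_pair_closed full_pair_closed in auto)

lemma generic_chain_embeddingI:
  assumes "elem_emb \<sigma> (elts M) (elts B) (Lset A \<tau>) (Lpred A \<tau>)" "full M B"
    and "ZFC_minus (Lset A \<tau>) (Lpred A \<tau>)" "chain_bound \<prec> elts \<theta>" "H \<theta> \<subseteq> Lset A \<tau>"
    and "P' \<in> elts M" "\<sigma> P' = PS S"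
  shows "generic_chain_embedding \<kappa> S \<sigma> (elts M) (Lset A \<tau>) (elts B) (Lpred A \<tau>) P'"
  using chain_embeddingI[OF assms(1-5)] assms(6,7)
  by (simp add: generic_chain_embedding_def generic_chain_embedding_axioms_def)

lemma elts_Lset: "elts (vset (Lset A \<tau>)) = Lset A \<tau>"
  by (rule elts_vset_small[OF small_Lset])

lemma elts_Lpred: "elts (vset (Lpred A \<tau>)) = Lpred A \<tau>"
  by (rule elts_vset_small, rule small_subset[OF small_Lset[of A \<tau>]]) blast

lemma spread_out_imp_inf_subcomplete:
  assumes "spread_out \<kappa> S"
  shows "inf_subcomplete (PS S)"
  unfolding inf_subcomplete_iff
proof (intro conjI forcing_PS,
    rule suff_largeI_small[OF conjunct2[OF assms[unfolded spread_out_iff]] small_chain_bound])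
  fix \<theta> :: 'v assume \<theta>: "Card \<theta>" "chain_bound \<prec> elts \<theta>"
  assume spread: "spread_out_at \<kappa> S \<theta>"
  let ?P = "PS S"
  have main: "\<exists>p\<in>conds ?P. forces_embedding ?P M B (vset (Lset A \<tau>)) (vset (Lpred A \<tau>)) G'
      (vpair s (vpair \<theta>' P')) (\<sigma> (vpair s (vpair \<theta>' P'))) p"
    if \<tau>: "Ord \<tau>" "H \<theta> \<subseteq> Lset A \<tau>" and N: "ZFC_minus (Lset A \<tau>) (Lpred A \<tau>)"
      and M: "countable (elts M)" "full M B"
      and \<sigma>: "elem_emb \<sigma> (elts M) (elts B) (Lset A \<tau>) (Lpred A \<tau>)"
      and \<theta>': "\<theta>' \<in> elts M" "P' \<in> elts M" "\<sigma> (vpair \<theta>' P') = vpair \<theta> ?P"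
      and G: "generic_over (elts M) P' G'" and s: "s \<in> elts M" for \<tau> A M B \<sigma> \<theta>' P' G' s
  proof -
    interpret E: chain_embedding \<kappa> S \<sigma> "elts M" "Lset A \<tau>" "elts B" "Lpred A \<tau>"
      by (rule chain_embeddingI[OF \<sigma> M(2) N \<theta>(2) \<tau>(2)])
    \<comment> \<open>Spreading out preserves a single element. Packing \<open>s\<close>,
      \<open>\<theta>'\<close> and \<open>P'\<close> into one tuple makes the isomorphism fix the
      images of all three.\<close>
    let ?t = "vpair s (vpair \<theta>' P')"
    have t: "?t \<in> elts M" using E.vpairM s \<theta>' by blast
    have \<sigma>\<theta>: "\<sigma> \<theta>' = \<theta>" "\<sigma> P' = ?P" using E.emb_vpair[OF \<theta>'(1,2)] \<theta>'(3) by simp_all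
    let ?X = "\<sigma> ` elts M"
    have iso: "struct_iso \<sigma> (elts M) (elts B) ?X (Lpred A \<tau> \<inter> ?X)" by (rule elem_emb_iso_image[OF \<sigma>])
    have "?X \<subseteq> Lset A \<tau>" using E.in_N by blast
    moreover have "S \<in> ?X" using E.S_in_range[OF \<theta>'(2) \<sigma>\<theta>(2)] .
    moreover have "\<sigma> ?t \<in> ?X" "\<theta> \<in> ?X" using t \<theta>'(1) \<sigma>\<theta>(1) by blast+
    moreover have "elem_sub ?X (Lset A \<tau>) (Lpred A \<tau>)" by (rule elem_emb_image_elem_sub[OF \<sigma>])
    moreover have "countable ?X" using M(1) by blast
    moreover have "collapse_full ?X (Lpred A \<tau>)" unfolding collapse_full_def using M(2) iso by blast
    ultimately obtain Y \<pi> x where Y: "elem_sub Y (Lset A \<tau>) (Lpred A \<tau>)"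
      and \<pi>: "struct_iso \<pi> ?X (Lpred A \<tau> \<inter> ?X) Y (Lpred A \<tau> \<inter> Y)" "\<pi> (\<sigma> ?t) = \<sigma> ?t"
      and x: "x \<in> elts S" "elts x = Y \<inter> H \<kappa>"
      using spread \<tau> N unfolding spread_out_at_def by meson
    define \<rho> where "\<rho> = \<pi> \<circ> \<sigma>"
    have \<rho>: "elem_emb \<rho> (elts M) (elts B) (Lset A \<tau>) (Lpred A \<tau>)"
      using elem_emb_trans[OF elem_emb_trans[OF struct_iso_elem_emb[OF iso] struct_iso_elem_emb[OF \<pi>(1)]]
          Y[unfolded elem_sub_def]] unfolding \<rho>_def by simp
    have \<rho>Y: "\<rho> ` elts M = Y" using \<pi>(1) unfolding \<rho>_def struct_iso_def bij_betw_def by (simp add: image_comp)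
    have \<rho>t: "\<rho> ?t = \<sigma> ?t" using \<pi>(2) by (simp add: \<rho>_def)
    interpret R: chain_embedding \<kappa> S \<rho> "elts M" "Lset A \<tau>" "elts B" "Lpred A \<tau>"
      by (rule chain_embeddingI[OF \<rho> M(2) N \<theta>(2) \<tau>(2)])
    have "\<rho> P' = ?P"
      using \<rho>t E.emb_vpair R.emb_vpair E.vpairM s \<theta>'(1,2) \<sigma>\<theta> by simp
    then interpret R: generic_chain_embedding \<kappa> S \<rho> "elts M" "Lset A \<tau>" "elts B" "Lpred A \<tau>" P'
      using generic_chain_embeddingI[OF \<rho> M(2) N \<theta>(2) \<tau>(2) \<theta>'(2)] by blast
    \<comment> \<open>The computation of the union is applied to \<rho>, whose range is
      \<open>Y\<close>; the union is therefore \<open>Y \<inter> H \<kappa>\<close>, a member of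
      \<open>S\<close>.\<close>
    have "z \<in> elts x \<longleftrightarrow> (\<exists>p\<in>\<rho> ` G'. \<exists>i X. vpair i X \<in> elts p \<and> z \<in> elts X)" for z
      unfolding R.generic_image(2)[OF G] \<rho>Y x(2) by simp
    then obtain q where q: "q \<in> chain_conds S" "\<And>p. p \<in> \<rho> ` G' \<Longrightarrow> elts p \<subseteq> elts q"
      by (rule directed_bound[OF R.generic_image(1)[OF G] x(1)]) blast
    have GP: "G' \<subseteq> conds P'" using G unfolding generic_over_def by blast
    have GM: "G' \<subseteq> elts M" using GP R.conds_M by blast
    have "le ?P q (\<rho> r)" if "r \<in> G'" for r
      unfolding elts_PS(2) using q that R.conds_iff GP GM by blast
    moreover have "small G'" using small_subset[OF small_elts GM] .
    moreover have "elem_emb \<rho> (elts M) (elts B) (elts (vset (Lset A \<tau>))) (elts (vset (Lpred A \<tau>)))"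
      unfolding elts_Lset elts_Lpred by (rule \<rho>)
    ultimately show ?thesis
      using forcing_order.forces_embeddingI[OF forcing_order_PS, of \<rho> M B "vset (Lset A \<tau>)" "vset (Lpred A \<tau>)" G' q ?t] GM t q(1)
      unfolding \<rho>t elts_PS(1) by blast
  qed
  show "inf_subcomplete_at ?P \<theta>"
    unfolding inf_subcomplete_at_def
    by (intro conjI PS_in_H[OF \<theta>(2)]; intro allI impI; elim conjE; rule main; assumption)
qed

text \<open>The domain \<open>M\<close> is countable and each value is decided densely, so
  distributivity yields one condition deciding all values; the decided function \<rho> belongs to
  the ground model.\<close>

lemma forced_embedding_decided:
  assumes M: "countable (elts M)" "elts M \<noteq> {}" and p: "p \<in> chain_conds S"
    and emb: "f_elem_emb (PS S) f (check (PS S) M) (check (PS S) B) (check (PS S) N) (check (PS S) C) p"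
  obtains q \<rho> where "le (PS S) q p" "elem_emb \<rho> (elts M) (elts B) (elts N) (elts C)"
    "\<And>m. m \<in> elts M \<Longrightarrow> f_app (PS S) f (check (PS S) m) (check (PS S) (\<rho> m)) q"
proof -
  interpret F: forcing_order "PS S" by (rule forcing_order_PS)
  let ?e = "from_nat_into (elts M)"
  let ?D = "\<lambda>n. {q. \<exists>y\<in>elts N. f_app (PS S) f (check (PS S) (?e n)) (check (PS S) y) q}"
  have e: "range ?e = elts M" by (rule range_from_nat_into[OF M(2,1)])
  obtain q where q: "q \<in> chain_conds S" "elts p \<subseteq> elts q" "\<And>n. q \<in> ?D n"
  proof (rule chain_conds_distributive[OF p, of ?D])
    fix n q assume q: "q \<in> chain_conds S" "elts p \<subseteq> elts q"
    have "?e n \<in> elts M" using e by blast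
    then obtain s y where "le (PS S) s q" "y \<in> elts N" "f_app (PS S) f (check (PS S) (?e n)) (check (PS S) y) s"
      using F.f_elem_emb_value_dense[OF emb, of "?e n" q] p q unfolding elts_PS(2) by blast
    then show "\<exists>r\<in>chain_conds S. elts q \<subseteq> elts r \<and> r \<in> ?D n" unfolding elts_PS(2) by blast
  next
    fix n q r assume "q \<in> ?D n" "q \<in> chain_conds S" "r \<in> chain_conds S" "elts q \<subseteq> elts r"
    then show "r \<in> ?D n" using F.reg_mono[OF F.reg_f_app] unfolding elts_PS(2) by blast
  qed blast
  have qp: "le (PS S) q p" using p q unfolding elts_PS(2) by blast
  define \<rho> where "\<rho> m = (SOME y. y \<in> elts N \<and> f_app (PS S) f (check (PS S) m) (check (PS S) y) q)" for m
  have \<rho>: "\<rho> m \<in> elts N \<and> f_app (PS S) f (check (PS S) m) (check (PS S) (\<rho> m)) q" if m: "m \<in> elts M" for m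
  proof -
    obtain n where "m = ?e n" using m e by blast
    then have "\<exists>y. y \<in> elts N \<and> f_app (PS S) f (check (PS S) m) (check (PS S) y) q" using q(3)[of n] by blast
    then show ?thesis unfolding \<rho>_def by (rule someI_ex)
  qed
  show thesis
    using that[OF qp F.f_elem_emb_decided[OF emb qp \<rho>]] \<rho> by blast
qed

lemma inf_subcomplete_imp_spread_out:
  assumes "inf_subcomplete (PS S)"
  shows "spread_out \<kappa> S"
  unfolding spread_out_iff
proof (intro conjI stationary,
    rule suff_largeI_small[OF conjunct2[OF assms[unfolded inf_subcomplete_iff]] small_chain_bound])
  let ?P = "PS S"
  fix \<theta> :: 'v assume \<theta>: "Card \<theta>" "chain_bound \<prec> elts \<theta>"
  assume sub: "inf_subcomplete_at ?P \<theta>"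
  interpret F: forcing_order ?P by (rule forcing_order_PS)
  have main: "\<exists>Y \<pi>. Y \<subseteq> Lset A \<tau> \<and> elem_sub Y (Lset A \<tau>) (Lpred A \<tau>) \<and>
         struct_iso \<pi> X (Lpred A \<tau> \<inter> X) Y (Lpred A \<tau> \<inter> Y) \<and> \<pi> a = a \<and>
         (\<exists>s\<in>elts S. elts s = Y \<inter> H \<kappa>)"
    if \<tau>: "Ord \<tau>" "H \<theta> \<subseteq> Lset A \<tau>" and N: "ZFC_minus (Lset A \<tau>) (Lpred A \<tau>)"
      and X: "X \<subseteq> Lset A \<tau>" "S \<in> X" "a \<in> X" "\<theta> \<in> X" "elem_sub X (Lset A \<tau>) (Lpred A \<tau>)"
        "countable X" "collapse_full X (Lpred A \<tau>)" for \<tau> A X a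
  proof -
    obtain M B \<sigma> where M: "full M B" and iso: "struct_iso \<sigma> (elts M) (elts B) X (Lpred A \<tau> \<inter> X)"
      using X(7) unfolding collapse_full_def by blast
    have bij: "bij_betw \<sigma> (elts M) X" using iso by (simp add: struct_iso_def)
    then have \<sigma>X: "\<sigma> ` elts M = X" by (simp add: bij_betw_def)
    have cM: "countable (elts M)" using bij X(6) by (metis bij_betw_def countable_image_inj_on)
    have \<sigma>: "elem_emb \<sigma> (elts M) (elts B) (Lset A \<tau>) (Lpred A \<tau>)"
      using elem_emb_trans[OF struct_iso_elem_emb[OF iso] X(5)[unfolded elem_sub_def]] by simp
    interpret E: chain_embedding \<kappa> S \<sigma> "elts M" "Lset A \<tau>" "elts B" "Lpred A \<tau>"
      by (rule chain_embeddingI[OF \<sigma> M N \<theta>(2) \<tau>(2)])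
    obtain S' where S': "S' \<in> elts M" "\<sigma> S' = S" using X(2) \<sigma>X by blast
    obtain P' where P': "P' \<in> elts M" "\<sigma> P' = ?P" using E.PS_in_range[OF S'] by force
    obtain \<theta>' where \<theta>': "\<theta>' \<in> elts M" "\<sigma> \<theta>' = \<theta>" using X(4) \<sigma>X by blast
    obtain s where s: "s \<in> elts M" "\<sigma> s = a" using X(3) \<sigma>X by blast
    interpret E: generic_chain_embedding \<kappa> S \<sigma> "elts M" "Lset A \<tau>" "elts B" "Lpred A \<tau>" P'
      by (rule generic_chain_embeddingI[OF \<sigma> M N \<theta>(2) \<tau>(2) P'])
    \<comment> \<open>Any generic filter will do here; it serves only as input to
      subcompleteness.\<close>
    obtain G' where G': "generic_over (elts M) P' G'"
      using forcing_order.ex_generic[OF E.forcing_order_P' cM E.conds_P'_nonempty] by blast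
    let ?t = "vpair s (vpair \<theta>' P')"
    have t: "?t \<in> elts M" using E.vpairM s \<theta>' P' by blast
    have "\<theta> \<in> elts \<tau>" by (rule Ord_in_Lset[OF \<tau>(1) Card_Ord[OF \<theta>(1)]]) (use X in blast)
    moreover have "\<sigma> (vpair \<theta>' P') = vpair \<theta> ?P" using E.emb_vpair \<theta>' P' by simp
    moreover have "vtransitive M" "elts B \<subseteq> elts M" using M by (simp_all add: full_def)
    moreover have "{?P, \<theta>} \<subseteq> \<sigma> ` elts M" unfolding P'(2)[symmetric] \<theta>'(2)[symmetric] using P'(1) \<theta>'(1) by blast
    ultimately obtain p0 where p0: "p0 \<in> conds ?P"
      "forces_embedding ?P M B (vset (Lset A \<tau>)) (vset (Lpred A \<tau>)) G' ?t (\<sigma> ?t) p0"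
      using sub \<tau> N M cM \<sigma> \<theta>'(1) P'(1) G' s(1) unfolding inf_subcomplete_at_def by meson
    \<comment> \<open>A forced existential provides an actual name only below some stronger
      condition.\<close>
    obtain p f where p: "le ?P p p0" "f_elem_emb ?P f (check ?P M) (check ?P B)
                       (check ?P (vset (Lset A \<tau>))) (check ?P (vset (Lpred A \<tau>))) p"
      "f_app ?P f (check ?P ?t) (check ?P (\<sigma> ?t)) p"
      and gen: "\<And>x y q. le ?P q p \<Longrightarrow> f_mem ?P x (check ?P (vset G')) q \<Longrightarrow> f_app ?P f x y q \<Longrightarrow>
        f_mem ?P y (gen_name ?P) q"
      using F.f_exD[OF p0(2)[unfolded forces_embedding_def] F.le_refl[OF p0(1)]] unfolding f_and_def f_all_def f_imp_def by blast
    have pS: "p \<in> chain_conds S" using F.le_conds(1)[OF p(1)] by (simp add: elts_PS(1))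
    obtain q \<rho> where qp: "le ?P q p"
      and \<rho>: "elem_emb \<rho> (elts M) (elts B) (Lset A \<tau>) (Lpred A \<tau>)"
      and app: "\<And>m. m \<in> elts M \<Longrightarrow> f_app ?P f (check ?P m) (check ?P (\<rho> m)) q"
      using forced_embedding_decided[OF cM _ pS p(2)] t unfolding elts_Lset elts_Lpred by blast
    have q: "q \<in> chain_conds S" using F.le_conds(1)[OF qp] by (simp add: elts_PS(1))
    \<comment> \<open>The value at the tuple was prescribed, so \<rho> agrees there with \<sigma>;
      decomposing the pairs gives \<open>\<rho> P' = PS S\<close> and
      \<open>\<rho> s = a\<close>.\<close>
    have \<rho>t: "\<sigma> ?t = \<rho> ?t" by (rule F.f_elem_emb_value_unique[OF p(2) qp p(3) app[OF t]])
    interpret R: chain_embedding \<kappa> S \<rho> "elts M" "Lset A \<tau>" "elts B" "Lpred A \<tau>"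
      by (rule chain_embeddingI[OF \<rho> M N \<theta>(2) \<tau>(2)])
    have \<rho>': "\<rho> P' = ?P" "\<rho> s = a"
      using \<rho>t E.emb_vpair R.emb_vpair E.vpairM s \<theta>' P' by simp_all
    interpret R: generic_chain_embedding \<kappa> S \<rho> "elts M" "Lset A \<tau>" "elts B" "Lpred A \<tau>" P'
      by (rule generic_chain_embeddingI[OF \<rho> M N \<theta>(2) \<tau>(2) P'(1) \<rho>'(1)])
    have GP: "G' \<subseteq> conds P'" using G' unfolding generic_over_def by blast
    have GM: "G' \<subseteq> elts M" using GP R.conds_M by blast
    have "elts (\<rho> r) \<subseteq> elts q" if r: "r \<in> G'" for r
    \<comment> \<open>\<open>q\<close> forces \<open>\<rho> r\<close> into the generic filter, so
      every extension of \<open>q\<close> is compatible with \<open>\<rho> r\<close>.\<close>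
    proof (rule chain_separative[OF q])
      show rS: "\<rho> r \<in> chain_conds S" using r R.conds_iff GP GM by blast
      fix q' assume q': "q' \<in> chain_conds S" "elts q \<subseteq> elts q'"
      have "f_mem ?P (check ?P r) (check ?P (vset G')) q"
        by (rule F.f_mem_checkI[OF _ F.f_eq_refl])
          (use r elts_vset_small[OF small_subset[OF small_elts GM]] in blast)
      then have "f_mem ?P (check ?P (\<rho> r)) (gen_name ?P) q"
        using gen[OF qp] app r GM by blast
      then obtain u where "le ?P u q'" "le ?P u (\<rho> r)"
        using F.f_mem_gen_nameD[of "\<rho> r" q q'] q q' unfolding elts_PS(2) by blast
      then show "\<exists>s\<in>chain_conds S. elts q' \<subseteq> elts s \<and> elts (\<rho> r) \<subseteq> elts s"
        unfolding elts_PS(2) by blast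
    qed
    then have bound: "\<And>p. p \<in> \<rho> ` G' \<Longrightarrow> elts p \<subseteq> elts q" by blast
    obtain x where x: "x \<in> elts S"
      "\<And>z. z \<in> elts x \<longleftrightarrow> (\<exists>p\<in>\<rho> ` G'. \<exists>i X. vpair i X \<in> elts p \<and> z \<in> elts X)"
      by (rule directed_bounded_imp[OF R.generic_image(1)[OF G'] q bound]) (assumption, rule that)
    have xY: "elts x = \<rho> ` elts M \<inter> H \<kappa>" using x(2) unfolding R.generic_image(2)[OF G'] by blast
    \<comment> \<open>The isomorphism goes back along the collapse \<sigma> and forward along
      \<rho>; it fixes \<open>a\<close> because \<sigma> and \<rho> agree at
      \<open>s\<close>.\<close>
    let ?\<pi> = "\<rho> \<circ> inv_into (elts M) \<sigma>"
    have inv: "inv_into (elts M) \<sigma> (\<sigma> m) = m" if "m \<in> elts M" for m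
      using bij that by (simp add: bij_betw_def)
    have "struct_iso ?\<pi> X (Lpred A \<tau> \<inter> X) (\<rho> ` elts M) (Lpred A \<tau> \<inter> \<rho> ` elts M)"
    proof -
      have iso': "struct_iso \<rho> (elts M) (elts B) (\<rho> ` elts M) (Lpred A \<tau> \<inter> \<rho> ` elts M)"
        by (rule elem_emb_iso_image[OF \<rho>])
      show ?thesis
        unfolding struct_iso_def
      proof (intro conjI)
        show "bij_betw ?\<pi> X (\<rho> ` elts M)"
          using iso' unfolding struct_iso_def by (intro bij_betw_trans[OF bij_betw_inv_into[OF bij]]) blast
      qed (use iso iso' inv in \<open>auto simp: struct_iso_def \<sigma>X[symmetric]\<close>)
    qed
    moreover have "?\<pi> a = a" using inv s \<rho>'(2) by auto
    moreover have "elem_sub (\<rho> ` elts M) (Lset A \<tau>) (Lpred A \<tau>)" by (rule elem_emb_image_elem_sub[OF \<rho>])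
    moreover have "\<rho> ` elts M \<subseteq> Lset A \<tau>" using R.in_N by blast
    ultimately show ?thesis using x(1) xY by blast
  qed
  show "spread_out_at \<kappa> S \<theta>"
    unfolding spread_out_at_def
    by (intro allI impI, elim conjE, rule main, assumption+)
qed

end

theorem theorem2p24:
  fixes \<kappa> S :: "'v::zfc"
  assumes "regular_cardinal \<kappa>" and "uncountable (elts \<kappa>)"
    and "stationary (H \<kappa>) S"
  shows "spread_out \<kappa> S \<longleftrightarrow> inf_subcomplete (PS S)"
proof -
  interpret stationary_chains \<kappa> S by unfold_locales (use assms in auto)
  show ?thesis using spread_out_imp_inf_subcomplete inf_subcomplete_imp_spread_out by blast
qed

end
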